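(* The $\mathbb{Z}[\tau]$-modules $\mathcal{M}_{\rm B}$ and $\mathcal{M}_{\rm F}$ have the $\mathrm{SOC}$-group $\mathrm{SO}(3,\mathbb{Q}(\sqrt5))$ and share the elementary coincidence spectrum $$\Sigma\bigl(\mathrm{SO}(3,\mathbb{Q}(\sqrt5))\bigr)=\{m\in\mathbb{N}\mid m=k^2+k\ell-\ell^2 \text{ with } k,\ell\in\mathbb{Z}\}=\{1,4,5,9,11,16,19,20,25,\ldots\}.$$ This spectrum is a (multiplicative) monoid and consists of all natural numbers that have all primes congruent to $\pm2\pmod 5$ in their factorizations occurring with an even power.
   Context: $\tau=(\sqrt5+1)/2$ is the golden ratio, $\mathbb{Z}[\tau]$ is the ring of integers of $\mathbb{Q}(\sqrt5)$, $\mathbb{N}=\{1,2,3,\ldots\}$, and $e_1,e_2,e_3$ is the standard basis of $\mathbb{R}^3$. The body centred and face centred icosahedral modules are $$\mathcal{M}_{\rm B}=\Bigl\{\sum_{i=1}^3\alpha_ie_i \,\Big|\, \alpha_i\in\mathbb{Z}[\tau],\ \tau^2\alpha_1+\tau\alpha_2+\alpha_3\equiv0\ (\mathrm{mod}\ 2)\Bigr\}=\bigl\langle(2,0,0)^t,(1,1,1)^t,(\tau,0,1)^t\bigr\rangle_{\mathbb{Z}[\tau]},$$ $$\mathcal{M}_{\rm F}=\Bigl\{\sum_{i=1}^3\alpha_ie_i \,\Big|\, \alpha_i\in\mathbb{Z}[\tau],\ \alpha_1\equiv\tau\alpha_2\equiv\tau^2\alpha_3\ (\mathrm{mod}\ 2)\Bigr\}=\bigl\langle(2,0,0)^t,(\tau+1,\tau,1)^t,(0,0,2)^t\bigr\rangle_{\mathbb{Z}[\tau]}.$$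 Two $\mathbb{Z}$-modules in $\mathbb{R}^3$ are commensurate ($\sim$) if their intersection has finite index in both. For $\Gamma\in\{\mathcal{M}_{\rm B},\mathcal{M}_{\rm F}\}$, $\mathrm{SOC}(\Gamma)=\{R\in\mathrm{SO}(3,\mathbb{R})\mid\Gamma\sim R\Gamma\}$, and for $R\in\mathrm{SOC}(\Gamma)$, $\Sigma(R)=[\Gamma:(\Gamma\cap R\Gamma)]$. The elementary coincidence spectrum of $\Gamma$ is $\Sigma(\mathrm{SOC}(\Gamma))$. *)

theory Defs
  imports
    "HOL-Analysis.Analysis"
    "HOL-Algebra.Coset"
    "HOL-Number_Theory.Cong"
begin

definition golden :: real where
  "golden = (sqrt 5 + 1) / 2"

definition Z_golden :: "real set" where
  "Z_golden = {of_int a + of_int b * golden | a b. True}"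

definition Q_sqrt5 :: "real set" where
  "Q_sqrt5 = {a + b * sqrt 5 | a b. a \<in> \<rat> \<and> b \<in> \<rat>}"

(* Congruence modulo 2 in the ring Z_golden, not in the field of all reals,
   where it would be trivial. *)
definition cong2 :: "real \<Rightarrow> real \<Rightarrow> bool" where
  "cong2 x y \<longleftrightarrow> (\<exists>z\<in>Z_golden. x - y = 2 * z)"

definition M_B :: "(real ^ 3) set" where
  "M_B = {v. (\<forall>i. v $ i \<in> Z_golden) \<and>
             cong2 (golden\<^sup>2 * v $ 1 + golden * v $ 2 + v $ 3) 0}"

definition M_F :: "(real ^ 3) set" where
  "M_F = {v. (\<forall>i. v $ i \<in> Z_golden) \<and>
             cong2 (v $ 1) (golden * v $ 2) \<and>
             cong2 (golden * v $ 2) (golden\<^sup>2 * v $ 3)}"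

definition additive_group :: "'a::ab_group_add set \<Rightarrow> 'a monoid" where
  "additive_group A = \<lparr>carrier = A, mult = (+), one = 0\<rparr>"

abbreviation cosets_in :: "'a::ab_group_add set \<Rightarrow> 'a set \<Rightarrow> 'a set set" where
  "cosets_in A B \<equiv> rcosets\<^bsub>additive_group A\<^esub> B"

(* As card is 0 on infinite sets, the value of add_index is the index of B in A
   only if that index is finite. *)
definition add_index :: "'a::ab_group_add set \<Rightarrow> 'a set \<Rightarrow> nat" where
  "add_index A B = card (cosets_in A B)"

definition commensurate :: "'a::ab_group_add set \<Rightarrow> 'a set \<Rightarrow> bool" where
  "commensurate A B \<longleftrightarrow> finite (cosets_in A (A \<inter> B)) \<and> finite (cosets_in B (A \<inter> B))"

definition SO3 :: "(real ^ 3 ^ 3) set" where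
  "SO3 = {R. orthogonal_matrix R \<and> det R = 1}"

definition SO3_Q_sqrt5 :: "(real ^ 3 ^ 3) set" where
  "SO3_Q_sqrt5 = {R \<in> SO3. \<forall>i j. R $ i $ j \<in> Q_sqrt5}"

definition SOC :: "(real ^ 3) set \<Rightarrow> (real ^ 3 ^ 3) set" where
  "SOC \<Gamma> = {R \<in> SO3. commensurate \<Gamma> ((*v) R ` \<Gamma>)}"

definition coincidence_index :: "(real ^ 3) set \<Rightarrow> real ^ 3 ^ 3 \<Rightarrow> nat" where
  "coincidence_index \<Gamma> R = add_index \<Gamma> (\<Gamma> \<inter> (*v) R ` \<Gamma>)"

definition coincidence_spectrum :: "(real ^ 3) set \<Rightarrow> nat set" where
  "coincidence_spectrum \<Gamma> = coincidence_index \<Gamma> ` SOC \<Gamma>"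

end

theory Submission
  imports Defs "HOL-Number_Theory.Quadratic_Reciprocity"
begin

text \<open>
  Write \<open>\<O> = \<int>[\<tau>]\<close> and \<open>K = \<rat>(\<surd>5)\<close>, let a prime denote the conjugation of \<open>K\<close>, and let \<open>I\<close> be
  the ring of icosians, a maximal order in the quaternion algebra over \<open>K\<close>. The module \<open>M_F\<close>
  consists of the doubles of the pure icosians and \<open>M_B\<close> of the doubles of the imaginary parts of
  all icosians (\<open>M_F_iff\<close>, \<open>M_B_iff\<close>), so that both are governed by conjugation in \<open>I\<close>. Let \<open>\<Gamma>\<close> be
  one of them.

  The coincidence group is elementary. If \<open>R \<Gamma>\<close> is commensurate with \<open>\<Gamma>\<close>, then \<open>R\<close> maps some multiple
  of each standard basis vector into \<open>\<Gamma>\<close>, so its entries lie in \<open>K\<close>. Conversely a common denominator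
  of the entries of \<open>R\<close> bounds the index (\<open>SOC_icosahedral_module\<close>).

  Every index is a norm. The quotient \<open>\<Gamma> / (\<Gamma> \<inter> R \<Gamma>)\<close> is a finite \<open>\<O>\<close>-module. It has a filtration
  whose quotients are generated by one element of prime order \<open>p\<close>; they have order \<open>p\<^sup>2\<close>, which is the
  norm of \<open>p\<close>, or order \<open>p\<close>, in which case \<open>\<tau>\<close> acts as a root of \<open>c\<^sup>2 - c - 1\<close> modulo \<open>p\<close> and \<open>p\<close> is itself
  a norm (\<open>index_is_golden_norm\<close>).

  Every norm \<open>m = \<alpha> \<alpha>'\<close> is an index. Suppose an icosian \<open>h\<close> has a norm divisible by \<open>\<alpha>\<close> and a trace
  prime to \<open>m\<close>. Icosians have Euclidean division, so the right ideal \<open>h I + \<alpha> I\<close> has a generator \<open>q\<close>,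
  and the condition on the trace makes the norm of \<open>q\<close> an associate of \<open>\<alpha>\<close> (\<open>icosian_gcd\<close>). Let \<open>R\<close>
  be conjugation by \<open>q\<close>. Then an icosian \<open>w\<close> lies in \<open>q I q\<^sup>-\<^sup>1\<close> if and only if \<open>\<alpha>\<close> divides \<open>q\<^sup>* w q\<close>, which
  happens if and only if \<open>\<alpha>\<close> divides \<open>h\<^sup>* w h\<close> (\<open>qdvd_conjugate_iff\<close>). Modulo \<open>\<alpha>\<close> the map
  \<open>w \<mapsto> h\<^sup>* w h\<close> has rank one, so this is one linear condition \<open>L v \<in> \<alpha> \<O>\<close> on the vector \<open>v\<close> that
  belongs to \<open>w\<close>. It follows that \<open>\<Gamma> / (\<Gamma> \<inter> R \<Gamma>)\<close> is isomorphic to \<open>\<O> / \<alpha> \<O>\<close>, a ring with \<open>m\<close>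
  elements (\<open>coincidence_index_from_functional\<close>). For odd \<open>m\<close> one may take \<open>h = 1 + x i + y j\<close> with
  \<open>m\<close> dividing \<open>x\<^sup>2 + y\<^sup>2 + 1\<close>; for \<open>m = 4 ^ k\<close> one may take \<open>h = z - g\<close>, where \<open>g\<close> is an icosian with
  \<open>g\<^sup>2 - g + 2 = 0\<close> and \<open>z\<close> is an integral root of this polynomial modulo a power of \<open>2\<close>. Since every
  even norm is \<open>4\<close> times a norm and indices multiply when they are coprime
  (\<open>has_coincidence_index_mult\<close>), this covers all norms.

  The description by prime factorizations is the arithmetic of the form \<open>k\<^sup>2 + k l - l\<^sup>2\<close>: primes
  congruent to \<open>\<plusminus>2\<close> modulo \<open>5\<close> divide a value only together with \<open>k\<close> and \<open>l\<close>, by quadratic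
  reciprocity (for the prime \<open>2\<close>, by parity), and all other primes are values by Thue's argument.
\<close>

section \<open>Integers of the form \<open>k\<^sup>2 + k l - l\<^sup>2\<close>\<close>

definition is_golden_norm :: "int \<Rightarrow> bool" where
  "is_golden_norm n \<longleftrightarrow> (\<exists>k l :: int. n = k\<^sup>2 + k * l - l\<^sup>2)"

lemma is_golden_normI: "n = k\<^sup>2 + k * l - l\<^sup>2 \<Longrightarrow> is_golden_norm n"
  unfolding is_golden_norm_def by blast

lemma is_golden_norm_square: "is_golden_norm (n\<^sup>2)"
  by (rule is_golden_normI[of _ n 0]) simp

text \<open>The form is the norm of \<open>k + l \<tau>\<close>, so the product of two values comes from multiplying two
  golden integers.\<close>

lemma is_golden_norm_mult:
  assumes "is_golden_norm m" "is_golden_norm n"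
  shows "is_golden_norm (m * n)"
proof -
  obtain k l k' l' where mn: "m = k\<^sup>2 + k * l - l\<^sup>2" "n = k'\<^sup>2 + k' * l' - l'\<^sup>2"
    using assms unfolding is_golden_norm_def by blast
  have "m * n = (k * k' + l * l')\<^sup>2 + (k * k' + l * l') * (k * l' + l * k' + l * l')
      - (k * l' + l * k' + l * l')\<^sup>2"
    unfolding mn by (simp add: power2_eq_square algebra_simps)
  then show ?thesis by (rule is_golden_normI)
qed

text \<open>Multiplication by the unit \<open>\<tau>\<close>, whose norm is \<open>-1\<close>.\<close>

lemma is_golden_norm_uminus:
  assumes "is_golden_norm n"
  shows "is_golden_norm (- n)"
proof -
  obtain k l where "n = k\<^sup>2 + k * l - l\<^sup>2"
    using assms unfolding is_golden_norm_def by blast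
  then have "- n = l\<^sup>2 + l * (k + l) - (k + l)\<^sup>2"
    by (simp add: power2_eq_square algebra_simps)
  then show ?thesis by (rule is_golden_normI)
qed

lemma even_golden_norm:
  fixes k l :: int
  assumes "even (k\<^sup>2 + k * l - l\<^sup>2)"
  shows "even k \<and> even l"
  using assms by auto

text \<open>Infinite descent: a value that is even forces both arguments to be even. This carries the
  irrationality of \<open>\<surd>5\<close>.\<close>

lemma golden_norm_eq_0:
  fixes k l :: int
  assumes "k\<^sup>2 + k * l - l\<^sup>2 = 0"
  shows "k = 0 \<and> l = 0"
  using assms
proof (induction "nat (\<bar>k\<bar> + \<bar>l\<bar>)" arbitrary: k l rule: less_induct)
  case less
  show ?case
  proof (rule ccontr)
    assume nz: "\<not> ?case"
    have "even k" "even l" using even_golden_norm[of k l] less.prems by simp_all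
    then obtain k' l' where kl: "k = 2 * k'" "l = 2 * l'" by (elim evenE)
    have "k'\<^sup>2 + k' * l' - l'\<^sup>2 = 0"
      using less.prems kl by (simp add: power2_eq_square)
    moreover have "nat (\<bar>k'\<bar> + \<bar>l'\<bar>) < nat (\<bar>k\<bar> + \<bar>l\<bar>)"
      using nz kl by auto
    ultimately show False using less.hyps[of k' l'] nz kl by auto
  qed
qed

lemma golden_norm_abs_le:
  fixes k l s :: int
  assumes "\<bar>k\<bar> \<le> s" "\<bar>l\<bar> \<le> s"
  shows "4 * \<bar>k\<^sup>2 + k * l - l\<^sup>2\<bar> \<le> 5 * s\<^sup>2"
proof -
  have "k\<^sup>2 \<le> s\<^sup>2" "l\<^sup>2 \<le> s\<^sup>2"
    using power_mono[OF assms(1), of 2] power_mono[OF assms(2), of 2] by simp_all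
  moreover have "4 * (k\<^sup>2 + k * l - l\<^sup>2) = 5 * k\<^sup>2 - (2 * l - k)\<^sup>2"
    and "4 * (k\<^sup>2 + k * l - l\<^sup>2) = (2 * k + l)\<^sup>2 - 5 * l\<^sup>2"
    by (simp_all add: power2_eq_square algebra_simps)
  moreover have "0 \<le> (2 * l - k)\<^sup>2" "0 \<le> (2 * k + l)\<^sup>2" by simp_all
  ultimately show ?thesis by linarith
qed

text \<open>Thue's argument: two of the more than \<open>p\<close> pairs of numbers up to \<open>\<surd>p\<close> have the same residue \<open>i + c j\<close>, and
  their difference \<open>(k, l)\<close> gives a nonzero value divisible by \<open>p\<close> of absolute value at most
  \<open>5 p / 4\<close>, hence \<open>\<plusminus>p\<close>.\<close>

lemma is_golden_norm_prime:
  fixes p :: nat and c :: int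
  assumes p: "prime p" and c: "int p dvd c\<^sup>2 - c - 1"
  shows "is_golden_norm (int p)"
proof -
  define s where "s = nat \<lfloor>sqrt (real p)\<rfloor>"
  have s_le: "real s \<le> sqrt (real p)" and s_gt: "sqrt (real p) < real s + 1"
    unfolding s_def by (simp_all add: floor_correct) 
  have "(real s)\<^sup>2 \<le> (sqrt (real p))\<^sup>2" using s_le by (intro power_mono) auto
  then have "real (s\<^sup>2) \<le> real p" by simp
  then have s2: "s\<^sup>2 \<le> p" by linarith
  have "(sqrt (real p))\<^sup>2 < (real s + 1)\<^sup>2" using s_gt by (intro power_strict_mono) auto
  then have "real p < real ((s + 1)\<^sup>2)" by (simp add: algebra_simps)
  then have s3: "p < (s + 1)\<^sup>2" by linarith
  define f where "f = (\<lambda>(i, j). (int i + c * int j) mod int p)"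
  have p0: "p > 0" using p prime_gt_0_nat by blast
  have "f ` ({..s} \<times> {..s}) \<subseteq> {0..<int p}"
    unfolding f_def using p0 by auto
  then have "card (f ` ({..s} \<times> {..s})) \<le> p"
    using card_mono[of "{0..<int p}"] by fastforce
  moreover have "card ({..s} \<times> {..s}) = (s + 1)\<^sup>2"
    by (simp add: power2_eq_square)
  ultimately have "\<not> inj_on f ({..s} \<times> {..s})"
    using s3 card_image by fastforce
  then obtain i j i' j' where ij: "i \<le> s" "j \<le> s" "i' \<le> s" "j' \<le> s" "(i, j) \<noteq> (i', j')"
    and feq: "f (i, j) = f (i', j')"
    unfolding inj_on_def by blast
  define k where "k = int i - int i'"
  define l where "l = int j - int j'"
  have kl: "\<bar>k\<bar> \<le> int s" "\<bar>l\<bar> \<le> int s" unfolding k_def l_def using ij by auto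
  have "int p dvd (int i + c * int j) - (int i' + c * int j')"
    using feq unfolding f_def by (simp add: mod_eq_dvd_iff)
  then have d1: "int p dvd k + c * l"
    unfolding k_def l_def by (simp add: algebra_simps)
  have "k\<^sup>2 + k * l - l\<^sup>2 = (k + c * l) * (k - c * l + l) + l\<^sup>2 * (c\<^sup>2 - c - 1)"
    by (simp add: power2_eq_square algebra_simps)
  then have dvd: "int p dvd k\<^sup>2 + k * l - l\<^sup>2"
    using d1 c by simp
  then obtain t where t: "k\<^sup>2 + k * l - l\<^sup>2 = int p * t" by blast
  have "4 * \<bar>k\<^sup>2 + k * l - l\<^sup>2\<bar> \<le> 5 * (int s)\<^sup>2" using golden_norm_abs_le[OF kl] .
  also have "\<dots> \<le> 5 * int p"
  proof -
    have "int (s\<^sup>2) \<le> int p" using s2 by linarith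
    then show ?thesis by simp
  qed
  finally have "4 * (int p * \<bar>t\<bar>) \<le> 5 * int p" by (simp add: t abs_mult)
  then have "int p * (4 * \<bar>t\<bar>) \<le> int p * 5" by (simp add: algebra_simps)
  then have "4 * \<bar>t\<bar> \<le> 5" using p0 by simp
  moreover have "t \<noteq> 0"
    using golden_norm_eq_0[of k l] ij t unfolding k_def l_def by auto
  ultimately have "t = 1 \<or> t = -1" by auto
  moreover have "is_golden_norm (int p * t)" using t is_golden_normI by metis
  ultimately show ?thesis using is_golden_norm_uminus[of "int p * t"] by auto
qed

lemma Legendre_5:
  assumes "\<not> [a = 0] (mod 5)"
  shows "Legendre a 5 = (if [a = 1] (mod 5) \<or> [a = -1] (mod 5) then 1 else -1)"
proof -
  have "QuadRes 5 a \<longleftrightarrow> [a = 1] (mod 5) \<or> [a = -1] (mod 5)"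
  proof
    assume "QuadRes 5 a"
    then obtain y where y: "[y\<^sup>2 = a] (mod 5)" unfolding QuadRes_def by blast
    have "y mod 5 = 0 \<or> y mod 5 = 1 \<or> y mod 5 = 2 \<or> y mod 5 = 3 \<or> y mod 5 = 4" by presburger
    then have "(y mod 5)\<^sup>2 mod 5 = 0 \<or> (y mod 5)\<^sup>2 mod 5 = 1 \<or> (y mod 5)\<^sup>2 mod 5 = 4"
      by (elim disjE) simp_all
    then have "y\<^sup>2 mod 5 = 0 \<or> y\<^sup>2 mod 5 = 1 \<or> y\<^sup>2 mod 5 = 4"
      by (simp add: power_mod)
    then show "[a = 1] (mod 5) \<or> [a = -1] (mod 5)"
      using y assms unfolding cong_def by auto
  next
    assume "[a = 1] (mod 5) \<or> [a = -1] (mod 5)"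
    then have "[1\<^sup>2 = a] (mod 5) \<or> [2\<^sup>2 = a] (mod 5)" unfolding cong_def by auto
    then show "QuadRes 5 a" unfolding QuadRes_def by blast
  qed
  then show ?thesis using assms unfolding Legendre_def by simp
qed

lemma QuadRes_5_iff:
  fixes p :: nat
  assumes p: "prime p" "p \<noteq> 2" "p \<noteq> 5"
  shows "QuadRes (int p) 5 \<longleftrightarrow> [int p = 1] (mod 5) \<or> [int p = -1] (mod 5)"
proof -
  have p2: "2 < p" using p prime_ge_2_nat[of p] by linarith
  have p5: "\<not> [int p = 0] (mod 5)"
  proof
    assume "[int p = 0] (mod 5)"
    then have "5 dvd p" by (auto simp: cong_0_iff) presburger
    then show False using p primes_dvd_imp_eq[of 5 p] by simp
  qed
  have p5': "\<not> [5 = 0] (mod int p)"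
  proof
    assume "[5 = 0] (mod int p)"
    then have "int p dvd int 5" by (simp add: cong_0_iff)
    then have "p dvd 5" using int_dvd_int_iff by blast
    then show False using p primes_dvd_imp_eq[of p 5] by simp
  qed
  have "Legendre (int p) (int 5) * Legendre (int 5) (int p) = (-1::int) ^ ((p - 1) div 2 * ((5 - 1) div 2))"
    by (rule Quadratic_Reciprocity) (use p p2 in auto)
  then have "Legendre (int p) 5 * Legendre 5 (int p) = 1" by simp
  then show ?thesis
    using Legendre_5[OF p5] p5' unfolding Legendre_def[of 5] by (auto split: if_splits)
qed

text \<open>Since \<open>4 (k\<^sup>2 + k l - l\<^sup>2) = (2 k + l)\<^sup>2 - 5 l\<^sup>2\<close>, a prime that divides this value but not \<open>l\<close> would
  make \<open>5\<close> a quadratic residue. The prime \<open>2\<close> is covered by parity.\<close>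

lemma inert_prime_dvd_golden_norm:
  fixes p :: nat and k l :: int
  assumes p: "prime p" and inert: "[int p = 2] (mod 5) \<or> [int p = - 2] (mod 5)"
    and dvd: "int p dvd k\<^sup>2 + k * l - l\<^sup>2"
  shows "int p dvd k \<and> int p dvd l"
proof (cases "p = 2")
  case True
  then show ?thesis using even_golden_norm dvd by auto
next
  case False
  have p5: "p \<noteq> 5" using inert by (auto simp: cong_def)
  have n: "\<not> QuadRes (int p) 5"
    using QuadRes_5_iff[OF p False p5] inert by (auto simp: cong_def)
  have pp: "prime (int p)" using p by simp
  have "int p dvd l"
  proof (rule ccontr)
    assume "\<not> int p dvd l"
    then have "coprime l (int p)" using pp prime_imp_coprime coprime_commute by blast
    then obtain r where r: "[l * r = 1] (mod int p)" using cong_solve_coprime_int by blast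
    have "((2 * k + l) * r)\<^sup>2 - 5 = 4 * r\<^sup>2 * (k\<^sup>2 + k * l - l\<^sup>2) + 5 * ((l * r - 1) * (l * r + 1))"
      by (simp add: power2_eq_square algebra_simps)
    moreover have "int p dvd l * r - 1" using r by (simp add: cong_iff_dvd_diff)
    ultimately have "int p dvd ((2 * k + l) * r)\<^sup>2 - 5"
      using dvd by (metis dvd_add dvd_mult dvd_mult2)
    then have "QuadRes (int p) 5" unfolding QuadRes_def by (auto simp: cong_iff_dvd_diff)
    with n show False by blast
  qed
  moreover have "k\<^sup>2 = (k\<^sup>2 + k * l - l\<^sup>2) + l * (l - k)"
    by (simp add: power2_eq_square algebra_simps)
  ultimately have "int p dvd k\<^sup>2" using dvd by (metis dvd_add dvd_mult2)
  then have "int p dvd k" using pp prime_dvd_power by blast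
  with \<open>int p dvd l\<close> show ?thesis by blast
qed

lemma golden_root_mod_prime:
  fixes p :: nat
  assumes p: "prime p" and ninert: "\<not> ([int p = 2] (mod 5) \<or> [int p = - 2] (mod 5))"
  shows "\<exists>c. int p dvd c\<^sup>2 - c - 1"
proof (cases "p = 5")
  case True
  then have "int p dvd 3\<^sup>2 - 3 - 1" by simp
  then show ?thesis by blast
next
  case False
  have p2: "p \<noteq> 2" using ninert by (auto simp: cong_def)
  have "\<not> 5 dvd p" using p False primes_dvd_imp_eq[of 5 p] by auto
  then have "int p mod 5 \<noteq> 0" by presburger
  moreover have "0 \<le> int p mod 5" "int p mod 5 < 5" by simp_all
  ultimately have "[int p = 1] (mod 5) \<or> [int p = -1] (mod 5)"
    using ninert unfolding cong_def by auto
  then obtain y where y: "int p dvd y\<^sup>2 - 5"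
    using QuadRes_5_iff[OF p p2 False] unfolding QuadRes_def by (auto simp: cong_iff_dvd_diff)
  have "odd p" using p p2 prime_odd_nat prime_ge_2_nat[of p] by (metis le_neq_implies_less)
  then obtain h' where "p = 2 * h' + 1" by (elim oddE)
  then have h: "int p = 2 * int h' + 1" by simp
  define h where "h = int h'"
  note h = h[folded h_def]
  \<comment> \<open>Modulo \<open>p\<close> the inverse of \<open>2\<close> is \<open>-h\<close>, so this is \<open>(1 + y) / 2\<close>.\<close>
  define c where "c = - h * (1 + y)"
  have "c\<^sup>2 - c - 1 = h\<^sup>2 * (y\<^sup>2 - 5) + int p * (3 * h - 1 + y * h)"
    unfolding c_def h by (simp add: power2_eq_square algebra_simps)
  then have "int p dvd c\<^sup>2 - c - 1" using y by (metis dvd_add dvd_mult dvd_triv_left)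
  then show ?thesis by blast
qed

text \<open>Both directions remove one prime from \<open>m\<close> at a time: squares of inert primes, and single other
  primes.\<close>

lemma golden_norm_iff_even_multiplicity:
  fixes m :: nat
  assumes "m \<ge> 1"
  shows "is_golden_norm (int m) \<longleftrightarrow>
    (\<forall>p :: nat. prime p \<and> ([int p = 2] (mod 5) \<or> [int p = - 2] (mod 5)) \<longrightarrow> even (multiplicity p m))"
    (is "_ \<longleftrightarrow> (\<forall>p. ?inert p \<longrightarrow> _)")
proof
  assume "is_golden_norm (int m)"
  then show "\<forall>p. ?inert p \<longrightarrow> even (multiplicity p m)" using assms
  proof (induction m rule: less_induct)
    case (less m)
    show ?case
    proof (intro allI impI)
      fix p assume p: "?inert p"
      show "even (multiplicity p m)"
      proof (cases "p dvd m")
        case False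
        then show ?thesis by (simp add: not_dvd_imp_multiplicity_0)
      next
        case True
        obtain k l where kl: "int m = k\<^sup>2 + k * l - l\<^sup>2"
          using less.prems unfolding is_golden_norm_def by blast
        have "int p dvd int m" using True by simp
        then have "int p dvd k \<and> int p dvd l"
          using inert_prime_dvd_golden_norm[of p k l] p kl by simp
        then obtain k' l' where "k = int p * k'" "l = int p * l'" by (elim conjE dvdE)
        then have mm: "int m = (int p)\<^sup>2 * (k'\<^sup>2 + k' * l' - l'\<^sup>2)"
          using kl by (simp add: power2_eq_square algebra_simps)
        have pp: "p > 1" using p prime_gt_1_nat by blast
        define n where "n = nat (k'\<^sup>2 + k' * l' - l'\<^sup>2)"
        have "0 < (int p)\<^sup>2 * (k'\<^sup>2 + k' * l' - l'\<^sup>2)" using mm less.prems by linarith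
        then have pos: "k'\<^sup>2 + k' * l' - l'\<^sup>2 > 0" 
          by (rule zero_less_mult_pos) (use pp in simp)
        then have n: "int n = k'\<^sup>2 + k' * l' - l'\<^sup>2" "n \<ge> 1" unfolding n_def by auto
        have "int m = int (p\<^sup>2 * n)" using mm n by simp
        then have mn: "m = p\<^sup>2 * n" by linarith
        have "n < p\<^sup>2 * n" using n pp by (simp add: power2_eq_square one_less_mult)
        then have ev: "even (multiplicity p n)"
          using less.IH[of n] p n is_golden_normI mn by metis
        have "multiplicity p m = 2 + multiplicity p n"
          using mn p n pp by (simp add: prime_elem_multiplicity_mult_distrib prime_elem_multiplicity_power_distrib)
        then show ?thesis using ev by simp
      qed
    qed
  qed
next
  assume "\<forall>p. ?inert p \<longrightarrow> even (multiplicity p m)"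
  then show "is_golden_norm (int m)" using assms
  proof (induction m rule: less_induct)
    case (less m)
    show ?case
    proof (cases "m = 1")
      case True
      then show ?thesis by (auto intro: is_golden_normI[of _ 1 0])
    next
      case False
      then obtain p where p: "prime p" "p dvd m" using prime_factor_nat by blast
      have p1: "p > 1" using p prime_gt_1_nat by blast
      have pe: "prime_elem p" using p by simp
      show ?thesis
      proof (cases "?inert p")
        case True
        have "multiplicity p m \<noteq> 0" using p less.prems by (simp add: prime_multiplicity_gt_zero_iff) 
        moreover have "even (multiplicity p m)" using less.prems True by blast
        ultimately have "2 \<le> multiplicity p m" by presburger
        then obtain n where mn: "m = p\<^sup>2 * n" using multiplicity_dvd' by blast
        have n: "n \<ge> 1" using mn less.prems by (cases n) auto
        have "n < m" using n p1 mn by (simp add: power2_eq_square one_less_mult)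
        moreover have "even (multiplicity q n)" if "?inert q" for q
        proof -
          have "multiplicity q m = 2 * multiplicity q p + multiplicity q n"
            using that mn n p1 by (simp add: prime_elem_multiplicity_mult_distrib prime_elem_multiplicity_power_distrib)
          moreover have "even (multiplicity q m)" using less.prems that by blast
          ultimately show ?thesis by simp
        qed
        ultimately have "is_golden_norm (int n)" using less.IH n by blast
        then show ?thesis using mn is_golden_norm_mult is_golden_norm_square by simp
      next
        case ninert: False
        obtain n where mn: "m = p * n" using p by blast
        have n: "n \<ge> 1" using mn less.prems by (cases n) auto
        have "n < m" using n p1 mn by simp
        moreover have "even (multiplicity q n)" if "?inert q" for q
        proof -
          have "q \<noteq> p" using ninert that by blast
          then have "multiplicity q p = 0" using p that
            by (auto intro!: not_dvd_imp_multiplicity_0 dest: primes_dvd_imp_eq)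
          then have "multiplicity q m = multiplicity q n"
            using that mn n p1 by (simp add: prime_elem_multiplicity_mult_distrib)
          moreover have "even (multiplicity q m)" using less.prems that by blast
          ultimately show ?thesis by simp
        qed
        ultimately have "is_golden_norm (int n)" using less.IH n by blast
        moreover have "is_golden_norm (int p)"
          using golden_root_mod_prime[of p] ninert p is_golden_norm_prime by blast
        ultimately show ?thesis using mn is_golden_norm_mult by simp
      qed
    qed
  qed
qed

text \<open>The primes \<open>2, 3, 7, 13, 17, 23\<close> are the inert ones below \<open>25\<close>; a number up
  to \<open>25\<close>, other than \<open>8\<close>, in which one of them has an odd exponent is divisible by an inert prime but
  not by its square.\<close>

lemma golden_norms_upto_25:
  "{m :: nat. m \<ge> 1 \<and> (\<exists>k l :: int. int m = k\<^sup>2 + k * l - l\<^sup>2) \<and> m \<le> 25} = {1, 4, 5, 9, 11, 16, 19, 20, 25}"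
  (is "?L = ?R")
proof
  show "?L \<subseteq> ?R"
  proof
    fix m assume m: "m \<in> ?L"
    then have norm: "is_golden_norm (int m)" and m25: "1 \<le> m" "m \<le> 25"
      unfolding is_golden_norm_def by auto
    then have ev: "even (multiplicity p m)" if "prime p" "p mod 5 = 2 \<or> p mod 5 = 3" for p :: nat
    proof -
      have "int p mod 5 = 2 \<or> int p mod 5 = 3"
        using that(2) by (metis of_nat_mod of_nat_numeral)
      then have "[int p = 2] (mod 5) \<or> [int p = - 2] (mod 5)"
        unfolding cong_def by auto
      then show ?thesis using that norm m25 golden_norm_iff_even_multiplicity[of m] by blast
    qed
    have sq: "p dvd m \<Longrightarrow> p\<^sup>2 dvd m" if "prime p" "p mod 5 = 2 \<or> p mod 5 = 3" for p :: nat
    proof -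
      assume "p dvd m"
      then have "multiplicity p m \<noteq> 0" using that m25 by (simp add: prime_multiplicity_gt_zero_iff)
      then have "2 \<le> multiplicity p m" using ev[OF that] by presburger
      then show ?thesis by (rule multiplicity_dvd')
    qed
    have "2 dvd m \<Longrightarrow> 4 dvd m" "3 dvd m \<Longrightarrow> 9 dvd m" "7 dvd m \<Longrightarrow> 49 dvd m"
      "13 dvd m \<Longrightarrow> 169 dvd m" "17 dvd m \<Longrightarrow> 289 dvd m" "23 dvd m \<Longrightarrow> 529 dvd m"
      using sq[of 2] sq[of 3] sq[of 7] sq[of 13] sq[of 17] sq[of 23] by simp_all
    moreover have "m \<noteq> 8"
    proof
      assume "m = 8"
      then have "multiplicity 2 m = 3" using multiplicity_same_power[of "2::nat" 3] by simp
      then show False using ev[of 2] by simp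
    qed
    moreover have "\<forall>m\<in>set [1..<26]. (2 dvd m \<longrightarrow> 4 dvd m) \<and> (3 dvd m \<longrightarrow> 9 dvd m) \<and> (7 dvd m \<longrightarrow> 49 dvd m)
        \<and> (13 dvd m \<longrightarrow> 169 dvd m) \<and> (17 dvd m \<longrightarrow> 289 dvd m) \<and> (23 dvd m \<longrightarrow> 529 dvd m) \<and> m \<noteq> 8
        \<longrightarrow> m \<in> ?R"
      by code_simp
    moreover have "m \<in> set [1..<26]" using m25 by simp
    ultimately show "m \<in> ?R" by blast
  qed
  show "?R \<subseteq> ?L"
  proof -
    have "\<exists>k l :: int. 1 = k\<^sup>2 + k * l - l\<^sup>2" by (rule exI[of _ 1], rule exI[of _ 0]) simp
    moreover have "\<exists>k l :: int. 4 = k\<^sup>2 + k * l - l\<^sup>2" by (rule exI[of _ 2], rule exI[of _ 0]) simp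
    moreover have "\<exists>k l :: int. 5 = k\<^sup>2 + k * l - l\<^sup>2" by (rule exI[of _ 2], rule exI[of _ 1]) simp
    moreover have "\<exists>k l :: int. 9 = k\<^sup>2 + k * l - l\<^sup>2" by (rule exI[of _ 3], rule exI[of _ 0]) simp
    moreover have "\<exists>k l :: int. 11 = k\<^sup>2 + k * l - l\<^sup>2" by (rule exI[of _ 3], rule exI[of _ 1]) simp
    moreover have "\<exists>k l :: int. 16 = k\<^sup>2 + k * l - l\<^sup>2" by (rule exI[of _ 4], rule exI[of _ 0]) simp
    moreover have "\<exists>k l :: int. 19 = k\<^sup>2 + k * l - l\<^sup>2" by (rule exI[of _ 4], rule exI[of _ 1]) simp
    moreover have "\<exists>k l :: int. 20 = k\<^sup>2 + k * l - l\<^sup>2" by (rule exI[of _ 4], rule exI[of _ 2]) simp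
    moreover have "\<exists>k l :: int. 25 = k\<^sup>2 + k * l - l\<^sup>2" by (rule exI[of _ 5], rule exI[of _ 0]) simp
    ultimately show ?thesis by simp
  qed
qed

section \<open>Two congruences\<close>

text \<open>The squares and the numbers \<open>-1 - y\<^sup>2\<close> occupy \<open>(p + 1) / 2\<close> residue classes each, so they meet.\<close>

lemma sum_two_squares_plus_one_mod_prime:
  fixes p :: nat
  assumes p: "prime p" "odd p"
  shows "\<exists>x y :: int. int p dvd x\<^sup>2 + y\<^sup>2 + 1"
proof -
  obtain h where h: "p = 2 * h + 1" using p by (elim oddE)
  have pp: "prime (int p)" using p by simp
  define A where "A = (\<lambda>x. (int x)\<^sup>2 mod int p) ` {..h}"
  define B where "B = (\<lambda>x. (- 1 - (int x)\<^sup>2) mod int p) ` {..h}"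
  have key: "x = y" if "int p dvd (int x)\<^sup>2 - (int y)\<^sup>2" "x \<le> h" "y \<le> h" for x y :: nat
  proof -
    have "(int x)\<^sup>2 - (int y)\<^sup>2 = (int x - int y) * (int x + int y)"
      by (simp add: power2_eq_square algebra_simps)
    then have "int p dvd int x - int y \<or> int p dvd int x + int y"
      using that pp prime_dvd_mult_iff by metis
    then show ?thesis
    proof
      assume "int p dvd int x - int y"
      moreover have "\<bar>int x - int y\<bar> < int p" using that h by linarith
      ultimately show ?thesis by (metis dvd_imp_le_int eq_iff_diff_eq_0 int_int_eq linorder_not_le abs_of_nat)
    next
      assume "int p dvd int x + int y"
      moreover have "\<bar>int x + int y\<bar> < int p" using that h by linarith
      ultimately have "int x + int y = 0" by (metis dvd_imp_le_int linorder_not_le abs_of_nat)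
      then show ?thesis by linarith
    qed
  qed
  have "inj_on (\<lambda>x. (int x)\<^sup>2 mod int p) {..h}"
    using key by (auto simp: inj_on_def mod_eq_dvd_iff)
  then have cA: "card A = h + 1" unfolding A_def by (simp add: card_image)
  have "inj_on (\<lambda>x. (- 1 - (int x)\<^sup>2) mod int p) {..h}"
    using key by (auto simp: inj_on_def mod_eq_dvd_iff dvd_diff_commute)
  then have cB: "card B = h + 1" unfolding B_def by (simp add: card_image)
  have sub: "A \<union> B \<subseteq> {0..<int p}" unfolding A_def B_def using h by auto
  have "A \<inter> B \<noteq> {}"
  proof
    assume "A \<inter> B = {}"
    moreover have "finite A" "finite B" unfolding A_def B_def by simp_all
    ultimately have "card (A \<union> B) = 2 * h + 2" using cA cB card_Un_disjoint by fastforce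
    moreover have "card (A \<union> B) \<le> p" using card_mono[OF _ sub] by simp
    ultimately show False using h by simp
  qed
  then obtain x y where "(int x)\<^sup>2 mod int p = (- 1 - (int y)\<^sup>2) mod int p"
    unfolding A_def B_def by auto
  then have "int p dvd (int x)\<^sup>2 - (- 1 - (int y)\<^sup>2)" by (simp add: mod_eq_dvd_iff)
  then have "int p dvd (int x)\<^sup>2 + (int y)\<^sup>2 + 1" by (simp add: algebra_simps)
  then show ?thesis by blast
qed

text \<open>Prime factors are added one at a time: a new prime by the Chinese remainder theorem, a repeated
  one by lifting the solution.\<close>

lemma sum_two_squares_plus_one_mod_odd:
  fixes m :: nat
  assumes "odd m"
  shows "\<exists>x y :: int. int m dvd x\<^sup>2 + y\<^sup>2 + 1"
  using assms
proof (induction m rule: prime_divisors_induct)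
  case zero
  then show ?case by simp
next
  case (unit m)
  then show ?case by simp
next
  case (factor p m)
  have p: "prime p" "odd p" and m: "odd m" using factor by auto
  have pp: "prime (int p)" using p by simp
  obtain x y where xy: "int m dvd x\<^sup>2 + y\<^sup>2 + 1" using factor.IH m by blast
  show ?case
  proof (cases "p dvd m")
    case False
    then have cop: "coprime (int p) (int m)" using p by (simp add: prime_imp_coprime)
    obtain x' y' where xy': "int p dvd x'\<^sup>2 + y'\<^sup>2 + 1"
      using sum_two_squares_plus_one_mod_prime p by blast
    obtain X where X: "[X = x'] (mod int p)" "[X = x] (mod int m)"
      using binary_chinese_remainder_int[OF cop] by blast
    obtain Y where Y: "[Y = y'] (mod int p)" "[Y = y] (mod int m)"
      using binary_chinese_remainder_int[OF cop] by blast
    have "[X\<^sup>2 + Y\<^sup>2 + 1 = x'\<^sup>2 + y'\<^sup>2 + 1] (mod int p)" by (intro cong_add cong_pow X Y cong_refl)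
    then have 1: "int p dvd X\<^sup>2 + Y\<^sup>2 + 1" using xy' cong_dvd_iff by blast
    have "[X\<^sup>2 + Y\<^sup>2 + 1 = x\<^sup>2 + y\<^sup>2 + 1] (mod int m)" by (intro cong_add cong_pow X Y cong_refl)
    then have 2: "int m dvd X\<^sup>2 + Y\<^sup>2 + 1" using xy cong_dvd_iff by blast
    from 1 2 cop have "int p * int m dvd X\<^sup>2 + Y\<^sup>2 + 1" by (rule divides_mult)
    then show ?thesis by auto
  next
    case True
    then have pm: "int p dvd int m" by simp
    obtain t where t: "x\<^sup>2 + y\<^sup>2 + 1 = int m * t" using xy by blast
    have np: "\<not> (int p dvd x \<and> int p dvd y)"
    proof
      assume "int p dvd x \<and> int p dvd y"
      then have "int p dvd x\<^sup>2 + y\<^sup>2" by (simp add: power2_eq_square)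
      moreover have "int p dvd x\<^sup>2 + y\<^sup>2 + 1" using pm xy dvd_trans by blast
      ultimately have "int p dvd 1" by (simp add: dvd_add_right_iff)
      then show False using pp by (simp add: not_prime_unit)
    qed
    \<comment> \<open>Newton step in whichever of the two variables is a unit modulo \<open>p\<close>.\<close>
    have step: "\<exists>u v. int p dvd t + 2 * (u * x + v * y)"
    proof -
      have solve: "\<exists>u. int p dvd t + 2 * (u * z)" if "\<not> int p dvd z" for z
      proof -
        have "\<not> int p dvd 2"
        proof
          assume "int p dvd 2"
          then have "p dvd 2" using int_dvd_int_iff[of p 2] by simp
          then show False using p primes_dvd_imp_eq[of p 2] by auto
        qed
        then have "\<not> int p dvd 2 * z" using that pp prime_dvd_mult_iff by blast
        then have "coprime (2 * z) (int p)" using pp prime_imp_coprime coprime_commute by blast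
        then obtain r where r: "[2 * z * r = 1] (mod int p)" using cong_solve_coprime_int by blast
        have "t + 2 * ((- t * r) * z) = - t * (2 * z * r - 1)" by (simp add: algebra_simps)
        moreover have "int p dvd 2 * z * r - 1" using r by (simp add: cong_iff_dvd_diff)
        ultimately show ?thesis by (metis dvd_mult)
      qed
      show ?thesis
      proof (cases "int p dvd x")
        case True
        then obtain v where "int p dvd t + 2 * (v * y)" using np solve by blast
        then have "int p dvd t + 2 * (0 * x + v * y)" by simp
        then show ?thesis by blast
      next
        case False
        then obtain u where "int p dvd t + 2 * (u * x)" using solve by blast
        then have "int p dvd t + 2 * (u * x + 0 * y)" by simp
        then show ?thesis by blast
      qed
    qed
    then obtain u v where uv: "int p dvd t + 2 * (u * x + v * y)" by blast
    have "(x + int m * u)\<^sup>2 + (y + int m * v)\<^sup>2 + 1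
        = (x\<^sup>2 + y\<^sup>2 + 1) + int m * (2 * (u * x + v * y)) + int m * (int m * (u\<^sup>2 + v\<^sup>2))"
      by (simp add: power2_eq_square algebra_simps)
    also have "\<dots> = int m * ((t + 2 * (u * x + v * y)) + int m * (u\<^sup>2 + v\<^sup>2))"
      unfolding t by (simp add: algebra_simps)
    finally have "(x + int m * u)\<^sup>2 + (y + int m * v)\<^sup>2 + 1
        = int m * ((t + 2 * (u * x + v * y)) + int m * (u\<^sup>2 + v\<^sup>2))" .
    moreover have "int p dvd (t + 2 * (u * x + v * y)) + int m * (u\<^sup>2 + v\<^sup>2)"
      using uv pm by simp
    ultimately have "int (p * m) dvd (x + int m * u)\<^sup>2 + (y + int m * v)\<^sup>2 + 1"
      by (simp add: mult.commute mult_dvd_mono)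
    then show ?thesis by blast
  qed
qed

text \<open>Lifting of the root \<open>0\<close> modulo \<open>2\<close>. The other root modulo \<open>2\<close> is \<open>1\<close>; the evenness of \<open>z\<close> matters
  in \<open>coincidence_index_power_4\<close>, where it makes the vector that spans the image modulo \<open>2 ^ k\<close> an
  icosian.\<close>

lemma root_mod_power_of_2:
  "\<exists>z :: int. even z \<and> 2 ^ Suc k dvd z\<^sup>2 - z + 2"
proof (induction k)
  case 0
  show ?case by (rule exI[of _ 0]) simp
next
  case (Suc k)
  then obtain z t :: int where z: "even z" and t: "z\<^sup>2 - z + 2 = 2 ^ Suc k * t" by blast
  \<comment> \<open>Newton step; the derivative \<open>2 z - 1\<close> is \<open>-1\<close> modulo \<open>2\<close>.\<close>
  define w where "w = z + 2 ^ Suc k * t"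
  obtain z' where z': "z = 2 * z'" using z by blast
  have "w\<^sup>2 - w + 2 = (z\<^sup>2 - z + 2) + 2 ^ Suc k * t * (2 * z - 1) + (2 ^ Suc k * t)\<^sup>2"
    unfolding w_def by (simp add: power2_eq_square algebra_simps)
  also have "\<dots> = 2 ^ Suc (Suc k) * (z * t + 2 ^ k * t\<^sup>2)"
    unfolding t by (simp add: power2_eq_square algebra_simps)
  finally have "2 ^ Suc (Suc k) dvd w\<^sup>2 - w + 2" by simp
  moreover have "even w" using z unfolding w_def by simp
  ultimately show ?case by blast
qed

section \<open>Indices of additive subgroups\<close>

text \<open>The cosets in question are cosets of a bare set in a bare set, so subgroups of the additive group
  of a type are also kept as sets.\<close>

definition is_addsubgroup :: "'a::ab_group_add set \<Rightarrow> bool" where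
  "is_addsubgroup A \<longleftrightarrow> 0 \<in> A \<and> (\<forall>x\<in>A. \<forall>y\<in>A. x - y \<in> A)"

lemma addsubgroupI:
  assumes "0 \<in> A" "\<And>x y. x \<in> A \<Longrightarrow> y \<in> A \<Longrightarrow> x - y \<in> A"
  shows "is_addsubgroup A"
  using assms unfolding is_addsubgroup_def by blast

lemma addsubgroup_zero: "is_addsubgroup A \<Longrightarrow> 0 \<in> A"
  unfolding is_addsubgroup_def by blast

lemma addsubgroup_diff: "is_addsubgroup A \<Longrightarrow> x \<in> A \<Longrightarrow> y \<in> A \<Longrightarrow> x - y \<in> A"
  unfolding is_addsubgroup_def by blast

lemma addsubgroup_uminus: "is_addsubgroup A \<Longrightarrow> x \<in> A \<Longrightarrow> - x \<in> A"
  using addsubgroup_diff[OF _ addsubgroup_zero, of A x] by simp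

lemma addsubgroup_add: "is_addsubgroup A \<Longrightarrow> x \<in> A \<Longrightarrow> y \<in> A \<Longrightarrow> x + y \<in> A"
  using addsubgroup_diff[of A x "- y"] addsubgroup_uminus[of A y] by simp

lemma addsubgroup_Int: "is_addsubgroup A \<Longrightarrow> is_addsubgroup B \<Longrightarrow> is_addsubgroup (A \<inter> B)"
  unfolding is_addsubgroup_def by blast

lemma addsubgroup_scale_int:
  fixes A :: "'a::real_vector set"
  assumes "is_addsubgroup A" "x \<in> A"
  shows "of_int n *\<^sub>R x \<in> A"
proof -
  have nat: "of_nat k *\<^sub>R x \<in> A" for k
    by (induction k) (auto simp: scaleR_left_distrib assms addsubgroup_zero addsubgroup_add)
  show ?thesis
  proof (cases "n \<ge> 0")
    case True
    then show ?thesis using nat[of "nat n"] by simp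
  next
    case False
    then show ?thesis using addsubgroup_uminus[OF assms(1) nat[of "nat (- n)"]] by simp
  qed
qed

lemma cosets_in_eq: "cosets_in A B = (\<lambda>a. (\<lambda>b. b + a) ` B) ` A"
  unfolding RCOSETS_def r_coset_def additive_group_def by auto

lemma translate_eq_iff:
  assumes "is_addsubgroup B"
  shows "(\<lambda>b. b + x) ` B = (\<lambda>b. b + y) ` B \<longleftrightarrow> x - y \<in> B"
proof
  assume eq: "(\<lambda>b. b + x) ` B = (\<lambda>b. b + y) ` B"
  have "x \<in> (\<lambda>b. b + x) ` B" using addsubgroup_zero[OF assms] by force
  then obtain b where "b \<in> B" "x = b + y" unfolding eq by blast
  then show "x - y \<in> B" by simp
next
  assume d: "x - y \<in> B"
  have 1: "(\<lambda>b. b + u) ` B \<subseteq> (\<lambda>b. b + v) ` B" if "u - v \<in> B" for u v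
  proof
    fix z assume "z \<in> (\<lambda>b. b + u) ` B"
    then obtain b where "b \<in> B" "z = b + u" by blast
    then have "b + (u - v) \<in> B" "z = (b + (u - v)) + v" using that assms addsubgroup_add by auto
    then show "z \<in> (\<lambda>b. b + v) ` B" by blast
  qed
  have "y - x \<in> B" using addsubgroup_uminus[OF assms d] by simp
  then show "(\<lambda>b. b + x) ` B = (\<lambda>b. b + y) ` B" using 1 d by blast
qed

lemma bij_betw_images:
  assumes "\<And>x y. x \<in> A \<Longrightarrow> y \<in> A \<Longrightarrow> f x = f y \<longleftrightarrow> g x = g y"
  shows "\<exists>h. bij_betw h (f ` A) (g ` A)"
proof -
  define h where "h = (\<lambda>u. g (SOME x. x \<in> A \<and> f x = u))"
  have h: "h (f x) = g x" if "x \<in> A" for x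
  proof -
    have "\<exists>z. z \<in> A \<and> f z = f x" using that by blast
    from someI_ex[OF this] show ?thesis unfolding h_def using assms that by blast
  qed
  have "inj_on h (f ` A)" using h assms by (auto simp: inj_on_def)
  moreover have "h ` (f ` A) = g ` A" using h by force
  ultimately show ?thesis unfolding bij_betw_def by blast
qed

text \<open>A function that separates exactly the cosets computes the index; this is how indices become
  cardinalities of explicit finite sets.\<close>

lemma cosets_classify:
  assumes "is_addsubgroup B" "\<And>x y. x \<in> A \<Longrightarrow> y \<in> A \<Longrightarrow> f x = f y \<longleftrightarrow> x - y \<in> B"
  shows "finite (cosets_in A B) \<longleftrightarrow> finite (f ` A)" "add_index A B = card (f ` A)"
proof -
  obtain h where h: "bij_betw h ((\<lambda>a. (\<lambda>b. b + a) ` B) ` A) (f ` A)"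
    using bij_betw_images[of A "\<lambda>a. (\<lambda>b. b + a) ` B" f] assms translate_eq_iff by metis
  show "finite (cosets_in A B) \<longleftrightarrow> finite (f ` A)" "add_index A B = card (f ` A)"
    unfolding add_index_def cosets_in_eq
    using bij_betw_finite[OF h] bij_betw_same_card[OF h] by simp_all
qed

text \<open>For finiteness alone a function may separate more than the cosets.\<close>

lemma finite_cosetsI:
  assumes B: "is_addsubgroup B" and f: "finite (f ` A)"
    and imp: "\<And>x y. x \<in> A \<Longrightarrow> y \<in> A \<Longrightarrow> f x = f y \<Longrightarrow> x - y \<in> B"
  shows "finite (cosets_in A B)"
proof -
  have "cosets_in A B \<subseteq> (\<lambda>u. (\<lambda>b. b + (SOME x. x \<in> A \<and> f x = u)) ` B) ` (f ` A)"
  proof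
    fix c assume "c \<in> cosets_in A B"
    then obtain a where a: "a \<in> A" "c = (\<lambda>b. b + a) ` B" unfolding cosets_in_eq by blast
    define s where "s = (SOME x. x \<in> A \<and> f x = f a)"
    have "\<exists>x. x \<in> A \<and> f x = f a" using a by blast
    from someI_ex[OF this] have "s \<in> A" "f s = f a" unfolding s_def by auto
    then have "c = (\<lambda>b. b + s) ` B" using imp a translate_eq_iff[OF B] by metis
    then show "c \<in> (\<lambda>u. (\<lambda>b. b + (SOME x. x \<in> A \<and> f x = u)) ` B) ` (f ` A)"
      using a unfolding s_def by blast
  qed
  then show ?thesis using f finite_surj by blast
qed

lemma add_index_self: "is_addsubgroup A \<Longrightarrow> add_index A A = 1"
proof -
  assume A: "is_addsubgroup A"
  have "add_index A A = card ((\<lambda>_. ()) ` A)"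
    by (rule cosets_classify(2)) (auto simp: A addsubgroup_diff)
  also have "(\<lambda>_. ()) ` A = {()}" using addsubgroup_zero[OF A] by auto
  finally show ?thesis by simp
qed

lemma add_index_pos: "finite (cosets_in A B) \<Longrightarrow> A \<noteq> {} \<Longrightarrow> add_index A B > 0"
  unfolding add_index_def cosets_in_eq by (simp add: card_gt_0_iff)

text \<open>The map \<open>f\<close> induces a bijection of \<open>A / B\<close> onto \<open>C / D\<close>. It need not be additive, only compatible
  with differences modulo \<open>B\<close> and \<open>D\<close>, which also allows a change of type.\<close>

lemma add_index_transport:
  assumes B: "is_addsubgroup B" and D: "is_addsubgroup D"
    and sur: "\<And>c. c \<in> C \<Longrightarrow> \<exists>a\<in>A. c - f a \<in> D"
    and into: "\<And>a. a \<in> A \<Longrightarrow> f a \<in> C"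
    and iff: "\<And>x y. x \<in> A \<Longrightarrow> y \<in> A \<Longrightarrow> f x - f y \<in> D \<longleftrightarrow> x - y \<in> B"
  shows "finite (cosets_in A B) \<longleftrightarrow> finite (cosets_in C D)" "add_index A B = add_index C D"
proof -
  let ?g = "\<lambda>a. (\<lambda>b. b + f a) ` D"
  have "?g ` A = cosets_in C D"
  proof
    show "?g ` A \<subseteq> cosets_in C D" using into unfolding cosets_in_eq by blast
    show "cosets_in C D \<subseteq> ?g ` A"
    proof
      fix c assume "c \<in> cosets_in C D"
      then obtain x where x: "x \<in> C" "c = (\<lambda>b. b + x) ` D" unfolding cosets_in_eq by blast
      then obtain a where "a \<in> A" "x - f a \<in> D" using sur by blast
      then show "c \<in> ?g ` A" using x translate_eq_iff[OF D] by blast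
    qed
  qed
  moreover have "?g x = ?g y \<longleftrightarrow> x - y \<in> B" if "x \<in> A" "y \<in> A" for x y
    using translate_eq_iff[OF D] iff that by blast
  ultimately show "finite (cosets_in A B) \<longleftrightarrow> finite (cosets_in C D)" "add_index A B = add_index C D"
    using cosets_classify[OF B, of A ?g] unfolding add_index_def by auto
qed

text \<open>An element \<open>x\<close> of \<open>A\<close> is classified modulo \<open>C\<close> by the representative of its coset modulo \<open>B\<close>
  together with the coset modulo \<open>C\<close> of the remaining difference.\<close>

lemma add_index_tower:
  assumes A: "is_addsubgroup A" and B: "is_addsubgroup B" and C: "is_addsubgroup C"
    and "C \<subseteq> B" "B \<subseteq> A"
  shows "add_index A C = add_index A B * add_index B C"
    and "finite (cosets_in A C) \<longleftrightarrow> finite (cosets_in A B) \<and> finite (cosets_in B C)"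
proof -
  define rep where "rep = (\<lambda>x. SOME r. r \<in> A \<and> x - r \<in> B)"
  have rep: "rep x \<in> A" "x - rep x \<in> B" if "x \<in> A" for x
  proof -
    have "\<exists>r. r \<in> A \<and> x - r \<in> B" using that addsubgroup_zero[OF B] by (intro exI[of _ x]) auto
    from someI_ex[OF this] show "rep x \<in> A" "x - rep x \<in> B" unfolding rep_def by auto
  qed
  have rep_eq: "rep x = rep y \<longleftrightarrow> x - y \<in> B" if xy: "x \<in> A" "y \<in> A" for x y
  proof
    assume "rep x = rep y"
    then have "x - y = (x - rep x) - (y - rep y)" by simp
    then show "x - y \<in> B" using rep[OF xy(1)] rep[OF xy(2)] addsubgroup_diff[OF B] by metis
  next
    assume d: "x - y \<in> B"
    have "x - r \<in> B \<longleftrightarrow> y - r \<in> B" for r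
    proof
      assume "x - r \<in> B"
      then have "(x - r) - (x - y) \<in> B" using d addsubgroup_diff[OF B] by blast
      then show "y - r \<in> B" by simp
    next
      assume "y - r \<in> B"
      then have "(y - r) + (x - y) \<in> B" using d addsubgroup_add[OF B] by blast
      then show "x - r \<in> B" by simp
    qed
    then show "rep x = rep y" unfolding rep_def by simp
  qed
  define g where "g = (\<lambda>x. (rep x, (\<lambda>b. b + (x - rep x)) ` C))"
  have giff: "g x = g y \<longleftrightarrow> x - y \<in> C" if xy: "x \<in> A" "y \<in> A" for x y
  proof (cases "rep x = rep y")
    case True
    then show ?thesis unfolding g_def using translate_eq_iff[OF C] by auto
  next
    case False
    then show ?thesis unfolding g_def using rep_eq[OF xy] assms(4) by auto
  qed
  have gim: "g ` A = (rep ` A) \<times> cosets_in B C"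
  proof
    show "g ` A \<subseteq> (rep ` A) \<times> cosets_in B C"
      unfolding g_def cosets_in_eq using rep by auto
    show "(rep ` A) \<times> cosets_in B C \<subseteq> g ` A"
    proof (clarify)
      fix x c assume x: "x \<in> A" and "c \<in> cosets_in B C"
      then obtain b where b: "b \<in> B" "c = (\<lambda>z. z + b) ` C" unfolding cosets_in_eq by blast
      have y: "rep x + b \<in> A" using rep(1)[OF x] b assms addsubgroup_add by blast
      have "(rep x + b) - x = b - (x - rep x)" by simp
      then have "(rep x + b) - x \<in> B" using b rep(2)[OF x] addsubgroup_diff[OF B] by metis
      then have "rep (rep x + b) = rep x" using rep_eq[OF y x] by blast
      then have "g (rep x + b) = (rep x, c)" unfolding g_def b by simp
      then show "(rep x, c) \<in> g ` A" using y by force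
    qed
  qed
  have ne: "rep ` A \<noteq> {}" "cosets_in B C \<noteq> {}"
    using addsubgroup_zero[OF A] addsubgroup_zero[OF B] unfolding cosets_in_eq by auto
  show "add_index A C = add_index A B * add_index B C"
    using cosets_classify(2)[OF C, of A g] cosets_classify(2)[OF B, of A rep] giff rep_eq gim
    by (auto simp: card_cartesian_product add_index_def)
  show "finite (cosets_in A C) \<longleftrightarrow> finite (cosets_in A B) \<and> finite (cosets_in B C)"
    using cosets_classify(1)[OF C, of A g] cosets_classify(1)[OF B, of A rep] giff rep_eq gim ne
    by (auto simp: finite_cartesian_product_iff)
qed

text \<open>With \<open>u m + v n = 1\<close>, an element of \<open>A \<inter> C\<close> is an integral combination of its multiples by \<open>m\<close> and
  \<open>n\<close>, both of which lie in \<open>B\<close>; hence \<open>A \<inter> C \<subseteq> B\<close>. The same combination shows that \<open>A \<inter> B\<close> maps onto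
  \<open>B / (B \<inter> C)\<close>.\<close>

lemma add_index_coprime:
  fixes A B C :: "'a::real_vector set"
  assumes A: "is_addsubgroup A" and B: "is_addsubgroup B" and C: "is_addsubgroup C"
    and cop: "coprime m n"
    and AB: "\<And>x. x \<in> A \<Longrightarrow> of_nat m *\<^sub>R x \<in> B" and BA: "\<And>x. x \<in> B \<Longrightarrow> of_nat m *\<^sub>R x \<in> A"
    and BC: "\<And>x. x \<in> B \<Longrightarrow> of_nat n *\<^sub>R x \<in> C" and CB: "\<And>x. x \<in> C \<Longrightarrow> of_nat n *\<^sub>R x \<in> B"
  shows "add_index A (A \<inter> C) = add_index A (A \<inter> B) * add_index B (B \<inter> C)"
proof -
  have "coprime (int m) (int n)" using cop by simp
  then obtain u v where "u * int m + v * int n = 1"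
    using bezout_int[of "int m" "int n"] by auto
  then have "of_int (u * int m + v * int n) = (1::real)" by simp
  then have uv: "of_int u * of_nat m + of_int v * of_nat n = (1::real)" by simp
  have split: "x = of_int u *\<^sub>R (of_nat m *\<^sub>R x) + of_int v *\<^sub>R (of_nat n *\<^sub>R x)" for x :: 'a
    using uv by (metis scaleR_left_distrib scaleR_one scaleR_scaleR)
  have sub: "A \<inter> C \<subseteq> B"
  proof
    fix x assume x: "x \<in> A \<inter> C"
    then have "of_int u *\<^sub>R (of_nat m *\<^sub>R x) + of_int v *\<^sub>R (of_nat n *\<^sub>R x) \<in> B"
      by (intro addsubgroup_add[OF B] addsubgroup_scale_int[OF B] AB CB) auto
    then show "x \<in> B" using split by metis
  qed
  have "add_index A (A \<inter> C) = add_index A (A \<inter> B) * add_index (A \<inter> B) (A \<inter> C)"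
    by (rule add_index_tower) (use A B C sub in \<open>auto intro: addsubgroup_Int\<close>)
  also have "add_index (A \<inter> B) (A \<inter> C) = add_index B (B \<inter> C)"
  proof (rule add_index_transport(2)[where f = "\<lambda>x. x"])
    fix b assume b: "b \<in> B"
    let ?a = "of_int u *\<^sub>R (of_nat m *\<^sub>R b)"
    have "of_nat m *\<^sub>R b \<in> B" using addsubgroup_scale_int[OF B b, of "int m"] by simp
    then have "?a \<in> A \<inter> B" by (intro IntI addsubgroup_scale_int A B BA b)
    moreover have "b - ?a = of_int v *\<^sub>R (of_nat n *\<^sub>R b)" using split[of b] by (simp add: algebra_simps)
    moreover have "of_int v *\<^sub>R (of_nat n *\<^sub>R b) \<in> C" by (intro addsubgroup_scale_int C BC b)
    ultimately show "\<exists>a\<in>A \<inter> B. b - a \<in> B \<inter> C" using b addsubgroup_diff[OF B] by (metis IntD2 IntI)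
  next
    fix x y assume "x \<in> A \<inter> B" "y \<in> A \<inter> B"
    then show "x - y \<in> B \<inter> C \<longleftrightarrow> x - y \<in> A \<inter> C"
      using addsubgroup_diff[OF A] addsubgroup_diff[OF B] by blast
  qed (use A B C in \<open>auto intro: addsubgroup_Int\<close>)
  finally show ?thesis .
qed

text \<open>Two multiples of \<open>x\<close> lie in the same coset.\<close>

lemma finite_index_multiple:
  fixes A B :: "'a::real_vector set"
  assumes A: "is_addsubgroup A" and B: "is_addsubgroup B"
    and fin: "finite (cosets_in A B)" and x: "x \<in> A"
  shows "\<exists>n::nat. n > 0 \<and> of_nat n *\<^sub>R x \<in> B"
proof -
  let ?f = "\<lambda>k::nat. (\<lambda>b. b + of_nat k *\<^sub>R x) ` B"
  have "range ?f \<subseteq> cosets_in A B"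
  proof (clarify)
    fix k :: nat
    have "of_nat k *\<^sub>R x \<in> A" using addsubgroup_scale_int[OF A x, of "int k"] by simp
    then show "?f k \<in> cosets_in A B" unfolding cosets_in_eq by blast
  qed
  then have "finite (range ?f)" using fin finite_subset by blast
  then have "\<not> inj ?f" using finite_imageD infinite_UNIV_nat by blast
  then obtain j k where jk: "j < k" "?f k = ?f j"
    unfolding inj_def by (metis linorder_neqE_nat)
  then have "of_nat k *\<^sub>R x - of_nat j *\<^sub>R x \<in> B" using translate_eq_iff[OF B] by blast
  then have "of_nat (k - j) *\<^sub>R x \<in> B" using jk by (simp add: of_nat_diff scaleR_left_diff_distrib)
  then show ?thesis using jk by (intro exI[of _ "k - j"]) auto
qed

section \<open>The ring of golden integers and its finite modules\<close>

lemma golden_mult_golden: "golden * golden = golden + 1"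
proof -
  have "sqrt 5 * sqrt 5 = (5::real)" by simp
  then show ?thesis unfolding golden_def by (simp add: field_simps)
qed

lemma golden_reduce: "golden * (golden * y) = y + golden * y"
  using golden_mult_golden by (simp add: mult.assoc[symmetric] algebra_simps)

lemma Z_goldenI: "x = of_int a + of_int b * golden \<Longrightarrow> x \<in> Z_golden"
  unfolding Z_golden_def by blast

lemma Z_goldenE:
  assumes "x \<in> Z_golden"
  obtains a b where "x = of_int a + of_int b * golden"
  using assms unfolding Z_golden_def by blast

lemma Z_golden_of_int [simp]: "of_int n \<in> Z_golden"
  by (rule Z_goldenI[of _ n 0]) simp

lemma Z_golden_of_nat [simp]: "of_nat n \<in> Z_golden"
  using Z_golden_of_int[of "int n"] by simp

lemma Z_golden_numeral [simp]: "numeral n \<in> Z_golden"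
  using Z_golden_of_nat[of "numeral n"] by simp

lemma Z_golden_0 [simp]: "0 \<in> Z_golden" and Z_golden_1 [simp]: "1 \<in> Z_golden"
  using Z_golden_of_int[of 0] Z_golden_of_int[of 1] by simp_all

lemma Z_golden_golden [simp]: "golden \<in> Z_golden"
  by (rule Z_goldenI[of _ 0 1]) simp

lemma Z_golden_add [simp]: 
  assumes "x \<in> Z_golden" "y \<in> Z_golden"
  shows "x + y \<in> Z_golden"
proof -
  obtain a b c d where "x = of_int a + of_int b * golden" "y = of_int c + of_int d * golden"
    using assms by (elim Z_goldenE)
  then have "x + y = of_int (a + c) + of_int (b + d) * golden" by (simp add: algebra_simps)
  then show ?thesis by (rule Z_goldenI)
qed

lemma Z_golden_uminus [simp]: 
  assumes "x \<in> Z_golden"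
  shows "- x \<in> Z_golden"
proof -
  obtain a b where "x = of_int a + of_int b * golden"
    using assms by (elim Z_goldenE)
  then have "- x = of_int (- a) + of_int (- b) * golden" by simp
  then show ?thesis by (rule Z_goldenI)
qed

lemma Z_golden_diff [simp]: "x \<in> Z_golden \<Longrightarrow> y \<in> Z_golden \<Longrightarrow> x - y \<in> Z_golden"
  using Z_golden_add[of x "- y"] by simp

lemma golden_mult_formula:
  "(a + b * golden) * (c + d * golden) = (a * c + b * d) + (a * d + b * c + b * d) * golden"
proof -
  have "(a + b * golden) * (c + d * golden) = a * c + (a * d + b * c) * golden + b * d * (golden * golden)"
    by (simp add: algebra_simps)
  then show ?thesis by (simp add: golden_mult_golden algebra_simps)
qed

lemma Z_golden_mult [simp]: 
  assumes "x \<in> Z_golden" "y \<in> Z_golden"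
  shows "x * y \<in> Z_golden"
proof -
  obtain a b c d where "x = of_int a + of_int b * golden" "y = of_int c + of_int d * golden"
    using assms by (elim Z_goldenE)
  then have "x * y = of_int (a * c + b * d) + of_int (a * d + b * c + b * d) * golden"
    by (simp add: golden_mult_formula)
  then show ?thesis by (rule Z_goldenI)
qed

lemma Z_golden_power [simp]: "x \<in> Z_golden \<Longrightarrow> x ^ n \<in> Z_golden"
  by (induction n) auto

lemma addsubgroup_Z_golden: "is_addsubgroup Z_golden"
  by (rule addsubgroupI) auto

lemma golden_int_independent:
  assumes "of_int k + of_int l * golden = 0"
  shows "k = 0" "l = 0"
proof -
  have "(of_int k + of_int l * golden) * (of_int (k + l) + of_int (- l) * golden)
      = of_int (k\<^sup>2 + k * l - l\<^sup>2)"
    unfolding golden_mult_formula by (simp add: power2_eq_square algebra_simps)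
  then have "(of_int (k\<^sup>2 + k * l - l\<^sup>2) :: real) = 0" using assms by simp
  then show "k = 0" "l = 0" using golden_norm_eq_0[of k l] by linarith+
qed

lemma golden_rat_independent:
  assumes "a \<in> \<rat>" "b \<in> \<rat>" "a + b * golden = 0"
  shows "a = 0" "b = 0"
proof -
  obtain p q where pq: "a = of_int p / of_int q" "q > 0" using assms(1) by (metis Rats_cases')
  obtain r s where rs: "b = of_int r / of_int s" "s > 0" using assms(2) by (metis Rats_cases')
  have "of_int (p * s) + of_int (r * q) * golden = of_int q * of_int s * (a + b * golden)"
    using pq rs by (simp add: field_simps)
  then have "p * s = 0" "r * q = 0" using golden_int_independent[of "p * s" "r * q"] assms(3) by simp_all
  then show "a = 0" "b = 0" using pq rs by simp_all
qed

lemma Q_sqrt5_iff: "x \<in> Q_sqrt5 \<longleftrightarrow> (\<exists>a\<in>\<rat>. \<exists>b\<in>\<rat>. x = a + b * golden)"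
proof
  assume "x \<in> Q_sqrt5"
  then obtain a b where "a \<in> \<rat>" "b \<in> \<rat>" "x = a + b * sqrt 5" unfolding Q_sqrt5_def by blast
  then have "a - b \<in> \<rat>" "2 * b \<in> \<rat>" "x = (a - b) + 2 * b * golden"
    unfolding golden_def by (auto simp: field_simps)
  then show "\<exists>a\<in>\<rat>. \<exists>b\<in>\<rat>. x = a + b * golden" by blast
next
  assume "\<exists>a\<in>\<rat>. \<exists>b\<in>\<rat>. x = a + b * golden"
  then obtain a b where "a \<in> \<rat>" "b \<in> \<rat>" "x = a + b * golden" by blast
  then have "a + b / 2 \<in> \<rat>" "b / 2 \<in> \<rat>" "x = (a + b / 2) + b / 2 * sqrt 5"
    unfolding golden_def by (auto simp: field_simps)
  then show "x \<in> Q_sqrt5" unfolding Q_sqrt5_def by blast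
qed

lemma Q_sqrt5E:
  assumes "x \<in> Q_sqrt5"
  obtains a b where "a \<in> \<rat>" "b \<in> \<rat>" "x = a + b * golden"
  using assms unfolding Q_sqrt5_iff by blast

lemma Z_golden_sub: "x \<in> Z_golden \<Longrightarrow> x \<in> Q_sqrt5"
  unfolding Z_golden_def Q_sqrt5_iff by (auto intro: bexI[OF _ Rats_of_int])

text \<open>The nontrivial automorphism of \<open>K\<close>, extended arbitrarily to the reals. Choice picks the
  coordinates, which are unique by irrationality.\<close>

definition gconj :: "real \<Rightarrow> real" where
  "gconj x = (SOME y. \<exists>a\<in>\<rat>. \<exists>b\<in>\<rat>. x = a + b * golden \<and> y = a + b * (1 - golden))"

lemma gconj_eq:
  assumes "a \<in> \<rat>" "b \<in> \<rat>"
  shows "gconj (a + b * golden) = a + b * (1 - golden)"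
proof -
  have "\<exists>y. \<exists>a'\<in>\<rat>. \<exists>b'\<in>\<rat>. a + b * golden = a' + b' * golden \<and> y = a' + b' * (1 - golden)"
    using assms by blast
  from someI_ex[OF this] obtain a' b' where ab: "a' \<in> \<rat>" "b' \<in> \<rat>" "a + b * golden = a' + b' * golden"
    "gconj (a + b * golden) = a' + b' * (1 - golden)"
    unfolding gconj_def by blast
  then have "(a - a') + (b - b') * golden = 0" by (simp add: algebra_simps)
  then have "a = a'" "b = b'" using golden_rat_independent[of "a - a'" "b - b'"] assms ab by auto
  then show ?thesis using ab by simp
qed

lemma gconj_of_rat: "x \<in> \<rat> \<Longrightarrow> gconj x = x"
  using gconj_eq[of x 0] by simp

lemma Q_sqrt5_add [simp]: "x \<in> Q_sqrt5 \<Longrightarrow> y \<in> Q_sqrt5 \<Longrightarrow> x + y \<in> Q_sqrt5"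
  and gconj_add: "x \<in> Q_sqrt5 \<Longrightarrow> y \<in> Q_sqrt5 \<Longrightarrow> gconj (x + y) = gconj x + gconj y"
proof -
  assume "x \<in> Q_sqrt5" "y \<in> Q_sqrt5"
  then obtain a b c d where r: "a \<in> \<rat>" "b \<in> \<rat>" "c \<in> \<rat>" "d \<in> \<rat>"
    and xy: "x = a + b * golden" "y = c + d * golden" by (elim Q_sqrt5E)
  have e: "x + y = (a + c) + (b + d) * golden" unfolding xy by (simp add: algebra_simps)
  show "x + y \<in> Q_sqrt5" unfolding e Q_sqrt5_iff using r Rats_add by blast
  show "gconj (x + y) = gconj x + gconj y"
    unfolding e using gconj_eq[of "a + c" "b + d"] gconj_eq[of a b] gconj_eq[of c d] r xy
    by (simp add: algebra_simps)
qed

lemma Q_sqrt5_mult [simp]: "x \<in> Q_sqrt5 \<Longrightarrow> y \<in> Q_sqrt5 \<Longrightarrow> x * y \<in> Q_sqrt5"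
  and gconj_mult: "x \<in> Q_sqrt5 \<Longrightarrow> y \<in> Q_sqrt5 \<Longrightarrow> gconj (x * y) = gconj x * gconj y"
proof -
  assume "x \<in> Q_sqrt5" "y \<in> Q_sqrt5"
  then obtain a b c d where r: "a \<in> \<rat>" "b \<in> \<rat>" "c \<in> \<rat>" "d \<in> \<rat>"
    and xy: "x = a + b * golden" "y = c + d * golden" by (elim Q_sqrt5E)
  have e: "x * y = (a * c + b * d) + (a * d + b * c + b * d) * golden"
    unfolding xy by (rule golden_mult_formula)
  have r': "a * c + b * d \<in> \<rat>" "a * d + b * c + b * d \<in> \<rat>" using r by auto
  show "x * y \<in> Q_sqrt5" unfolding e Q_sqrt5_iff using r' by blast
  have "gconj x * gconj y = ((a + b) + (- b) * golden) * ((c + d) + (- d) * golden)"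
    unfolding xy gconj_eq[OF r(1,2)] gconj_eq[OF r(3,4)] by (simp add: algebra_simps)
  also have "\<dots> = (a * c + b * d) + (a * d + b * c + b * d) * (1 - golden)"
    unfolding golden_mult_formula by (simp add: algebra_simps)
  finally show "gconj (x * y) = gconj x * gconj y" unfolding e gconj_eq[OF r'] by simp
qed

lemma Q_sqrt5_Rats [simp]: "x \<in> \<rat> \<Longrightarrow> x \<in> Q_sqrt5"
  unfolding Q_sqrt5_iff by (rule bexI[of _ x], rule bexI[of _ 0]) auto

lemma Q_sqrt5_golden [simp]: "golden \<in> Q_sqrt5"
  using Z_golden_sub by simp

lemma Q_sqrt5_uminus [simp]: "x \<in> Q_sqrt5 \<Longrightarrow> - x \<in> Q_sqrt5"
  using Q_sqrt5_mult[of "-1" x] by simp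

lemma gconj_uminus: "x \<in> Q_sqrt5 \<Longrightarrow> gconj (- x) = - gconj x"
  using gconj_mult[of "-1" x] gconj_of_rat[of "-1"] by simp

lemma Q_sqrt5_diff [simp]: "x \<in> Q_sqrt5 \<Longrightarrow> y \<in> Q_sqrt5 \<Longrightarrow> x - y \<in> Q_sqrt5"
  using Q_sqrt5_add[of x "- y"] by simp

lemma gconj_gconj:
  assumes "x \<in> Q_sqrt5"
  shows "gconj x \<in> Q_sqrt5" "gconj (gconj x) = x"
proof -
  obtain a b where r: "a \<in> \<rat>" "b \<in> \<rat>" and x: "x = a + b * golden" using assms by (elim Q_sqrt5E)
  have e: "gconj x = (a + b) + (- b) * golden" unfolding x gconj_eq[OF r] by (simp add: algebra_simps)
  show "gconj x \<in> Q_sqrt5" unfolding e Q_sqrt5_iff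
    by (rule bexI[of _ "a + b"], rule bexI[of _ "- b"]) (use r in auto)
  show "gconj (gconj x) = x" unfolding e using gconj_eq[of "a + b" "- b"] r x by (simp add: algebra_simps)
qed

lemma gconj_Z_golden:
  assumes "x \<in> Z_golden"
  shows "gconj x \<in> Z_golden"
proof -
  obtain a b where x: "x = of_int a + of_int b * golden" using assms by (elim Z_goldenE)
  have "gconj x = of_int (a + b) + of_int (- b) * golden"
    unfolding x by (subst gconj_eq) (auto simp: algebra_simps)
  then show ?thesis by (rule Z_goldenI)
qed

lemma mult_gconj_eq:
  "(of_int k + of_int l * golden) * gconj (of_int k + of_int l * golden) = of_int (k\<^sup>2 + k * l - l\<^sup>2)"
proof -
  have e: "gconj (of_int k + of_int l * golden) = of_int (k + l) + of_int (- l) * golden"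
    by (subst gconj_eq) (auto simp: algebra_simps)
  show ?thesis
    unfolding e golden_mult_formula by (simp add: power2_eq_square algebra_simps)
qed

lemma gconj_eq_0_iff: "x \<in> Q_sqrt5 \<Longrightarrow> gconj x = 0 \<longleftrightarrow> x = 0"
  using gconj_gconj gconj_of_rat[of 0] by (metis Rats_0)

lemma mult_gconj_Rats:
  assumes "x \<in> Q_sqrt5"
  shows "x * gconj x \<in> \<rat>"
proof -
  obtain a b where r: "a \<in> \<rat>" "b \<in> \<rat>" and x: "x = a + b * golden" using assms by (elim Q_sqrt5E)
  have e: "gconj x = (a + b) + (- b) * golden" unfolding x gconj_eq[OF r] by (simp add: algebra_simps)
  have "x * gconj x = a * (a + b) + b * (- b)"
    unfolding e unfolding x golden_mult_formula by (simp add: algebra_simps)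
  then show ?thesis using r by simp
qed

lemma Q_sqrt5_inverse [simp]:
  assumes "x \<in> Q_sqrt5"
  shows "inverse x \<in> Q_sqrt5"
proof (cases "x = 0")
  case False
  then have "inverse x = gconj x * inverse (x * gconj x)"
    using gconj_eq_0_iff[OF assms] by (simp add: field_simps)
  moreover have "inverse (x * gconj x) \<in> Q_sqrt5" using mult_gconj_Rats[OF assms] Rats_inverse Q_sqrt5_Rats by blast
  ultimately show ?thesis using gconj_gconj(1)[OF assms] Q_sqrt5_mult by metis
qed simp

lemma Q_sqrt5_divide [simp]: "x \<in> Q_sqrt5 \<Longrightarrow> y \<in> Q_sqrt5 \<Longrightarrow> x / y \<in> Q_sqrt5"
  using Q_sqrt5_mult[OF _ Q_sqrt5_inverse] by (simp add: field_simps)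

lemma Q_sqrt5_denominator:
  assumes "x \<in> Q_sqrt5"
  shows "\<exists>n::nat. n > 0 \<and> of_nat n * x \<in> Z_golden"
proof -
  obtain a b where r: "a \<in> \<rat>" "b \<in> \<rat>" and x: "x = a + b * golden" using assms by (elim Q_sqrt5E)
  obtain p q where pq: "a = of_int p / of_int q" "q > 0" using r(1) by (metis Rats_cases')
  obtain u v where uv: "b = of_int u / of_int v" "v > 0" using r(2) by (metis Rats_cases')
  have "of_nat (nat (q * v)) * x = of_int (p * v) + of_int (u * q) * golden"
    using pq uv unfolding x by (simp add: field_simps)
  then have "of_nat (nat (q * v)) * x \<in> Z_golden" by (rule Z_goldenI)
  moreover have "nat (q * v) > 0" using pq uv by simp
  ultimately show ?thesis by blast
qed

text \<open>The prime \<open>2\<close> is inert, so \<open>\<O> / 2 \<O>\<close> is a field and has no nilpotent elements.\<close>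

lemma half_square_Z_golden:
  assumes x: "x \<in> Z_golden" and "x * x = 2 * y" "y \<in> Z_golden"
  shows "x / 2 \<in> Z_golden"
proof -
  obtain a b where ab: "x = of_int a + of_int b * golden" using x by (elim Z_goldenE)
  obtain c d where cd: "y = of_int c + of_int d * golden" using assms(3) by (elim Z_goldenE)
  have "of_int (a * a + b * b - 2 * c) + of_int (a * b + b * a + b * b - 2 * d) * golden = 0"
    using assms(2) unfolding ab cd golden_mult_formula by (simp add: algebra_simps)
  then have 1: "a * a + b * b - 2 * c = 0" "a * b + b * a + b * b - 2 * d = 0"
    using golden_int_independent by blast+
  have "b * b = 2 * (d - a * b)" using 1(2) by (simp add: algebra_simps)
  then have "even (b * b)" by (metis dvd_triv_left)
  then have b: "even b" by simp
  have "a * a + b * b = 2 * c" using 1(1) by simp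
  then have "even (a * a + b * b)" by (metis dvd_triv_left)
  then have "even (a * a)" using \<open>even (b * b)\<close> by (metis even_add)
  then have a: "even a" by simp
  obtain a' b' where "a = 2 * a'" "b = 2 * b'" using a b by (elim evenE)
  then have "x / 2 = of_int a' + of_int b' * golden" unfolding ab by simp
  then show ?thesis by (rule Z_goldenI)
qed

text \<open>The two coordinates with respect to \<open>1\<close> and \<open>\<tau>\<close>, reduced modulo \<open>n\<close>.\<close>

definition gcoord_mod :: "nat \<Rightarrow> real \<Rightarrow> int \<times> int" where
  "gcoord_mod n x = (SOME c. \<exists>a b. x = of_int a + of_int b * golden \<and> c = (a mod int n, b mod int n))"

lemma gcoord_mod_eq: "gcoord_mod n (of_int a + of_int b * golden) = (a mod int n, b mod int n)"
proof -
  have "\<exists>c. \<exists>a' b'. of_int a + of_int b * golden = of_int a' + of_int b' * golden \<and> c = (a' mod int n, b' mod int n)"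
    by blast
  from someI_ex[OF this] obtain a' b' where ab: "of_int a + of_int b * golden = of_int a' + of_int b' * golden"
    "gcoord_mod n (of_int a + of_int b * golden) = (a' mod int n, b' mod int n)"
    unfolding gcoord_mod_def by blast
  have "of_int (a - a') + of_int (b - b') * golden = 0" using ab(1) by (simp add: algebra_simps)
  then have "a = a'" "b = b'" using golden_int_independent[of "a - a'" "b - b'"] by simp_all
  then show ?thesis using ab by simp
qed

lemma gcoord_mod_eq_iff:
  assumes "n > 0" "x \<in> Z_golden" "y \<in> Z_golden"
  shows "gcoord_mod n x = gcoord_mod n y \<longleftrightarrow> x - y \<in> (*) (of_nat n) ` Z_golden"
proof -
  obtain a b where ab: "x = of_int a + of_int b * golden" using assms by (elim Z_goldenE)
  obtain c d where cd: "y = of_int c + of_int d * golden" using assms by (elim Z_goldenE)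
  have "x - y \<in> (*) (of_nat n) ` Z_golden \<longleftrightarrow> int n dvd a - c \<and> int n dvd b - d"
  proof
    assume "x - y \<in> (*) (of_nat n) ` Z_golden"
    then obtain u where u: "u \<in> Z_golden" "x - y = of_nat n * u" by blast
    obtain e f where "u = of_int e + of_int f * golden" using u by (elim Z_goldenE)
    then have "x - y = of_nat n * (of_int e + of_int f * golden)" using u by blast
    then have "of_int (a - c - int n * e) + of_int (b - d - int n * f) * golden = 0"
      unfolding ab cd by (simp add: algebra_simps)
    then have "a - c - int n * e = 0" "b - d - int n * f = 0" using golden_int_independent by blast+
    then show "int n dvd a - c \<and> int n dvd b - d" by simp
  next
    assume "int n dvd a - c \<and> int n dvd b - d"
    then obtain e f where "a - c = int n * e" "b - d = int n * f" by (elim conjE dvdE)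
    then have "real_of_int (a - c) = of_nat n * of_int e" "real_of_int (b - d) = of_nat n * of_int f"
      by simp_all
    then have "x - y = of_nat n * (of_int e + of_int f * golden)"
      unfolding ab cd by (simp add: algebra_simps)
    then show "x - y \<in> (*) (of_nat n) ` Z_golden" using Z_goldenI by blast
  qed
  then show ?thesis unfolding ab cd gcoord_mod_eq by (simp add: mod_eq_dvd_iff)
qed

lemma gcoord_mod_range:
  assumes "n > 0"
  shows "gcoord_mod n ` Z_golden = {0..<int n} \<times> {0..<int n}"
proof
  show "gcoord_mod n ` Z_golden \<subseteq> {0..<int n} \<times> {0..<int n}"
    using assms by (auto elim!: Z_goldenE simp: gcoord_mod_eq)
  show "{0..<int n} \<times> {0..<int n} \<subseteq> gcoord_mod n ` Z_golden"
  proof (clarify)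
    fix a b assume "a \<in> {0..<int n}" "b \<in> {0..<int n}"
    then have "gcoord_mod n (of_int a + of_int b * golden) = (a, b)" by (simp add: gcoord_mod_eq)
    then show "(a, b) \<in> gcoord_mod n ` Z_golden" by (metis Z_goldenI imageI)
  qed
qed

lemma addsubgroup_gideal: "is_addsubgroup ((*) \<alpha> ` Z_golden)"
proof (rule addsubgroupI)
  have "\<alpha> * 0 \<in> (*) \<alpha> ` Z_golden" by (rule imageI) simp
  then show "0 \<in> (*) \<alpha> ` Z_golden" by simp
  fix x y assume "x \<in> (*) \<alpha> ` Z_golden" "y \<in> (*) \<alpha> ` Z_golden"
  then obtain u v where "u \<in> Z_golden" "v \<in> Z_golden" "x = \<alpha> * u" "y = \<alpha> * v" by blast
  then have "x - y = \<alpha> * (u - v)" "u - v \<in> Z_golden" by (simp_all add: algebra_simps)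
  then show "x - y \<in> (*) \<alpha> ` Z_golden" by blast
qed

lemma index_multiples_nat:
  assumes "n > 0"
  shows "add_index Z_golden ((*) (of_nat n) ` Z_golden) = n\<^sup>2"
proof -
  have "add_index Z_golden ((*) (of_nat n) ` Z_golden) = card (gcoord_mod n ` Z_golden)"
    by (rule cosets_classify(2)) (use addsubgroup_gideal gcoord_mod_eq_iff assms in auto)
  then show ?thesis by (simp add: gcoord_mod_range[OF assms] power2_eq_square)
qed

text \<open>Conjugation shows that \<open>\<alpha> \<O>\<close> and \<open>\<alpha>' \<O>\<close> have the same index in \<open>\<O>\<close>. The chain
  \<open>\<O> \<supseteq> \<alpha> \<O> \<supseteq> \<alpha> \<alpha>' \<O> = n \<O>\<close> then gives the square of this index as \<open>n\<^sup>2\<close>, which avoids a normal form of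
  the matrix of \<open>\<alpha>\<close>.\<close>

lemma index_gideal:
  assumes \<alpha>: "\<alpha> \<in> Z_golden" and norm: "\<alpha> * gconj \<alpha> = of_nat n" and n: "n > 0"
  shows "add_index Z_golden ((*) \<alpha> ` Z_golden) = n"
proof -
  let ?O = Z_golden and ?A = "(*) \<alpha> ` Z_golden" and ?N = "(*) (of_nat n) ` Z_golden"
  have \<alpha>': "gconj \<alpha> \<in> Z_golden" using gconj_Z_golden \<alpha> by blast
  have nz: "\<alpha> \<noteq> 0" using norm n by auto
  have sub: "?A \<subseteq> ?O" using \<alpha> by auto
  have sub2: "?N \<subseteq> ?A"
  proof
    fix x assume "x \<in> ?N"
    then obtain u where "u \<in> ?O" "x = \<alpha> * (gconj \<alpha> * u)" using norm by (auto simp: mult.assoc[symmetric])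
    then show "x \<in> ?A" using \<alpha>' by auto
  qed
  \<comment> \<open>Multiplication by \<open>\<alpha>\<close> carries the ideal generated by the conjugate to the one generated by \<open>n\<close>.\<close>
  have "add_index ?A ?N = add_index ?O ((*) (gconj \<alpha>) ` ?O)"
  proof (rule add_index_transport(2)[symmetric, where f = "(*) \<alpha>"])
    show "\<alpha> * x - \<alpha> * y \<in> ?N \<longleftrightarrow> x - y \<in> (*) (gconj \<alpha>) ` ?O" for x y
    proof -
      have "\<alpha> * x - \<alpha> * y = of_nat n * u \<longleftrightarrow> x - y = gconj \<alpha> * u" for u
      proof -
        have "\<alpha> * x - \<alpha> * y = of_nat n * u \<longleftrightarrow> \<alpha> * (x - y) = \<alpha> * (gconj \<alpha> * u)"
          unfolding norm[symmetric] by (simp only: right_diff_distrib mult.assoc)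
        then show ?thesis using nz by simp
      qed
      then show ?thesis by (simp add: image_iff)
    qed
  next
    fix c assume "c \<in> ?A"
    then obtain a where "a \<in> ?O" "c - \<alpha> * a = 0" by auto
    then show "\<exists>a\<in>?O. c - \<alpha> * a \<in> ?N" using addsubgroup_zero[OF addsubgroup_gideal] by metis
  qed (auto simp: addsubgroup_gideal)
  also have "\<dots> = add_index ?O ?A"
  proof (rule add_index_transport(2)[where f = gconj])
    show "gconj x - gconj y \<in> ?A \<longleftrightarrow> x - y \<in> (*) (gconj \<alpha>) ` ?O" if "x \<in> ?O" "y \<in> ?O" for x y
    proof -
      have K: "x \<in> Q_sqrt5" "y \<in> Q_sqrt5" "\<alpha> \<in> Q_sqrt5" using that \<alpha> Z_golden_sub by auto
      have d: "gconj x - gconj y = gconj (x - y)"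
        using gconj_add[of x "- y"] gconj_uminus[of y] K by simp
      show ?thesis
      proof
        assume "gconj x - gconj y \<in> ?A"
        then obtain u where u: "u \<in> ?O" "gconj (x - y) = \<alpha> * u" using d by auto
        then have "gconj (gconj (x - y)) = gconj \<alpha> * gconj u" using gconj_mult K Z_golden_sub by simp
        then have "x - y = gconj \<alpha> * gconj u" using gconj_gconj K by simp
        then show "x - y \<in> (*) (gconj \<alpha>) ` ?O" using gconj_Z_golden u by blast
      next
        assume "x - y \<in> (*) (gconj \<alpha>) ` ?O"
        then obtain u where u: "u \<in> ?O" "x - y = gconj \<alpha> * u" by blast
        then have "gconj (x - y) = \<alpha> * gconj u"
          using gconj_mult[of "gconj \<alpha>" u] K gconj_gconj Z_golden_sub by simp
        then show "gconj x - gconj y \<in> ?A" using d gconj_Z_golden u by auto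
      qed
    qed
  next
    fix c assume "c \<in> ?O"
    then have "c - gconj (gconj c) = 0" using gconj_gconj Z_golden_sub by simp
    then show "\<exists>a\<in>?O. c - gconj a \<in> ?A"
      using addsubgroup_zero[OF addsubgroup_gideal] gconj_Z_golden \<open>c \<in> ?O\<close> by metis
  qed (auto simp: addsubgroup_gideal gconj_Z_golden)
  finally have "add_index ?O ?N = add_index ?O ?A * add_index ?O ?A"
    using add_index_tower(1)[OF addsubgroup_Z_golden addsubgroup_gideal addsubgroup_gideal sub2 sub] by simp
  then have "n\<^sup>2 = (add_index ?O ?A)\<^sup>2" using index_multiples_nat[OF n] by (simp add: power2_eq_square)
  then show ?thesis by simp
qed

lemma index_multiples_int:
  assumes "p > 0"
  shows "add_index (UNIV :: int set) {i. int p dvd i} = p"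
proof -
  have "add_index (UNIV :: int set) {i. int p dvd i} = card ((\<lambda>i. i mod int p) ` UNIV)"
    by (rule cosets_classify(2)) (auto simp: is_addsubgroup_def mod_eq_dvd_iff)
  also have "(\<lambda>i. i mod int p) ` UNIV = {0..<int p}"
    using assms by (auto intro: image_eqI[of _ _ "_ :: int"] simp: image_iff) (metis mod_pos_pos_trivial)
  finally show ?thesis by simp
qed

lemma index_multiples_int2:
  assumes "p > 0"
  shows "add_index (UNIV :: (int \<times> int) set) {(i, j). int p dvd i \<and> int p dvd j} = p\<^sup>2"
proof -
  let ?f = "\<lambda>(i, j). (i mod int p, j mod int p)"
  have "add_index (UNIV :: (int \<times> int) set) {(i, j). int p dvd i \<and> int p dvd j} = card (?f ` UNIV)"
    by (rule cosets_classify(2)) (auto simp: is_addsubgroup_def mod_eq_dvd_iff zero_prod_def)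
  also have "?f ` UNIV = {0..<int p} \<times> {0..<int p}"
  proof
    show "?f ` UNIV \<subseteq> {0..<int p} \<times> {0..<int p}" using assms by auto
    show "{0..<int p} \<times> {0..<int p} \<subseteq> ?f ` UNIV"
    proof (clarify)
      fix i j assume "i \<in> {0..<int p}" "j \<in> {0..<int p}"
      then have "(i, j) = ?f (i, j)" by simp
      then show "(i, j) \<in> ?f ` UNIV" by blast
    qed
  qed
  finally show ?thesis by (simp add: power2_eq_square)
qed

lemma prime_order_multiple:
  fixes y :: "'a::real_vector"
  assumes p: "prime p" and B: "is_addsubgroup B" and y: "y \<notin> B" "of_nat p *\<^sub>R y \<in> B"
  shows "of_int i *\<^sub>R y \<in> B \<longleftrightarrow> int p dvd i"
proof
  assume i: "of_int i *\<^sub>R y \<in> B"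
  show "int p dvd i"
  proof (rule ccontr)
    assume "\<not> int p dvd i"
    then have "coprime (int p) i" using p by (simp add: prime_imp_coprime)
    then obtain u v where "u * int p + v * i = 1" using bezout_int[of "int p" i] by auto
    then have "of_int (u * int p + v * i) = (1::real)" by simp
    then have "y = of_int u *\<^sub>R (of_nat p *\<^sub>R y) + of_int v *\<^sub>R (of_int i *\<^sub>R y)"
      by (simp add: scaleR_left_distrib[symmetric])
    also have "\<dots> \<in> B" by (intro addsubgroup_add addsubgroup_scale_int B y i)
    finally show False using y by blast
  qed
next
  assume "int p dvd i"
  then obtain t where "i = t * int p" by (metis dvdE mult.commute)
  then have "of_int i *\<^sub>R y = of_int t *\<^sub>R (of_nat p *\<^sub>R y)" by simp
  then show "of_int i *\<^sub>R y \<in> B" using addsubgroup_scale_int[OF B y(2), of t] by metis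
qed

text \<open>Induction on the index. Some \<open>y\<close> in \<open>A\<close> outside \<open>B\<close> has prime order \<open>p\<close> modulo \<open>B\<close>. The submodule \<open>C\<close>
  generated by \<open>B\<close> and \<open>y\<close> is spanned over \<open>B\<close> by \<open>y\<close> and \<open>z = \<tau> y\<close>. Either these are independent
  modulo \<open>p\<close>, and \<open>C / B\<close> has order \<open>p\<^sup>2\<close>, or \<open>z\<close> is congruent to a multiple \<open>c y\<close>, the order is \<open>p\<close>, and
  \<open>\<tau>\<^sup>2 = \<tau> + 1\<close> makes \<open>c\<close> a root of \<open>c\<^sup>2 - c - 1\<close> modulo \<open>p\<close>.\<close>

lemma index_is_golden_norm:
  fixes A B :: "'a::real_vector set"
  assumes A: "is_addsubgroup A" "\<And>x. x \<in> A \<Longrightarrow> golden *\<^sub>R x \<in> A"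
    and B: "is_addsubgroup B" "\<And>x. x \<in> B \<Longrightarrow> golden *\<^sub>R x \<in> B" "B \<subseteq> A"
    and fin: "finite (cosets_in A B)"
  shows "is_golden_norm (int (add_index A B))"
  using B fin
proof (induction "add_index A B" arbitrary: B rule: less_induct)
  case less
  note B = less.prems(1-3) and fin = less.prems(4)
  show ?case
  proof (cases "A = B")
    case True
    then show ?thesis using add_index_self[OF A(1)] by (auto intro: is_golden_normI[of _ 1 0])
  next
    case False
    then obtain x where x: "x \<in> A" "x \<notin> B" using B by blast
    define n where "n = (LEAST n::nat. n > 0 \<and> of_nat n *\<^sub>R x \<in> B)"
    have n: "n > 0" "of_nat n *\<^sub>R x \<in> B"
      using LeastI_ex[OF finite_index_multiple[OF A(1) B(1) fin x(1)]] unfolding n_def by auto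
    have least: "of_nat k *\<^sub>R x \<notin> B" if "k > 0" "k < n" for k
      using not_less_Least[of k "\<lambda>n. n > 0 \<and> of_nat n *\<^sub>R x \<in> B"] that unfolding n_def by blast
    have "n \<noteq> 1" using n x by auto
    then obtain p where p: "prime p" "p dvd n" using prime_factor_nat by blast
    then obtain r where r: "n = p * r" by blast
    have r0: "r > 0" "r < n" using n r prime_gt_1_nat[OF p(1)] by auto
    define y where "y = of_nat r *\<^sub>R x"
    have yA: "y \<in> A" using addsubgroup_scale_int[OF A(1) x(1), of "int r"] unfolding y_def by simp
    have y: "y \<notin> B" "of_nat p *\<^sub>R y \<in> B" using least[OF r0] n(2) unfolding y_def r by simp_all
    note mult_iff = prime_order_multiple[OF p(1) B(1) y]
    define z where "z = golden *\<^sub>R y"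
    have zA: "z \<in> A" using A(2) yA unfolding z_def by blast
    have pz: "of_nat p *\<^sub>R z \<in> B" using B(2)[OF y(2)] unfolding z_def by (simp add: mult.commute)
    have gz: "golden *\<^sub>R z = y + z"
      unfolding z_def scaleR_scaleR golden_mult_golden by (simp add: scaleR_left_distrib)
    define C where "C = {b + of_int i *\<^sub>R y + of_int j *\<^sub>R z | b i j. b \<in> B}"
    have CI: "b + of_int i *\<^sub>R y + of_int j *\<^sub>R z \<in> C" if "b \<in> B" for b i j
      unfolding C_def using that by blast
    have C1: "is_addsubgroup C"
    proof (rule addsubgroupI)
      show "0 \<in> C" using CI[of 0 0 0] addsubgroup_zero[OF B(1)] by simp
      fix u v assume "u \<in> C" "v \<in> C"
      then obtain b i j b' i' j' where b: "b \<in> B" "b' \<in> B"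
        and uv: "u = b + of_int i *\<^sub>R y + of_int j *\<^sub>R z" "v = b' + of_int i' *\<^sub>R y + of_int j' *\<^sub>R z"
        unfolding C_def by blast
      have "u - v = (b - b') + of_int (i - i') *\<^sub>R y + of_int (j - j') *\<^sub>R z"
        unfolding uv by (simp add: algebra_simps)
      then show "u - v \<in> C" using CI addsubgroup_diff[OF B(1) b] by metis
    qed
    have C2: "golden *\<^sub>R u \<in> C" if uC: "u \<in> C" for u
    proof -
      obtain b i j where b: "b \<in> B" and u: "u = b + of_int i *\<^sub>R y + of_int j *\<^sub>R z"
        using uC unfolding C_def by blast
      have "golden *\<^sub>R u = golden *\<^sub>R b + of_int i *\<^sub>R z + of_int j *\<^sub>R (golden *\<^sub>R z)"
        unfolding u z_def by (simp add: algebra_simps)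
      also have "\<dots> = golden *\<^sub>R b + of_int j *\<^sub>R y + of_int (i + j) *\<^sub>R z"
        unfolding gz by (simp add: algebra_simps)
      finally show ?thesis using CI B(2)[OF b] by metis
    qed
    have C3: "C \<subseteq> A"
      unfolding C_def using B(3) by (auto intro!: addsubgroup_add[OF A(1)] addsubgroup_scale_int[OF A(1)] yA zA)
    have BC: "B \<subseteq> C"
    proof
      fix b assume "b \<in> B"
      then show "b \<in> C" using CI[of b 0 0] by simp
    qed
    have yC: "y \<in> C" using CI[of 0 1 0] addsubgroup_zero[OF B(1)] by simp
    note tower = add_index_tower[OF A(1) C1 B(1) BC C3]
    have finAC: "finite (cosets_in A C)" using tower(2) fin by blast
    have idx: "is_golden_norm (int (add_index C B)) \<and> add_index C B > 1"
    proof (cases "\<exists>c::int. z - of_int c *\<^sub>R y \<in> B")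
      case True
      then obtain c :: int where c: "z - of_int c *\<^sub>R y \<in> B" by blast
      have "of_int (1 + c - c\<^sup>2) *\<^sub>R y = golden *\<^sub>R (z - of_int c *\<^sub>R y) - of_int (1 - c) *\<^sub>R (z - of_int c *\<^sub>R y)"
        unfolding scaleR_diff_right gz by (simp add: z_def algebra_simps power2_eq_square)
      also have "\<dots> \<in> B" by (intro addsubgroup_diff B addsubgroup_scale_int c)
      finally have "int p dvd 1 + c - c\<^sup>2" using mult_iff by blast
      then have "int p dvd - (1 + c - c\<^sup>2)" by (simp only: dvd_minus_iff)
      then have "int p dvd c\<^sup>2 - c - 1" by (simp add: algebra_simps)
      then have norm: "is_golden_norm (int p)" using is_golden_norm_prime p by blast
      have "add_index (UNIV :: int set) {i. int p dvd i} = add_index C B"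
      proof (rule add_index_transport(2)[where f = "\<lambda>i. of_int i *\<^sub>R y"])
        show "is_addsubgroup {i. int p dvd i}" by (simp add: is_addsubgroup_def)
        show "of_int i *\<^sub>R y \<in> C" for i using addsubgroup_scale_int[OF C1 yC] .
        show "of_int i *\<^sub>R y - of_int j *\<^sub>R y \<in> B \<longleftrightarrow> i - j \<in> {i. int p dvd i}" for i j
          using mult_iff[of "i - j"] by (simp add: scaleR_left_diff_distrib)
        fix u assume "u \<in> C"
        then obtain b i j where b: "b \<in> B" and u: "u = b + of_int i *\<^sub>R y + of_int j *\<^sub>R z"
          unfolding C_def by blast
        have "u - of_int (i + j * c) *\<^sub>R y = b + of_int j *\<^sub>R (z - of_int c *\<^sub>R y)"
          unfolding u by (simp add: algebra_simps)
        also have "\<dots> \<in> B" by (intro addsubgroup_add B addsubgroup_scale_int b c)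
        finally show "\<exists>a\<in>UNIV. u - of_int a *\<^sub>R y \<in> B" by blast
      qed (rule B)
      then have "add_index C B = p" using index_multiples_int prime_gt_0_nat[OF p(1)] by simp
      then show ?thesis using norm prime_gt_1_nat[OF p(1)] by simp
    next
      case nex: False
      have key: "of_int i *\<^sub>R y + of_int j *\<^sub>R z \<in> B \<longleftrightarrow> int p dvd i \<and> int p dvd j" for i j
      proof
        assume ij: "of_int i *\<^sub>R y + of_int j *\<^sub>R z \<in> B"
        have "int p dvd j"
        proof (rule ccontr)
          assume "\<not> int p dvd j"
          then have "coprime (int p) j" using p by (simp add: prime_imp_coprime)
          then obtain u v where uv: "u * int p + v * j = 1" using bezout_int[of "int p" j] by auto
          have "z - of_int (- v * i) *\<^sub>R y = of_int (u * int p + v * j) *\<^sub>R z - of_int (- v * i) *\<^sub>R y"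
            unfolding uv by simp
          also have "\<dots> = of_int v *\<^sub>R (of_int i *\<^sub>R y + of_int j *\<^sub>R z) + of_int u *\<^sub>R (of_nat p *\<^sub>R z)"
            by (simp add: algebra_simps)
          also have "\<dots> \<in> B" by (intro addsubgroup_add B addsubgroup_scale_int ij pz)
          finally show False using nex by blast
        qed
        moreover from this obtain t where "j = t * int p" by (metis dvdE mult.commute)
        then have "of_int i *\<^sub>R y = (of_int i *\<^sub>R y + of_int j *\<^sub>R z) - of_int t *\<^sub>R (of_nat p *\<^sub>R z)" by simp
        then have "of_int i *\<^sub>R y \<in> B"
          using addsubgroup_diff[OF B(1) ij addsubgroup_scale_int[OF B(1) pz]] by metis
        ultimately show "int p dvd i \<and> int p dvd j" using mult_iff by blast
      next
        assume ij: "int p dvd i \<and> int p dvd j"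
        then obtain t where "j = t * int p" by (metis dvdE mult.commute)
        then have "of_int j *\<^sub>R z = of_int t *\<^sub>R (of_nat p *\<^sub>R z)" by simp
        then have "of_int j *\<^sub>R z \<in> B" using addsubgroup_scale_int[OF B(1) pz] by metis
        then show "of_int i *\<^sub>R y + of_int j *\<^sub>R z \<in> B"
          using ij mult_iff addsubgroup_add[OF B(1)] by blast
      qed
      have "add_index (UNIV :: (int \<times> int) set) {(i, j). int p dvd i \<and> int p dvd j} = add_index C B"
      proof (rule add_index_transport(2)[where f = "\<lambda>(i, j). of_int i *\<^sub>R y + of_int j *\<^sub>R z"])
        show "is_addsubgroup {(i, j). int p dvd i \<and> int p dvd j}"
          by (auto simp: is_addsubgroup_def zero_prod_def)
        show "(case a of (i, j) \<Rightarrow> of_int i *\<^sub>R y + of_int j *\<^sub>R z) \<in> C" for a :: "int \<times> int"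
          using CI[OF addsubgroup_zero[OF B(1)]] by (auto split: prod.split)
        show "(case a of (i, j) \<Rightarrow> of_int i *\<^sub>R y + of_int j *\<^sub>R z)
            - (case b of (i, j) \<Rightarrow> of_int i *\<^sub>R y + of_int j *\<^sub>R z) \<in> B
            \<longleftrightarrow> a - b \<in> {(i, j). int p dvd i \<and> int p dvd j}" for a b :: "int \<times> int"
        proof -
          obtain i j where a: "a = (i, j)" by force
          obtain k l where b: "b = (k, l)" by force
          have "of_int i *\<^sub>R y + of_int j *\<^sub>R z - (of_int k *\<^sub>R y + of_int l *\<^sub>R z)
              = of_int (i - k) *\<^sub>R y + of_int (j - l) *\<^sub>R z" by (simp add: algebra_simps)
          then show ?thesis using key[of "i - k" "j - l"] unfolding a b by simp
        qed
        fix u assume "u \<in> C"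
        then obtain b i j where b: "b \<in> B" and u: "u = b + of_int i *\<^sub>R y + of_int j *\<^sub>R z"
          unfolding C_def by blast
        then show "\<exists>a\<in>UNIV. u - (case a of (i, j) \<Rightarrow> of_int i *\<^sub>R y + of_int j *\<^sub>R z) \<in> B"
          by (intro bexI[of _ "(i, j)"]) auto
      qed (rule B)
      then have "add_index C B = p\<^sup>2" using index_multiples_int2 prime_gt_0_nat[OF p(1)] by simp
      then show ?thesis using prime_gt_1_nat[OF p(1)] is_golden_norm_square[of "int p"]
        one_less_power[of p 2] by simp
    qed
    have "add_index A C > 0" using add_index_pos[OF finAC] addsubgroup_zero[OF A(1)] by blast
    then have "add_index A C < add_index A B" unfolding tower(1) using idx by simp
    then have "is_golden_norm (int (add_index A C))" using less.hyps C1 C2 C3 finAC by blast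
    then show ?thesis unfolding tower(1) using idx is_golden_norm_mult by simp
  qed
qed

section \<open>Quaternions and icosians\<close>

datatype quat = Quat (q0: real) (q1: real) (q2: real) (q3: real)

lemma quat_eq_iff: "x = y \<longleftrightarrow> q0 x = q0 y \<and> q1 x = q1 y \<and> q2 x = q2 y \<and> q3 x = q3 y"
  by (cases x; cases y) simp

instantiation quat :: ring_1
begin

definition "0 = Quat 0 0 0 0"
definition "1 = Quat 1 0 0 0"
definition "x + y = Quat (q0 x + q0 y) (q1 x + q1 y) (q2 x + q2 y) (q3 x + q3 y)"
definition "- x = Quat (- q0 x) (- q1 x) (- q2 x) (- q3 x)"
definition "(x :: quat) - y = Quat (q0 x - q0 y) (q1 x - q1 y) (q2 x - q2 y) (q3 x - q3 y)"
definition "x * y = Quat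
  (q0 x * q0 y - q1 x * q1 y - q2 x * q2 y - q3 x * q3 y)
  (q0 x * q1 y + q1 x * q0 y + q2 x * q3 y - q3 x * q2 y)
  (q0 x * q2 y - q1 x * q3 y + q2 x * q0 y + q3 x * q1 y)
  (q0 x * q3 y + q1 x * q2 y - q2 x * q1 y + q3 x * q0 y)"

instance
  by standard
    (simp_all add: zero_quat_def one_quat_def plus_quat_def uminus_quat_def minus_quat_def
      times_quat_def quat_eq_iff algebra_simps)

end

lemma quat_sel [simp]:
  "q0 0 = 0" "q1 0 = 0" "q2 0 = 0" "q3 0 = 0"
  "q0 1 = 1" "q1 1 = 0" "q2 1 = 0" "q3 1 = 0"
  "q0 (x + y) = q0 x + q0 y" "q1 (x + y) = q1 x + q1 y" "q2 (x + y) = q2 x + q2 y" "q3 (x + y) = q3 x + q3 y"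
  "q0 (x - y) = q0 x - q0 y" "q1 (x - y) = q1 x - q1 y" "q2 (x - y) = q2 x - q2 y" "q3 (x - y) = q3 x - q3 y"
  "q0 (- x) = - q0 x" "q1 (- x) = - q1 x" "q2 (- x) = - q2 x" "q3 (- x) = - q3 x"
  by (simp_all add: zero_quat_def one_quat_def plus_quat_def uminus_quat_def minus_quat_def)

lemma quat_times_sel [simp]:
  "q0 (x * y) = q0 x * q0 y - q1 x * q1 y - q2 x * q2 y - q3 x * q3 y"
  "q1 (x * y) = q0 x * q1 y + q1 x * q0 y + q2 x * q3 y - q3 x * q2 y"
  "q2 (x * y) = q0 x * q2 y - q1 x * q3 y + q2 x * q0 y + q3 x * q1 y"
  "q3 (x * y) = q0 x * q3 y + q1 x * q2 y - q2 x * q1 y + q3 x * q0 y"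
  by (simp_all add: times_quat_def)

text \<open>Conjugate, reduced norm, reduced trace, and the embedding of the scalars, which are central.\<close>

definition qcnj :: "quat \<Rightarrow> quat" where "qcnj x = Quat (q0 x) (- q1 x) (- q2 x) (- q3 x)"
definition qnr :: "quat \<Rightarrow> real" where "qnr x = (q0 x)\<^sup>2 + (q1 x)\<^sup>2 + (q2 x)\<^sup>2 + (q3 x)\<^sup>2"
definition qtr :: "quat \<Rightarrow> real" where "qtr x = 2 * q0 x"
definition qr :: "real \<Rightarrow> quat" where "qr r = Quat r 0 0 0"

lemma qcnj_sel [simp]: "q0 (qcnj x) = q0 x" "q1 (qcnj x) = - q1 x" "q2 (qcnj x) = - q2 x" "q3 (qcnj x) = - q3 x"
  by (simp_all add: qcnj_def)

lemma qr_sel [simp]: "q0 (qr r) = r" "q1 (qr r) = 0" "q2 (qr r) = 0" "q3 (qr r) = 0"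
  by (simp_all add: qr_def)

lemma qr_0 [simp]: "qr 0 = 0" and qr_1 [simp]: "qr 1 = 1"
  by (simp_all add: quat_eq_iff)

lemma qr_mult: "qr (r * s) = qr r * qr s"
  by (simp add: quat_eq_iff)

lemma qr_commute: "x * qr r = qr r * x"
  by (simp add: quat_eq_iff)

lemma qr_left_commute: "x * (qr r * y) = qr r * (x * y)"
  by (simp add: mult.assoc[symmetric] qr_commute)

lemma qr_cancel: "r \<noteq> 0 \<Longrightarrow> qr r * x = qr r * y \<longleftrightarrow> x = y"
  by (simp add: quat_eq_iff)

lemma qcnj_mult: "qcnj (x * y) = qcnj y * qcnj x" and qcnj_add: "qcnj (x + y) = qcnj x + qcnj y"
  and qcnj_qr [simp]: "qcnj (qr r) = qr r" and qcnj_qcnj [simp]: "qcnj (qcnj x) = x"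
  by (simp_all add: quat_eq_iff algebra_simps)

lemma mult_qcnj: "x * qcnj x = qr (qnr x)" and qcnj_mult_self: "qcnj x * x = qr (qnr x)"
  by (simp_all add: quat_eq_iff qnr_def power2_eq_square algebra_simps)

lemma qnr_mult: "qnr (x * y) = qnr x * qnr y"
  by (simp add: qnr_def power2_eq_square algebra_simps)

lemma qnr_qr [simp]: "qnr (qr r) = r\<^sup>2" and qnr_qcnj [simp]: "qnr (qcnj x) = qnr x"
  by (simp_all add: qnr_def)

lemma add_qcnj: "x + qcnj x = qr (qtr x)"
  by (simp add: quat_eq_iff qtr_def)

text \<open>The trace is invariant under conjugation; the factor appears because \<open>qcnj q\<close> replaces the inverse.\<close>

lemma qtr_conjugate: "qtr (q * z * qcnj q) = qnr q * qtr z"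
  by (simp add: qtr_def qnr_def power2_eq_square algebra_simps)

lemma qtr_qr_mult: "qtr (x * qr r) = r * qtr x"
  by (simp add: qtr_def)

lemma qnr_eq_0_iff: "qnr x = 0 \<longleftrightarrow> x = 0"
  by (auto simp: qnr_def quat_eq_iff add_nonneg_eq_0_iff)

lemma qnr_nonneg: "qnr x \<ge> 0"
  by (simp add: qnr_def)

text \<open>Together with \<open>1\<close>, a basis of the icosians over \<open>\<O>\<close>.\<close>

definition qi :: quat where "qi = Quat 0 1 0 0"
definition qomega :: quat where "qomega = Quat (1/2) (1/2) (1/2) (1/2)"
definition qiota :: quat where "qiota = Quat 0 (1/2) ((golden - 1) / 2) (golden / 2)"

definition qcomb :: "real \<Rightarrow> real \<Rightarrow> real \<Rightarrow> real \<Rightarrow> quat" where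
  "qcomb a b c d = qr a * qomega + qr b * qiota + qr c + qr d * qi"

lemma qcomb_sel [simp]:
  "q0 (qcomb a b c d) = c + a / 2" "q1 (qcomb a b c d) = d + (a + b) / 2"
  "q2 (qcomb a b c d) = (a + (golden - 1) * b) / 2" "q3 (qcomb a b c d) = (a + golden * b) / 2"
  by (simp_all add: qcomb_def qomega_def qiota_def qi_def field_simps)

text \<open>The doubled icosians are the quadruples over \<open>\<O>\<close> whose reduction modulo \<open>2\<close> lies in the code over the
  field with four elements spanned by \<open>(1, 1, 1, 1)\<close> and \<open>(0, 1, \<tau> - 1, \<tau>)\<close>.\<close>

definition icosian :: "quat set" where
  "icosian = {qcomb a b c d | a b c d. a \<in> Z_golden \<and> b \<in> Z_golden \<and> c \<in> Z_golden \<and> d \<in> Z_golden}"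

lemma icosianE:
  assumes "x \<in> icosian"
  obtains a b c d where "a \<in> Z_golden" "b \<in> Z_golden" "c \<in> Z_golden" "d \<in> Z_golden" "x = qcomb a b c d"
  using assms unfolding icosian_def by blast

text \<open>The four coordinates solved for: the last two parts determine \<open>a\<close> and \<open>b\<close>, and what the first two
  parts then leave for \<open>c\<close> and \<open>d\<close> is required to be integral.\<close>

lemma icosian_iff:
  "x \<in> icosian \<longleftrightarrow> 2 * q2 x \<in> Z_golden \<and> 2 * q3 x \<in> Z_golden
    \<and> q0 x - q2 x + (golden - 1) * (q3 x - q2 x) \<in> Z_golden
    \<and> q1 x - (golden - 1) * q2 x - (2 - golden) * q3 x \<in> Z_golden"
    (is "_ \<longleftrightarrow> ?R")
proof
  assume "x \<in> icosian"
  then obtain a b c d where abcd: "a \<in> Z_golden" "b \<in> Z_golden" "c \<in> Z_golden" "d \<in> Z_golden"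
    and x: "x = qcomb a b c d" by (elim icosianE)
  have 1: "2 * q2 x = a + (golden - 1) * b" "2 * q3 x = a + golden * b"
    unfolding x by simp_all
  have 2: "q0 x - q2 x + (golden - 1) * (q3 x - q2 x) = c"
    "q1 x - (golden - 1) * q2 x - (2 - golden) * q3 x = d"
    unfolding x by (simp_all add: field_simps golden_reduce)
  show ?R unfolding 2 unfolding 1 using abcd by simp
next
  assume R: ?R
  define b where "b = 2 * q3 x - 2 * q2 x"
  define a where "a = 2 * q2 x - (golden - 1) * b"
  define c where "c = q0 x - q2 x + (golden - 1) * (q3 x - q2 x)"
  define d where "d = q1 x - (golden - 1) * q2 x - (2 - golden) * q3 x"
  have "x = qcomb a b c d"
    by (simp add: quat_eq_iff a_def b_def c_def d_def add_divide_distrib diff_divide_distrib algebra_simps)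
  moreover have "a \<in> Z_golden" "b \<in> Z_golden" "c \<in> Z_golden" "d \<in> Z_golden"
    using R unfolding a_def b_def c_def d_def by simp_all
  ultimately show "x \<in> icosian" unfolding icosian_def by blast
qed

lemma icosian_add [simp]:
  assumes "x \<in> icosian" "y \<in> icosian"
  shows "x + y \<in> icosian"
proof -
  have e: "2 * q2 (x + y) = 2 * q2 x + 2 * q2 y" "2 * q3 (x + y) = 2 * q3 x + 2 * q3 y"
    "q0 (x + y) - q2 (x + y) + (golden - 1) * (q3 (x + y) - q2 (x + y))
      = (q0 x - q2 x + (golden - 1) * (q3 x - q2 x)) + (q0 y - q2 y + (golden - 1) * (q3 y - q2 y))"
    "q1 (x + y) - (golden - 1) * q2 (x + y) - (2 - golden) * q3 (x + y)
      = (q1 x - (golden - 1) * q2 x - (2 - golden) * q3 x) + (q1 y - (golden - 1) * q2 y - (2 - golden) * q3 y)"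
    by (simp_all add: algebra_simps)
  show ?thesis
    unfolding icosian_iff e using assms[unfolded icosian_iff] by (blast intro: Z_golden_add)
qed

lemma icosian_scale [simp]:
  assumes "r \<in> Z_golden" "x \<in> icosian"
  shows "qr r * x \<in> icosian"
proof -
  have e: "2 * q2 (qr r * x) = r * (2 * q2 x)" "2 * q3 (qr r * x) = r * (2 * q3 x)"
    "q0 (qr r * x) - q2 (qr r * x) + (golden - 1) * (q3 (qr r * x) - q2 (qr r * x))
      = r * (q0 x - q2 x + (golden - 1) * (q3 x - q2 x))"
    "q1 (qr r * x) - (golden - 1) * q2 (qr r * x) - (2 - golden) * q3 (qr r * x)
      = r * (q1 x - (golden - 1) * q2 x - (2 - golden) * q3 x)"
    by (simp_all add: algebra_simps)
  show ?thesis
    unfolding icosian_iff e using assms(2)[unfolded icosian_iff] by (intro conjI Z_golden_mult[OF assms(1)]) blast+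
qed

lemma icosian_0 [simp]: "0 \<in> icosian"
  by (simp add: icosian_iff)

lemma icosian_1 [simp]: "1 \<in> icosian"
  by (simp add: icosian_iff)

lemma icosian_qr [simp]: "r \<in> Z_golden \<Longrightarrow> qr r \<in> icosian"
  using icosian_scale[of r 1] by simp

lemma icosian_uminus [simp]: "x \<in> icosian \<Longrightarrow> - x \<in> icosian"
proof -
  assume "x \<in> icosian"
  then have "qr (-1) * x \<in> icosian" by (intro icosian_scale Z_golden_uminus) auto
  moreover have "qr (-1) * x = - x" by (simp add: quat_eq_iff)
  ultimately show ?thesis by simp
qed

lemma icosian_diff [simp]: "x \<in> icosian \<Longrightarrow> y \<in> icosian \<Longrightarrow> x - y \<in> icosian"
  using icosian_add[of x "- y"] by simp

lemma icosian_basis_products: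
  "qi * qi = qcomb 0 0 (-1) 0"
  "qi * qomega = qcomb (1 - 2 * golden) 2 (golden - 1) (golden - 1)"
  "qi * qiota = qcomb (-3) (2 * golden - 1) 1 (2 - golden)"
  "qomega * qi = qcomb (2 * golden - 1) (-2) (- golden) (2 - golden)"
  "qomega * qomega = qcomb 1 0 (-1) 0"
  "qomega * qiota = qcomb (golden - 2) (golden - 1) (1 - golden) (2 - golden)"
  "qiota * qi = qcomb 3 (1 - 2 * golden) (-2) (golden - 2)"
  "qiota * qomega = qcomb (2 - golden) (2 - golden) (-1) (golden - 2)"
  "qiota * qiota = qcomb 0 0 (-1) 0"
  by (simp_all add: quat_eq_iff qomega_def qiota_def qi_def field_simps golden_mult_golden golden_reduce)

lemma icosian_mult [simp]:
  assumes "x \<in> icosian" "y \<in> icosian"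
  shows "x * y \<in> icosian"
proof -
  have comb: "qcomb a b c d \<in> icosian" if "a \<in> Z_golden" "b \<in> Z_golden" "c \<in> Z_golden" "d \<in> Z_golden" for a b c d
    unfolding icosian_def using that by blast
  have basis: "u * v \<in> icosian" if "u \<in> {qi, qomega, qiota}" "v \<in> {qi, qomega, qiota}" for u v
  proof -
    have "- golden \<in> Z_golden" "-1 \<in> Z_golden" "-2 \<in> Z_golden" "-3 \<in> Z_golden"
      by (rule Z_golden_uminus, simp)+
    then show ?thesis using that by (auto simp: icosian_basis_products intro!: comb)
  qed
  have i: "qi \<in> icosian" "qomega \<in> icosian" "qiota \<in> icosian"
    using comb[of 0 0 0 1] comb[of 1 0 0 0] comb[of 0 1 0 0] by (simp_all add: qcomb_def)
  obtain a b c d where x: "x = qcomb a b c d" and a: "a \<in> Z_golden" "b \<in> Z_golden" "c \<in> Z_golden" "d \<in> Z_golden"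
    using assms(1) unfolding icosian_def by blast
  have right: "u * y \<in> icosian" if u: "u \<in> {qi, qomega, qiota}" for u
  proof -
    obtain a b c d where y: "y = qcomb a b c d" and a: "a \<in> Z_golden" "b \<in> Z_golden" "c \<in> Z_golden" "d \<in> Z_golden"
      using assms(2) unfolding icosian_def by blast
    have "u * y = qr a * (u * qomega) + qr b * (u * qiota) + qr c * u + qr d * (u * qi)"
      unfolding y qcomb_def by (simp add: distrib_left qr_left_commute qr_commute)
    also have "\<dots> \<in> icosian" using basis[OF u] a u i by (intro icosian_add icosian_scale) auto
    finally show ?thesis .
  qed
  have "x * y = qr a * (qomega * y) + qr b * (qiota * y) + qr c * y + qr d * (qi * y)"
    unfolding x qcomb_def by (simp add: distrib_right mult.assoc)
  also have "\<dots> \<in> icosian" using right a assms by (intro icosian_add icosian_scale) auto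
  finally show ?thesis .
qed

lemma qtr_icosian: "x \<in> icosian \<Longrightarrow> qtr x \<in> Z_golden"
  by (erule icosianE) (simp add: qtr_def)

lemma icosian_qcnj [simp]: 
  assumes "x \<in> icosian"
  shows "qcnj x \<in> icosian"
proof -
  have "qcnj x = qr (qtr x) - x" using add_qcnj[of x] by (simp add: algebra_simps)
  then show ?thesis using qtr_icosian assms by simp
qed

text \<open>Consequently traces and norms of icosians, being real icosians, lie in \<open>\<O>\<close>.\<close>

lemma icosian_real: "qr r \<in> icosian \<longleftrightarrow> r \<in> Z_golden"
  by (auto simp: icosian_iff)

lemma qnr_icosian: "x \<in> icosian \<Longrightarrow> qnr x \<in> Z_golden"
  using icosian_mult[OF _ icosian_qcnj, of x x] unfolding mult_qcnj icosian_real by blast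

lemma icosian_Q_sqrt5:
  assumes "x \<in> icosian"
  shows "q0 x \<in> Q_sqrt5" "q1 x \<in> Q_sqrt5" "q2 x \<in> Q_sqrt5" "q3 x \<in> Q_sqrt5"
proof -
  obtain a b c d where abcd: "a \<in> Z_golden" "b \<in> Z_golden" "c \<in> Z_golden" "d \<in> Z_golden"
    and x: "x = qcomb a b c d" using assms by (elim icosianE)
  have "a \<in> Q_sqrt5" "b \<in> Q_sqrt5" "c \<in> Q_sqrt5" "d \<in> Q_sqrt5" using abcd Z_golden_sub by auto
  then show "q0 x \<in> Q_sqrt5" "q1 x \<in> Q_sqrt5" "q2 x \<in> Q_sqrt5" "q3 x \<in> Q_sqrt5"
    unfolding x by simp_all
qed

section \<open>Euclidean division of icosians\<close>

text \<open>Besides the nearest integer \<open>u\<close>, the neighbour \<open>u + g\<close> on the other side of \<open>s\<close> is at distance at most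
  one and has the opposite parity.\<close>

lemma round_with_flip:
  fixes s :: real
  shows "\<exists>u g :: int. odd g \<and> (\<forall>f\<in>{0, 1}. (s - of_int (u + f * g))\<^sup>2 \<le> 1 / 4 + 3 / 4 * of_int f)"
proof -
  define u where "u = round s"
  define d where "d = s - of_int u"
  define g :: int where "g = (if d \<ge> 0 then 1 else -1)"
  have d: "\<bar>d\<bar> \<le> 1 / 2" unfolding d_def u_def using of_int_round_abs_le[of s] by (simp add: abs_minus_commute)
  have "\<bar>d - of_int g\<bar> \<le> 1" unfolding g_def using d by auto
  then have "(d - of_int g)\<^sup>2 \<le> 1" by (simp add: abs_square_le_1)
  moreover have "d\<^sup>2 \<le> (1 / 2)\<^sup>2" using d by (intro power2_le_iff_abs_le[THEN iffD2]) auto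
  ultimately have "\<forall>f\<in>{0, 1}. (s - of_int (u + f * g))\<^sup>2 \<le> 1 / 4 + 3 / 4 * of_int f"
    unfolding d_def by (simp add: power2_eq_square algebra_simps)
  moreover have "odd g" unfolding g_def by simp
  ultimately show ?thesis by blast
qed

text \<open>In terms of eight integral coordinates the code behind the doubled icosians is the extended Hamming
  code, whose covering radius is two. Coordinates \<open>0\<close> to \<open>3\<close> each occur in one parity check, and
  coordinates \<open>4\<close> to \<open>7\<close> each occur in three.\<close>

lemma hamming_flips:
  fixes e1 e2 e3 e4 :: int
  shows "\<exists>f0 f1 f2 f3 f4 f5 f6 f7 :: int. {f0, f1, f2, f3, f4, f5, f6, f7} \<subseteq> {0, 1}
    \<and> f0 + f1 + f2 + f3 + f4 + f5 + f6 + f7 \<le> 2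
    \<and> even (e1 + f0 + f4 + f5 + f7) \<and> even (e2 + f1 + f4 + f6 + f7)
    \<and> even (e3 + f2 + f5 + f6 + f7) \<and> even (e4 + f3 + f4 + f5 + f6)"
proof -
  let ?a = "odd e1" and ?b = "odd e2" and ?c = "odd e3" and ?d = "odd e4"
  let ?f4 = "?a \<and> ?b \<and> ?d" and ?f5 = "?a \<and> \<not> ?b \<and> ?c \<and> ?d"
    and ?f6 = "\<not> ?a \<and> ?b \<and> ?c \<and> ?d" and ?f7 = "?a \<and> ?b \<and> ?c \<and> \<not> ?d"
  let ?s = "?f4 \<or> ?f5 \<or> ?f6 \<or> ?f7"
  show ?thesis
    apply (rule exI[of _ "of_bool (?a \<and> \<not> ?s)"], rule exI[of _ "of_bool (?b \<and> \<not> ?s)"])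
    apply (rule exI[of _ "of_bool (?c \<and> (\<not> ?s \<or> ?f4))"], rule exI[of _ "of_bool (?d \<and> \<not> ?s)"])
    apply (rule exI[of _ "of_bool ?f4"], rule exI[of _ "of_bool ?f5"])
    apply (rule exI[of _ "of_bool ?f6"], rule exI[of _ "of_bool ?f7"])
    apply (cases ?a; cases ?b; cases ?c; cases ?d; simp)
    done
qed

text \<open>Weighted with the conjugate numbers \<open>\<tau> + 2\<close> and \<open>3 - \<tau>\<close>, whose product is \<open>5\<close>, the squares of
  \<open>s + t (\<tau> - 1)\<close> and of its conjugate \<open>s - t \<tau>\<close> add up to \<open>5 (s\<^sup>2 + t\<^sup>2)\<close>. The inequality of the means
  bounds the product of the two weighted sums.\<close>

lemma golden_form_bound:
  fixes S T :: "nat \<Rightarrow> real"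
  assumes E_def: "E = (\<Sum>i<n. (S i)\<^sup>2 + (T i)\<^sup>2)"
  shows "(\<Sum>i<n. (S i + T i * (golden - 1))\<^sup>2) * (\<Sum>i<n. (S i - T i * golden)\<^sup>2) \<le> 5 / 4 * E\<^sup>2"
proof -
  define a where "a = (\<Sum>i<n. (S i + T i * (golden - 1))\<^sup>2)"
  define b where "b = (\<Sum>i<n. (S i - T i * golden)\<^sup>2)"
  have one: "(golden + 2) * (s + t * (golden - 1))\<^sup>2 + (3 - golden) * (s - t * golden)\<^sup>2 = 5 * (s\<^sup>2 + t\<^sup>2)" for s t
  proof -
    have "(golden + 2) * (s + t * (golden - 1))\<^sup>2 + (3 - golden) * (s - t * golden)\<^sup>2
      = 5 * s\<^sup>2 + (4 * (golden * golden) - 4 * golden - 4) * s * t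
        + (golden * golden * 3 + 2 - 3 * golden) * t\<^sup>2"
      by (simp add: power2_eq_square algebra_simps)
    then show ?thesis by (simp add: golden_mult_golden algebra_simps)
  qed
  have sum: "(golden + 2) * a + (3 - golden) * b = 5 * E"
    unfolding a_def b_def E_def sum_distrib_left sum.distrib[symmetric] one ..
  have "((golden + 2) * a) * ((3 - golden) * b) = (golden + 6 - golden * golden) * (a * b)"
    by (simp add: algebra_simps)
  then have "((golden + 2) * a) * ((3 - golden) * b) = 5 * (a * b)"
    by (simp add: golden_mult_golden)
  moreover have "4 * (u * v) \<le> (u + v)\<^sup>2" for u v :: real
    using zero_le_power2[of "u - v"] by (simp add: power2_eq_square algebra_simps)
  ultimately have "4 * (5 * (a * b)) \<le> (5 * E)\<^sup>2" using sum by metis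
  then have "a * b \<le> 5 / 4 * E\<^sup>2" by (simp add: power2_eq_square)
  then show ?thesis unfolding a_def b_def .
qed

lemma Q_sqrt5_half_coordinates:
  assumes "y \<in> Q_sqrt5"
  shows "\<exists>s\<in>\<rat>. \<exists>t\<in>\<rat>. y = (s + t * (golden - 1)) / 2"
proof -
  obtain a b where r: "a \<in> \<rat>" "b \<in> \<rat>" and y: "y = a + b * golden" using assms by (elim Q_sqrt5E)
  have "y = (2 * (a + b) + (2 * b) * (golden - 1)) / 2" unfolding y by (simp add: field_simps)
  moreover have "2 * (a + b) \<in> \<rat>" "2 * b \<in> \<rat>" using r by auto
  ultimately show ?thesis by blast
qed

lemma gconj_half_square:
  assumes r: "S \<in> \<rat>" "T \<in> \<rat>"
  shows "((S + T * (golden - 1)) / 2)\<^sup>2 \<in> Q_sqrt5"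
    and "gconj (((S + T * (golden - 1)) / 2)\<^sup>2) = (S - T * golden)\<^sup>2 / 4"
proof -
  let ?z = "(S + T * (golden - 1)) / 2"
  have e: "?z = (S - T) / 2 + T / 2 * golden" by (simp add: field_simps)
  have r': "(S - T) / 2 \<in> \<rat>" "T / 2 \<in> \<rat>" using r by auto
  have K: "?z \<in> Q_sqrt5" unfolding e Q_sqrt5_iff using r' by blast
  then show "?z\<^sup>2 \<in> Q_sqrt5" by (simp add: power2_eq_square del: times_divide_eq_left times_divide_eq_right)
  have "gconj ?z = (S - T * golden) / 2" unfolding e gconj_eq[OF r'] by (simp add: field_simps)
  moreover have "gconj (?z\<^sup>2) = gconj ?z * gconj ?z"
    unfolding power2_eq_square by (rule gconj_mult[OF K K])
  ultimately show "gconj (?z\<^sup>2) = (S - T * golden)\<^sup>2 / 4"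
    by (simp only:) (simp add: power2_eq_square)
qed

text \<open>Round the eight rational coordinates of \<open>2 x\<close> with respect to \<open>1, \<tau> - 1\<close> to the nearest integers and
  flip at most two of them to reach a doubled icosian. The squared distance is at most
  \<open>8 / 4 + 2 \<cdot> 3 / 4 = 7 / 2\<close>, and \<open>5 / 4 \<cdot> (7 / 2)\<^sup>2 < 16\<close>, where \<open>16\<close> is the norm of the factor \<open>4\<close> by which
  doubling scales \<open>qnr\<close>.\<close>

lemma icosian_euclidean:
  assumes "q0 x \<in> Q_sqrt5" "q1 x \<in> Q_sqrt5" "q2 x \<in> Q_sqrt5" "q3 x \<in> Q_sqrt5"
  shows "\<exists>c\<in>icosian. qnr (x - c) * gconj (qnr (x - c)) < 1"
proof -
  obtain s0 t0 where 0: "s0 \<in> \<rat>" "t0 \<in> \<rat>" "q0 x = (s0 + t0 * (golden - 1)) / 2"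
    using Q_sqrt5_half_coordinates assms by blast
  obtain s1 t1 where 1: "s1 \<in> \<rat>" "t1 \<in> \<rat>" "q1 x = (s1 + t1 * (golden - 1)) / 2"
    using Q_sqrt5_half_coordinates assms by blast
  obtain s2 t2 where 2: "s2 \<in> \<rat>" "t2 \<in> \<rat>" "q2 x = (s2 + t2 * (golden - 1)) / 2"
    using Q_sqrt5_half_coordinates assms by blast
  obtain s3 t3 where 3: "s3 \<in> \<rat>" "t3 \<in> \<rat>" "q3 x = (s3 + t3 * (golden - 1)) / 2"
    using Q_sqrt5_half_coordinates assms by blast
  let ?near = "\<lambda>s u g. odd g \<and> (\<forall>f\<in>{0, 1}. (s - of_int (u + f * g))\<^sup>2 \<le> 1 / 4 + 3 / 4 * (of_int f :: real))"
  obtain u0 g0 where n0: "?near s0 u0 g0" using round_with_flip[of s0] by blast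
  obtain v0 h0 where m0: "?near t0 v0 h0" using round_with_flip[of t0] by blast
  obtain u1 g1 where n1: "?near s1 u1 g1" using round_with_flip[of s1] by blast
  obtain v1 h1 where m1: "?near t1 v1 h1" using round_with_flip[of t1] by blast
  obtain u2 g2 where n2: "?near s2 u2 g2" using round_with_flip[of s2] by blast
  obtain v2 h2 where m2: "?near t2 v2 h2" using round_with_flip[of t2] by blast
  obtain u3 g3 where n3: "?near s3 u3 g3" using round_with_flip[of s3] by blast
  obtain v3 h3 where m3: "?near t3 v3 h3" using round_with_flip[of t3] by blast
  obtain f0 f1 f2 f3 f4 f5 f6 f7 :: int where F: "{f0, f1, f2, f3, f4, f5, f6, f7} \<subseteq> {0, 1}"
    and Fs: "f0 + f1 + f2 + f3 + f4 + f5 + f6 + f7 \<le> 2"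
    and ev: "even ((u0 + u2 + v2 + v3) + f0 + f4 + f5 + f7)" "even ((v0 + u2 + u3 + v3) + f1 + f4 + f6 + f7)"
      "even ((u1 + u3 + v2 + v3) + f2 + f5 + f6 + f7)" "even ((v1 + v2 + u2 + u3) + f3 + f4 + f5 + f6)"
    using hamming_flips[of "u0 + u2 + v2 + v3" "v0 + u2 + u3 + v3" "u1 + u3 + v2 + v3" "v1 + v2 + u2 + u3"]
    by (elim exE conjE) (rule that)
  define a0 b0 where "a0 = u0 + f0 * g0" and "b0 = v0 + f1 * h0"
  define a1 b1 where "a1 = u1 + f2 * g1" and "b1 = v1 + f3 * h1"
  define a2 b2 where "a2 = u2 + f4 * g2" and "b2 = v2 + f5 * h2"
  define a3 b3 where "a3 = u3 + f6 * g3" and "b3 = v3 + f7 * h3"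
  note ab = a0_def b0_def a1_def b1_def a2_def b2_def a3_def b3_def
  have odds: "odd g0" "odd h0" "odd g1" "odd h1" "odd g2" "odd h2" "odd g3" "odd h3"
    using n0 m0 n1 m1 n2 m2 n3 m3 by blast+
  have flip: "\<exists>k. f * g = f + 2 * k" if g: "odd g" for f g :: int
  proof -
    obtain k where "g = 2 * k + 1" using g by (elim oddE)
    then have "f * g = f + 2 * (f * k)" by (simp add: algebra_simps)
    then show ?thesis by blast
  qed
  obtain w0 where w0: "f0 * g0 = f0 + 2 * w0" using flip[OF odds(1)] by blast
  obtain w1 where w1: "f1 * h0 = f1 + 2 * w1" using flip[OF odds(2)] by blast
  obtain w2 where w2: "f2 * g1 = f2 + 2 * w2" using flip[OF odds(3)] by blast
  obtain w3 where w3: "f3 * h1 = f3 + 2 * w3" using flip[OF odds(4)] by blast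
  obtain w4 where w4: "f4 * g2 = f4 + 2 * w4" using flip[OF odds(5)] by blast
  obtain w5 where w5: "f5 * h2 = f5 + 2 * w5" using flip[OF odds(6)] by blast
  obtain w6 where w6: "f6 * g3 = f6 + 2 * w6" using flip[OF odds(7)] by blast
  obtain w7 where w7: "f7 * h3 = f7 + 2 * w7" using flip[OF odds(8)] by blast
  note w = w0 w1 w2 w3 w4 w5 w6 w7
  obtain j1 j2 j3 j4 where j: "(u0 + u2 + v2 + v3) + f0 + f4 + f5 + f7 = 2 * j1"
    "(v0 + u2 + u3 + v3) + f1 + f4 + f6 + f7 = 2 * j2"
    "(u1 + u3 + v2 + v3) + f2 + f5 + f6 + f7 = 2 * j3"
    "(v1 + v2 + u2 + u3) + f3 + f4 + f5 + f6 = 2 * j4"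
    using ev by (elim evenE)
  have uv: "u0 = 2 * j1 - u2 - v2 - v3 - f0 - f4 - f5 - f7" "v0 = 2 * j2 - u2 - u3 - v3 - f1 - f4 - f6 - f7"
    "u1 = 2 * j3 - u3 - v2 - v3 - f2 - f5 - f6 - f7" "v1 = 2 * j4 - v2 - u2 - u3 - f3 - f4 - f5 - f6"
    using j by simp_all
  \<comment> \<open>The corrected integers satisfy the four parity checks that define the doubled icosians.\<close>
  define k1 where "k1 = j1 - u2 - f4 - v2 - f5 + w0 - w4 + w7 - w5"
  define k2 where "k2 = j2 - u2 - f4 - v3 - f7 + w1 + w6 - w4 - w7"
  define k3 where "k3 = j3 - v2 - f5 - u3 - f6 + w2 + w7 - w5 - w6"
  define k4 where "k4 = j4 - u2 - f4 - b3 + w3 + w5 + w6 - w4"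
  have k: "a0 - a2 + b3 - b2 = 2 * k1" "b0 + a3 - a2 - b3 = 2 * k2"
    "a1 + b3 - b2 - a3 = 2 * k3" "b1 + b2 + a3 - a2 - 2 * b3 = 2 * k4"
    unfolding k1_def k2_def k3_def k4_def ab w uv by (simp_all add: algebra_simps)
  have kr: "real_of_int a0 = a2 - b3 + b2 + 2 * k1" "real_of_int b0 = a2 + b3 - a3 + 2 * k2"
    "real_of_int a1 = b2 + a3 - b3 + 2 * k3" "real_of_int b1 = a2 + 2 * b3 - b2 - a3 + 2 * k4"
    using k by linarith+
  define c where "c = Quat ((a0 + b0 * (golden - 1)) / 2) ((a1 + b1 * (golden - 1)) / 2)
    ((a2 + b2 * (golden - 1)) / 2) ((a3 + b3 * (golden - 1)) / 2)"
  have c: "c \<in> icosian"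
  proof -
    have e1: "q0 c - q2 c + (golden - 1) * (q3 c - q2 c) = of_int k1 + of_int k2 * (golden - 1)"
      unfolding c_def by (simp add: kr field_simps golden_reduce)
    have e2: "q1 c - (golden - 1) * q2 c - (2 - golden) * q3 c = of_int k3 + of_int k4 * (golden - 1)"
      unfolding c_def by (simp add: kr field_simps golden_reduce)
    have e3: "2 * q2 c = of_int a2 + of_int b2 * (golden - 1)" "2 * q3 c = of_int a3 + of_int b3 * (golden - 1)"
      unfolding c_def by simp_all
    show ?thesis unfolding icosian_iff e1 e2 e3 by simp
  qed
  define S where "S = (\<lambda>i. [s0 - a0, s1 - a1, s2 - a2, s3 - a3] ! i)"
  define T where "T = (\<lambda>i. [t0 - b0, t1 - b1, t2 - b2, t3 - b3] ! i)"
  have four: "{..<4} = {0, 1, 2, 3::nat}" by auto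
  have STr: "S i \<in> \<rat>" "T i \<in> \<rat>" if "i \<in> {0, 1, 2, 3}" for i
    using that 0 1 2 3 unfolding S_def T_def by auto
  define E where "E = (\<Sum>i<4. (S i)\<^sup>2 + (T i)\<^sup>2)"
  have "E \<le> 7 / 2"
  proof -
    have b: "(s0 - a0)\<^sup>2 \<le> 1 / 4 + 3 / 4 * of_int f0" "(t0 - b0)\<^sup>2 \<le> 1 / 4 + 3 / 4 * of_int f1"
      "(s1 - a1)\<^sup>2 \<le> 1 / 4 + 3 / 4 * of_int f2" "(t1 - b1)\<^sup>2 \<le> 1 / 4 + 3 / 4 * of_int f3"
      "(s2 - a2)\<^sup>2 \<le> 1 / 4 + 3 / 4 * of_int f4" "(t2 - b2)\<^sup>2 \<le> 1 / 4 + 3 / 4 * of_int f5"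
      "(s3 - a3)\<^sup>2 \<le> 1 / 4 + 3 / 4 * of_int f6" "(t3 - b3)\<^sup>2 \<le> 1 / 4 + 3 / 4 * of_int f7"
      unfolding ab using n0 m0 n1 m1 n2 m2 n3 m3 F by blast+
    have "real_of_int (f0 + f1 + f2 + f3 + f4 + f5 + f6 + f7) \<le> 2" using Fs by linarith
    then show ?thesis unfolding E_def four S_def T_def using b by simp
  qed
  moreover have "E \<ge> 0" unfolding E_def by (intro sum_nonneg) simp
  ultimately have "E\<^sup>2 \<le> (7 / 2)\<^sup>2" by (intro power_mono)
  then have small: "5 / 4 * E\<^sup>2 < 16" by (simp add: power2_eq_square)
  have nr: "qnr (x - c) = (\<Sum>i<4. ((S i + T i * (golden - 1)) / 2)\<^sup>2)"
    unfolding qnr_def four S_def T_def c_def by (simp add: 0 1 2 3 diff_divide_distrib add_divide_distrib algebra_simps)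
  have "gconj (qnr (x - c)) = (\<Sum>i<4. gconj (((S i + T i * (golden - 1)) / 2)\<^sup>2))"
    unfolding nr four using gconj_half_square(1)[OF STr] by (simp add: gconj_add)
  also have "\<dots> = (\<Sum>i<4. (S i - T i * golden)\<^sup>2 / 4)"
    using gconj_half_square(2)[OF STr] by (intro sum.cong) (auto simp: four)
  also have "\<dots> = (\<Sum>i<4. (S i - T i * golden)\<^sup>2) / 4" by (simp add: sum_divide_distrib)
  finally have gnr: "gconj (qnr (x - c)) = (\<Sum>i<4. (S i - T i * golden)\<^sup>2) / 4" .
  have nr': "qnr (x - c) = (\<Sum>i<4. (S i + T i * (golden - 1))\<^sup>2) / 4"
    unfolding nr by (simp add: sum_divide_distrib power_divide)
  have "16 * (qnr (x - c) * gconj (qnr (x - c))) \<le> 5 / 4 * E\<^sup>2"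
    unfolding gnr unfolding nr' using golden_form_bound[OF E_def] by simp
  then show ?thesis using small c by (intro bexI[of _ c]) linarith
qed

text \<open>The measure for Euclidean division, a natural number on icosians.\<close>

definition absolute_norm :: "quat \<Rightarrow> real" where "absolute_norm x = qnr x * gconj (qnr x)"

lemma qnr_Q_sqrt5:
  assumes "q0 x \<in> Q_sqrt5" "q1 x \<in> Q_sqrt5" "q2 x \<in> Q_sqrt5" "q3 x \<in> Q_sqrt5"
  shows "qnr x \<in> Q_sqrt5" "gconj (qnr x) = (gconj (q0 x))\<^sup>2 + (gconj (q1 x))\<^sup>2 + (gconj (q2 x))\<^sup>2 + (gconj (q3 x))\<^sup>2"
  using assms by (simp_all add: qnr_def power2_eq_square gconj_add gconj_mult)

lemma absolute_norm_icosian: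
  assumes "x \<in> icosian"
  shows "absolute_norm x \<in> \<nat>" "absolute_norm x = 0 \<longleftrightarrow> x = 0"
proof -
  note K = icosian_Q_sqrt5[OF assms]
  have O: "qnr x \<in> Z_golden" using qnr_icosian assms by blast
  obtain k l where "qnr x = of_int k + of_int l * golden" using O by (elim Z_goldenE)
  then have i: "absolute_norm x = of_int (k\<^sup>2 + k * l - l\<^sup>2)" unfolding absolute_norm_def by (metis mult_gconj_eq)
  have "gconj (qnr x) \<ge> 0" using qnr_Q_sqrt5(2)[OF K] by simp
  then have "absolute_norm x \<ge> 0" unfolding absolute_norm_def using qnr_nonneg by simp
  then have "k\<^sup>2 + k * l - l\<^sup>2 \<ge> 0" using i by linarith
  then show "absolute_norm x \<in> \<nat>" using i by (metis of_int_of_nat_eq nonneg_int_cases of_nat_in_Nats)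
  show "absolute_norm x = 0 \<longleftrightarrow> x = 0"
    unfolding absolute_norm_def using gconj_eq_0_iff[OF qnr_Q_sqrt5(1)[OF K]] qnr_eq_0_iff by auto
qed

text \<open>A nonzero element of least absolute norm generates, by Euclidean division from the left.\<close>

lemma right_ideal_principal:
  assumes J: "J \<subseteq> icosian" "J \<noteq> {0}" "J \<noteq> {}"
    and diff: "\<And>x y. x \<in> J \<Longrightarrow> y \<in> J \<Longrightarrow> x - y \<in> J"
    and mult: "\<And>x c. x \<in> J \<Longrightarrow> c \<in> icosian \<Longrightarrow> x * c \<in> J"
  shows "\<exists>q\<in>J. \<forall>x\<in>J. \<exists>c\<in>icosian. x = q * c"
proof -
  define P where "P = (\<lambda>q. q \<in> J \<and> q \<noteq> 0)"
  have "\<exists>q. P q" unfolding P_def using J by blast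
  then obtain q where q: "P q" and min: "\<And>y. P y \<Longrightarrow> nat \<lfloor>absolute_norm q\<rfloor> \<le> nat \<lfloor>absolute_norm y\<rfloor>"
    using ex_has_least_nat[of P _ "\<lambda>q. nat \<lfloor>absolute_norm q\<rfloor>"] by blast
  have qJ: "q \<in> J" "q \<in> icosian" and nz: "qnr q \<noteq> 0" using q J qnr_eq_0_iff unfolding P_def by auto
  have "\<exists>c\<in>icosian. x = q * c" if x: "x \<in> J" for x
  proof -
    have xI: "x \<in> icosian" using x J by blast
    define r where "r = qr (1 / qnr q) * (qcnj q * x)"
    have qrr: "q * r = x"
    proof -
      have "q * r = qr (1 / qnr q) * (q * qcnj q * x)" unfolding r_def qr_left_commute by (simp add: mult.assoc)
      also have "\<dots> = qr (1 / qnr q * qnr q) * x" unfolding mult_qcnj qr_mult by (simp add: mult.assoc)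
      finally show ?thesis using nz by simp
    qed
    have KK: "1 / qnr q \<in> Q_sqrt5" using Z_golden_sub qnr_icosian qJ by (intro Q_sqrt5_divide) auto
    have "qcnj q * x \<in> icosian" using qJ xI by simp
    then have "q0 r \<in> Q_sqrt5" "q1 r \<in> Q_sqrt5" "q2 r \<in> Q_sqrt5" "q3 r \<in> Q_sqrt5"
      unfolding r_def quat_times_sel[of "qr _"] using KK icosian_Q_sqrt5[of "qcnj q * x"]
      by (simp_all only: qr_sel mult_zero_left diff_zero add_0_right add_0_left Q_sqrt5_mult)
    then obtain c where c: "c \<in> icosian" "absolute_norm (r - c) < 1" and Krc:
      "q0 (r - c) \<in> Q_sqrt5" "q1 (r - c) \<in> Q_sqrt5" "q2 (r - c) \<in> Q_sqrt5" "q3 (r - c) \<in> Q_sqrt5"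
      using icosian_euclidean[of r] icosian_Q_sqrt5 unfolding absolute_norm_def by (auto simp del: quat_times_sel)
    define y where "y = x - q * c"
    have y: "y = q * (r - c)" unfolding y_def right_diff_distrib qrr ..
    have yJ: "y \<in> J" unfolding y_def using diff mult x qJ c by blast
    have "y = 0"
    proof (rule ccontr)
      assume "y \<noteq> 0"
      then have le: "nat \<lfloor>absolute_norm q\<rfloor> \<le> nat \<lfloor>absolute_norm y\<rfloor>" using min yJ unfolding P_def by blast
      obtain m n where mn: "absolute_norm q = real m" "absolute_norm y = real n"
        using absolute_norm_icosian(1) qJ yJ J unfolding Nats_def by blast
      have "absolute_norm q \<le> absolute_norm y" using le unfolding mn by simp
      moreover have "absolute_norm y = absolute_norm q * absolute_norm (r - c)"
        unfolding y absolute_norm_def qnr_mult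
        using gconj_mult[OF qnr_Q_sqrt5(1)[OF icosian_Q_sqrt5[OF qJ(2)]] qnr_Q_sqrt5(1)[OF Krc]] by simp
      moreover have "absolute_norm q > 0" using absolute_norm_icosian(2)[OF qJ(2)] q mn unfolding P_def by auto
      ultimately show False using c(2) by (metis mult.right_neutral mult_less_cancel_left_pos not_le)
    qed
    then show ?thesis using c y_def by auto
  qed
  then show ?thesis using qJ by blast
qed

text \<open>Divisibility of quaternions by a scalar with an icosian quotient.\<close>

definition qdvd :: "real \<Rightarrow> quat \<Rightarrow> bool" where
  "qdvd \<alpha> x \<longleftrightarrow> (\<exists>y\<in>icosian. x = qr \<alpha> * y)"

lemma qdvdI: "y \<in> icosian \<Longrightarrow> x = qr \<alpha> * y \<Longrightarrow> qdvd \<alpha> x"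
  unfolding qdvd_def by blast

lemma qdvd_add: "qdvd \<alpha> x \<Longrightarrow> qdvd \<alpha> y \<Longrightarrow> qdvd \<alpha> (x + y)"
  unfolding qdvd_def by (metis distrib_left icosian_add)

lemma qdvd_diff: "qdvd \<alpha> x \<Longrightarrow> qdvd \<alpha> y \<Longrightarrow> qdvd \<alpha> (x - y)"
  unfolding qdvd_def by (metis right_diff_distrib icosian_diff)

lemma qdvd_mult_left: "qdvd \<alpha> x \<Longrightarrow> y \<in> icosian \<Longrightarrow> qdvd \<alpha> (y * x)"
  unfolding qdvd_def by (metis qr_left_commute icosian_mult)

lemma qdvd_mult_right: "qdvd \<alpha> x \<Longrightarrow> y \<in> icosian \<Longrightarrow> qdvd \<alpha> (x * y)"
  unfolding qdvd_def by (metis mult.assoc icosian_mult)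

lemma qdvd_qr: "\<alpha> \<noteq> 0 \<Longrightarrow> qdvd \<alpha> (qr r) \<longleftrightarrow> (\<exists>e\<in>Z_golden. r = \<alpha> * e)"
proof
  assume \<alpha>: "\<alpha> \<noteq> 0" and "qdvd \<alpha> (qr r)"
  then obtain y where y: "y \<in> icosian" "qr r = qr \<alpha> * y" unfolding qdvd_def by blast
  then have "qr \<alpha> * qr (r / \<alpha>) = qr \<alpha> * y" using \<alpha> by (simp add: qr_mult[symmetric])
  then have "y = qr (r / \<alpha>)" using qr_cancel \<alpha> by metis
  then have "r / \<alpha> \<in> Z_golden" using y icosian_real by blast
  then show "\<exists>e\<in>Z_golden. r = \<alpha> * e" using \<alpha> by (intro bexI[of _ "r / \<alpha>"]) auto
next
  assume "\<exists>e\<in>Z_golden. r = \<alpha> * e"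
  then show "qdvd \<alpha> (qr r)" unfolding qdvd_def using icosian_qr qr_mult by blast
qed

lemma conjugate_add_multiple:
  "qcnj (u + qr r * b) * w * (u + qr r * b)
    = qcnj u * w * u + qr r * (qcnj u * w * b + qcnj b * w * u + qr r * (qcnj b * w * b))"
proof -
  have 1: "qcnj u * w * (qr r * b) = qr r * (qcnj u * w * b)" by (rule qr_left_commute)
  have 2: "qr r * qcnj b * w * u = qr r * (qcnj b * w * u)" by (simp add: mult.assoc)
  have "qr r * qcnj b * w * (qr r * b) = qr r * (qr r * qcnj b * w * b)" by (rule qr_left_commute)
  then have 3: "qr r * qcnj b * w * (qr r * b) = qr r * (qr r * (qcnj b * w * b))" by (simp add: mult.assoc)
  have c: "qcnj (u + qr r * b) = qcnj u + qr r * qcnj b"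
    unfolding qcnj_add qcnj_mult qcnj_qr qr_commute ..
  show ?thesis unfolding c by (simp add: distrib_left distrib_right 1 2 3)
qed

lemma norm_add_multiple:
  "(u + qr r * b) * qcnj (u + qr r * b)
    = u * qcnj u + qr r * (u * qcnj b + b * qcnj u + qr r * (b * qcnj b))"
proof -
  have c: "qcnj (qcnj u + qr r * qcnj b) = u + qr r * b" and d: "qcnj (u + qr r * b) = qcnj u + qr r * qcnj b"
    unfolding qcnj_add qcnj_mult qcnj_qr qr_commute by simp_all
  show ?thesis
    using conjugate_add_multiple[of "qcnj u" r "qcnj b" 1] unfolding c d by simp
qed

text \<open>The norm of a generator \<open>q\<close> of \<open>h I + \<alpha> I\<close> is divisible by \<open>\<alpha>\<close> because the norms of \<open>h\<close> and \<open>\<alpha>\<close> are. For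
  the converse, \<open>h\<close> and \<open>\<alpha>\<close> both have the left factor \<open>q\<close>, so the trace of \<open>h \<alpha>\<close>, which is
  \<open>t \<alpha>\<close>, is divisible by the norm of \<open>q\<close>.\<close>

lemma icosian_gcd:
  assumes \<alpha>: "\<alpha> \<in> Z_golden" "\<alpha>' \<in> Z_golden" "\<alpha> * \<alpha>' = of_int m" "\<alpha> \<noteq> 0"
    and h: "h \<in> icosian" "qtr h = of_int t" "coprime t m" "qnr h = \<alpha> * \<beta>" "\<beta> \<in> Z_golden"
  shows "\<exists>q a b c. q \<in> icosian \<and> a \<in> icosian \<and> b \<in> icosian \<and> c \<in> icosian
    \<and> q = h * a + qr \<alpha> * b \<and> h = q * c \<and> (\<exists>e\<in>Z_golden. qnr q = \<alpha> * e) \<and> (\<exists>e\<in>Z_golden. \<alpha> = qnr q * e)"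
proof -
  define J where "J = {h * a + qr \<alpha> * b | a b. a \<in> icosian \<and> b \<in> icosian}"
  have JI: "h * a + qr \<alpha> * b \<in> J" if "a \<in> icosian" "b \<in> icosian" for a b
    unfolding J_def using that by blast
  have hJ: "h \<in> J" using JI[of 1 0] by simp
  have \<alpha>J: "qr \<alpha> \<in> J" using JI[of 0 1] by simp
  have "qr \<alpha> \<noteq> 0" using \<alpha> by (simp add: quat_eq_iff)
  then have ne: "J \<noteq> {0}" "J \<noteq> {}" using \<alpha>J by auto
  have sub: "J \<subseteq> icosian" unfolding J_def using \<alpha> h by auto
  have diff: "x - y \<in> J" if x: "x \<in> J" and y: "y \<in> J" for x y
  proof -
    obtain a b where 1: "a \<in> icosian" "b \<in> icosian" "x = h * a + qr \<alpha> * b" using x unfolding J_def by blast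
    obtain a' b' where 2: "a' \<in> icosian" "b' \<in> icosian" "y = h * a' + qr \<alpha> * b'" using y unfolding J_def by blast
    have "x - y = h * (a - a') + qr \<alpha> * (b - b')" using 1 2 by (simp only: right_diff_distrib) simp
    then show ?thesis using JI 1 2 icosian_diff by metis
  qed
  have mult: "x * c \<in> J" if x: "x \<in> J" and c: "c \<in> icosian" for x c
  proof -
    obtain a b where 1: "a \<in> icosian" "b \<in> icosian" "x = h * a + qr \<alpha> * b" using x unfolding J_def by blast
    have "x * c = h * (a * c) + qr \<alpha> * (b * c)" using 1 by (simp only: distrib_right mult.assoc)
    then show ?thesis using JI 1 c icosian_mult by metis
  qed
  obtain q where q: "q \<in> J" and gen: "\<forall>x\<in>J. \<exists>c\<in>icosian. x = q * c"
    using right_ideal_principal[OF sub ne diff mult] by blast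
  obtain a b where ab: "a \<in> icosian" "b \<in> icosian" "q = h * a + qr \<alpha> * b" using q unfolding J_def by blast
  obtain c where c: "c \<in> icosian" "h = q * c" using gen hJ by blast
  obtain d where d: "d \<in> icosian" "qr \<alpha> = q * d" using gen \<alpha>J by blast
  have qI: "q \<in> icosian" using q sub by blast
  have "\<exists>e\<in>Z_golden. qnr q = \<alpha> * e"
  proof -
    have "q * qcnj q = h * (a * qcnj a) * qcnj h
        + qr \<alpha> * (h * (a * qcnj b) + b * (qcnj a * qcnj h) + qr \<alpha> * (b * qcnj b))"
      unfolding ab(3) norm_add_multiple by (simp add: qcnj_mult mult.assoc)
    also have "h * (a * qcnj a) * qcnj h = qr \<alpha> * (qr \<beta> * qr (qnr a))"
    proof -
      have "h * (a * qcnj a) * qcnj h = qr (qnr a) * (h * qcnj h)"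
        unfolding mult_qcnj qr_commute[of h] mult.assoc ..
      also have "\<dots> = qr (\<alpha> * (\<beta> * qnr a))" unfolding mult_qcnj h qr_mult[symmetric] by (simp add: ac_simps)
      finally show ?thesis by (simp only: qr_mult)
    qed
    finally have "qr (qnr q) = qr \<alpha> * (qr \<beta> * qr (qnr a) + (h * (a * qcnj b) + b * (qcnj a * qcnj h) + qr \<alpha> * (b * qcnj b)))"
      unfolding mult_qcnj by (simp only: distrib_left)
    moreover have "qr \<beta> * qr (qnr a) + (h * (a * qcnj b) + b * (qcnj a * qcnj h) + qr \<alpha> * (b * qcnj b)) \<in> icosian"
      using ab h \<alpha> qnr_icosian by (intro icosian_add icosian_mult icosian_qcnj icosian_qr) auto
    ultimately have "qdvd \<alpha> (qr (qnr q))" unfolding qdvd_def by blast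
    then show ?thesis using qdvd_qr \<alpha> by blast
  qed
  moreover have "\<exists>e\<in>Z_golden. \<alpha> = qnr q * e"
  proof -
    \<comment> \<open>The reduced norm of \<open>q\<close> divides both \<open>\<alpha> * t\<close> and \<open>\<alpha>\<^sup>2\<close>, hence \<open>\<alpha> * gcd t m\<close>.\<close>
    have "qr \<alpha> = qcnj (qr \<alpha>)" by simp
    also have "\<dots> = qcnj d * qcnj q" unfolding d(2) qcnj_mult ..
    finally have "h * qr \<alpha> = q * (c * qcnj d) * qcnj q" using c(2) by (simp add: mult.assoc)
    then have 1: "\<alpha> * of_int t = qnr q * qtr (c * qcnj d)"
      using qtr_conjugate qtr_qr_mult h(2) by metis
    have "qnr (qr \<alpha>) = qnr q * qnr d" unfolding d(2) qnr_mult ..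
    then have 2: "\<alpha> * \<alpha> = qnr q * qnr d" by (simp add: power2_eq_square)
    obtain u v where "u * t + v * m = 1" using h(3) bezout_int[of t m] by auto
    then have uv: "of_int u * of_int t + of_int v * of_int m = (1::real)" by (metis of_int_add of_int_mult of_int_1)
    have "\<alpha> = \<alpha> * (of_int u * of_int t + of_int v * (\<alpha> * \<alpha>'))" unfolding \<alpha>(3) uv by simp
    also have "\<dots> = of_int u * (\<alpha> * of_int t) + of_int v * \<alpha>' * (\<alpha> * \<alpha>)" by (simp add: algebra_simps)
    also have "\<dots> = qnr q * (of_int u * qtr (c * qcnj d) + of_int v * \<alpha>' * qnr d)"
      unfolding 1 2 by (simp add: algebra_simps)
    finally have "\<alpha> = qnr q * (of_int u * qtr (c * qcnj d) + of_int v * \<alpha>' * qnr d)" .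
    moreover have "of_int u * qtr (c * qcnj d) + of_int v * \<alpha>' * qnr d \<in> Z_golden"
      using c d \<alpha> qnr_icosian qtr_icosian icosian_mult icosian_qcnj by (intro Z_golden_add Z_golden_mult) auto
    ultimately show ?thesis by blast
  qed
  ultimately show ?thesis using qI ab c by blast
qed

text \<open>Both \<open>q\<close> and \<open>h\<close> generate the same right ideal modulo \<open>\<alpha>\<close>, and divisibility of \<open>q\<^sup>* w q\<close> by \<open>\<alpha>\<close>
  depends only on this ideal. It makes the unknown generator \<open>q\<close> replaceable by the explicit \<open>h\<close>.\<close>

lemma qdvd_conjugate_iff:
  assumes \<alpha>: "\<alpha> \<in> Z_golden" and I: "a \<in> icosian" "b \<in> icosian" "c \<in> icosian" "h \<in> icosian" "w \<in> icosian"
    and q: "q = h * a + qr \<alpha> * b" and h: "h = q * c"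
  shows "qdvd \<alpha> (qcnj q * w * q) \<longleftrightarrow> qdvd \<alpha> (qcnj h * w * h)"
proof
  assume "qdvd \<alpha> (qcnj q * w * q)"
  then have "qdvd \<alpha> (qcnj c * (qcnj q * w * q) * c)"
    using I qdvd_mult_left qdvd_mult_right icosian_qcnj by blast
  then show "qdvd \<alpha> (qcnj h * w * h)" unfolding h qcnj_mult by (simp only: mult.assoc)
next
  assume d: "qdvd \<alpha> (qcnj h * w * h)"
  have e: "qcnj q * w * q = qcnj a * (qcnj h * w * h) * a
      + qr \<alpha> * (qcnj a * qcnj h * w * b + qcnj b * w * (h * a) + qr \<alpha> * (qcnj b * w * b))"
    unfolding q conjugate_add_multiple by (simp add: qcnj_mult mult.assoc)
  have "qdvd \<alpha> (qcnj a * (qcnj h * w * h) * a)" using d I qdvd_mult_left qdvd_mult_right icosian_qcnj by blast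
  moreover have "qdvd \<alpha> (qr \<alpha> * (qcnj a * qcnj h * w * b + qcnj b * w * (h * a) + qr \<alpha> * (qcnj b * w * b)))"
    by (rule qdvdI[OF _ refl]) (use I \<alpha> in simp)
  ultimately show "qdvd \<alpha> (qcnj q * w * q)" unfolding e by (rule qdvd_add)
qed

section \<open>The icosahedral modules under quaternion rotations\<close>

lemma qcnj_eq_0_iff: "qcnj q = 0 \<longleftrightarrow> q = 0"
  by (simp add: quat_eq_iff)

lemma cong2_iff: "cong2 x y \<longleftrightarrow> (x - y) / 2 \<in> Z_golden"
  unfolding cong2_def by (auto intro: bexI[of _ "(x - y) / 2"])

text \<open>The icosian candidate with real part \<open>s\<close> whose doubled imaginary part is \<open>v\<close>.\<close>

definition half_quat :: "real \<Rightarrow> real ^ 3 \<Rightarrow> quat" where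
  "half_quat s v = Quat s (v $ 1 / 2) (v $ 2 / 2) (v $ 3 / 2)"

lemma half_quat_sel [simp]:
  "q0 (half_quat s v) = s" "q1 (half_quat s v) = v $ 1 / 2"
  "q2 (half_quat s v) = v $ 2 / 2" "q3 (half_quat s v) = v $ 3 / 2"
  by (simp_all add: half_quat_def)

lemma half_quat_icosian:
  "half_quat s v \<in> icosian \<longleftrightarrow> v $ 2 \<in> Z_golden \<and> v $ 3 \<in> Z_golden
    \<and> s - (golden * v $ 2 - (golden - 1) * v $ 3) / 2 \<in> Z_golden
    \<and> (v $ 1 - (golden - 1) * v $ 2 - (2 - golden) * v $ 3) / 2 \<in> Z_golden"
proof -
  have e: "s - v $ 2 / 2 + (golden - 1) * (v $ 3 / 2 - v $ 2 / 2) = s - (golden * v $ 2 - (golden - 1) * v $ 3) / 2"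
    "v $ 1 / 2 - (golden - 1) * (v $ 2 / 2) - (2 - golden) * (v $ 3 / 2)
      = (v $ 1 - (golden - 1) * v $ 2 - (2 - golden) * v $ 3) / 2"
    by (simp_all add: field_simps)
  show ?thesis unfolding icosian_iff half_quat_sel e by simp
qed

lemma golden_powers: "golden\<^sup>2 = golden + 1" "(golden - 1) * golden = 1" "(2 - golden) * (golden + 1) = 1"
  using golden_mult_golden by (simp_all add: power2_eq_square algebra_simps)

text \<open>Modulo \<open>2\<close>, the code condition on the imaginary parts differs from the congruence that defines \<open>M_B\<close>
  by the unit factor \<open>\<tau>\<^sup>2\<close>; a suitable real part \<open>s\<close> always exists.\<close>

lemma M_B_iff: "v \<in> M_B \<longleftrightarrow> (\<exists>s. half_quat s v \<in> icosian)"
proof -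
  let ?a = "v $ 1" and ?b = "v $ 2" and ?c = "v $ 3"
  let ?D = "(?a - (golden - 1) * ?b - (2 - golden) * ?c) / 2"
  let ?T = "(golden\<^sup>2 * ?a + golden * ?b + ?c) / 2"
  have TD: "?T = (golden + 1) * ?D + golden * ?b + ?c"
    unfolding golden_powers by (simp add: field_simps golden_reduce)
  have DT: "?D = (2 - golden) * (?T - (golden * ?b + ?c))"
    unfolding TD by (simp add: field_simps golden_reduce)
  have "v \<in> M_B \<longleftrightarrow> ?a \<in> Z_golden \<and> ?b \<in> Z_golden \<and> ?c \<in> Z_golden \<and> ?T \<in> Z_golden"
    unfolding M_B_def cong2_iff by (simp add: forall_3)
  also have "\<dots> \<longleftrightarrow> ?b \<in> Z_golden \<and> ?c \<in> Z_golden \<and> ?D \<in> Z_golden"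
  proof
    assume *: "?a \<in> Z_golden \<and> ?b \<in> Z_golden \<and> ?c \<in> Z_golden \<and> ?T \<in> Z_golden"
    then have "(2 - golden) * (?T - (golden * ?b + ?c)) \<in> Z_golden"
      by (intro Z_golden_mult Z_golden_diff Z_golden_add) auto
    then show "?b \<in> Z_golden \<and> ?c \<in> Z_golden \<and> ?D \<in> Z_golden" using * DT by simp
  next
    assume *: "?b \<in> Z_golden \<and> ?c \<in> Z_golden \<and> ?D \<in> Z_golden"
    then have "(golden + 1) * ?D + golden * ?b + ?c \<in> Z_golden"
      by (intro Z_golden_mult Z_golden_add) auto
    moreover have "?a = 2 * ?D + (golden - 1) * ?b + (2 - golden) * ?c" by (simp add: field_simps)
    moreover have "2 * ?D + (golden - 1) * ?b + (2 - golden) * ?c \<in> Z_golden"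
      using * by (intro Z_golden_mult Z_golden_add) auto
    ultimately show "?a \<in> Z_golden \<and> ?b \<in> Z_golden \<and> ?c \<in> Z_golden \<and> ?T \<in> Z_golden"
      using * TD by metis
  qed
  also have "\<dots> \<longleftrightarrow> (\<exists>s. half_quat s v \<in> icosian)"
    unfolding half_quat_icosian
    by (auto intro!: exI[of _ "(golden * ?b - (golden - 1) * ?c) / 2"])
  finally show ?thesis .
qed

text \<open>Here both code conditions are conditions on \<open>v\<close>, and they are equivalent to the two congruences that
  define \<open>M_F\<close> by a unimodular change over \<open>\<O>\<close>.\<close>

lemma M_F_iff: "v \<in> M_F \<longleftrightarrow> half_quat 0 v \<in> icosian"
proof -
  let ?a = "v $ 1" and ?b = "v $ 2" and ?c = "v $ 3"
  let ?C = "0 - (golden * ?b - (golden - 1) * ?c) / 2"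
  let ?D = "(?a - (golden - 1) * ?b - (2 - golden) * ?c) / 2"
  let ?U = "(?a - golden * ?b) / 2" and ?V = "(golden * ?b - golden\<^sup>2 * ?c) / 2"
  have CV: "?C = - ?V - ?c" and VC: "?V = - ?C - ?c"
    unfolding golden_powers by (simp_all add: field_simps)
  have DU: "?D = ?U + (golden - 1) * ?V + (golden - 1) * ?c"
    and UD: "?U = ?D - (golden - 1) * ?V - (golden - 1) * ?c"
    unfolding golden_powers by (simp_all add: field_simps golden_reduce)
  have "v \<in> M_F \<longleftrightarrow> ?a \<in> Z_golden \<and> ?b \<in> Z_golden \<and> ?c \<in> Z_golden \<and> ?U \<in> Z_golden \<and> ?V \<in> Z_golden"
    unfolding M_F_def cong2_iff by (simp add: forall_3)
  also have "\<dots> \<longleftrightarrow> ?b \<in> Z_golden \<and> ?c \<in> Z_golden \<and> ?C \<in> Z_golden \<and> ?D \<in> Z_golden"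
  proof
    assume *: "?a \<in> Z_golden \<and> ?b \<in> Z_golden \<and> ?c \<in> Z_golden \<and> ?U \<in> Z_golden \<and> ?V \<in> Z_golden"
    then have "- ?V - ?c \<in> Z_golden" by (intro Z_golden_uminus Z_golden_diff) auto
    moreover have "?U + (golden - 1) * ?V + (golden - 1) * ?c \<in> Z_golden"
      using * by (intro Z_golden_add Z_golden_mult) auto
    ultimately show "?b \<in> Z_golden \<and> ?c \<in> Z_golden \<and> ?C \<in> Z_golden \<and> ?D \<in> Z_golden"
      using * CV DU by metis
  next
    assume *: "?b \<in> Z_golden \<and> ?c \<in> Z_golden \<and> ?C \<in> Z_golden \<and> ?D \<in> Z_golden"
    then have "- ?C - ?c \<in> Z_golden" by (blast intro: Z_golden_uminus Z_golden_diff)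
    then have V: "?V \<in> Z_golden" using VC by metis
    then have "?D - (golden - 1) * ?V - (golden - 1) * ?c \<in> Z_golden"
      using * by (intro Z_golden_diff Z_golden_mult) auto
    then have U: "?U \<in> Z_golden" using UD by metis
    have "?a = 2 * ?U + golden * ?b" by (simp add: field_simps)
    moreover have "2 * ?U + golden * ?b \<in> Z_golden"
      using * U by (intro Z_golden_mult Z_golden_add) auto
    ultimately show "?a \<in> Z_golden \<and> ?b \<in> Z_golden \<and> ?c \<in> Z_golden \<and> ?U \<in> Z_golden \<and> ?V \<in> Z_golden"
      using * U V by metis
  qed
  also have "\<dots> \<longleftrightarrow> half_quat 0 v \<in> icosian"
    unfolding half_quat_icosian by blast
  finally show ?thesis .
qed

lemma half_quat_diff: "half_quat (s - t) (v - w) = half_quat s v - half_quat t w"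
  and half_quat_scale: "half_quat (r * s) (r *\<^sub>R v) = qr r * half_quat s v"
  by (simp_all add: quat_eq_iff diff_divide_distrib)

lemma M_F_subset_M_B: "M_F \<subseteq> M_B"
  using M_B_iff M_F_iff by blast

text \<open>The common features that let one argument treat both modules: they are \<open>\<O>\<close>-modules between
  \<open>2 \<O>\<^sup>3\<close> and \<open>\<O>\<^sup>3\<close>.\<close>

lemma icosahedral_module:
  assumes "\<Gamma> \<in> {M_B, M_F}"
  shows "is_addsubgroup \<Gamma>"
    and "\<And>r v. r \<in> Z_golden \<Longrightarrow> v \<in> \<Gamma> \<Longrightarrow> r *\<^sub>R v \<in> \<Gamma>"
    and "\<And>v i. v \<in> \<Gamma> \<Longrightarrow> v $ i \<in> Z_golden"
    and "\<And>v. (\<And>i. v $ i / 2 \<in> Z_golden) \<Longrightarrow> v \<in> \<Gamma>"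
proof -
  have diffB: "v - w \<in> M_B" if "v \<in> M_B" "w \<in> M_B" for v w
    using that unfolding M_B_iff by (metis half_quat_diff icosian_diff)
  have diffF: "v - w \<in> M_F" if "v \<in> M_F" "w \<in> M_F" for v w
    using that unfolding M_F_iff by (metis half_quat_diff icosian_diff diff_0_right)
  have scB: "r *\<^sub>R v \<in> M_B" if "r \<in> Z_golden" "v \<in> M_B" for r v
    using that unfolding M_B_iff by (metis half_quat_scale icosian_scale)
  have scF: "r *\<^sub>R v \<in> M_F" if "r \<in> Z_golden" "v \<in> M_F" for r v
    using that unfolding M_F_iff by (metis half_quat_scale icosian_scale mult_zero_right)
  have evF: "v \<in> M_F" if ev: "\<And>i. v $ i / 2 \<in> Z_golden" for v
  proof -
    have 1: "v $ i \<in> Z_golden" for i using Z_golden_mult[OF _ ev, of 2 i] by simp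
    have 2: "0 - (golden * v $ 2 - (golden - 1) * v $ 3) / 2
        = 0 - (golden * (v $ 2 / 2) - (golden - 1) * (v $ 3 / 2))"
      "(v $ 1 - (golden - 1) * v $ 2 - (2 - golden) * v $ 3) / 2
        = v $ 1 / 2 - (golden - 1) * (v $ 2 / 2) - (2 - golden) * (v $ 3 / 2)"
      by (simp_all add: field_simps)
    show ?thesis unfolding M_F_iff half_quat_icosian 2
      using 1 ev by (intro conjI Z_golden_diff Z_golden_mult) auto
  qed
  have 0: "0 \<in> M_F" by (rule evF) simp
  show "is_addsubgroup \<Gamma>"
    using assms diffB diffF 0 M_F_subset_M_B by (auto intro!: addsubgroupI)
  show "\<And>r v. r \<in> Z_golden \<Longrightarrow> v \<in> \<Gamma> \<Longrightarrow> r *\<^sub>R v \<in> \<Gamma>"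
    using assms scB scF by blast
  show "\<And>v i. v \<in> \<Gamma> \<Longrightarrow> v $ i \<in> Z_golden"
    using assms unfolding M_B_def M_F_def by blast
  show "\<And>v. (\<And>i. v $ i / 2 \<in> Z_golden) \<Longrightarrow> v \<in> \<Gamma>"
    using assms evF M_F_subset_M_B by blast
qed

text \<open>The matrix of \<open>v \<mapsto> q v q\<^sup>-\<^sup>1\<close> on pure quaternions.\<close>

definition quat_rotation :: "quat \<Rightarrow> real ^ 3 ^ 3" where
  "quat_rotation q = (let a = q0 q; b = q1 q; c = q2 q; d = q3 q in
    (1 / qnr q) *\<^sub>R vector [
      vector [a\<^sup>2 + b\<^sup>2 - c\<^sup>2 - d\<^sup>2, 2 * (b * c - a * d), 2 * (b * d + a * c)],
      vector [2 * (b * c + a * d), a\<^sup>2 - b\<^sup>2 + c\<^sup>2 - d\<^sup>2, 2 * (c * d - a * b)],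
      vector [2 * (b * d - a * c), 2 * (c * d + a * b), a\<^sup>2 - b\<^sup>2 - c\<^sup>2 + d\<^sup>2]])"

lemma quat_rotation_nth:
  "quat_rotation q $ 1 $ 1 = ((q0 q)\<^sup>2 + (q1 q)\<^sup>2 - (q2 q)\<^sup>2 - (q3 q)\<^sup>2) / qnr q"
  "quat_rotation q $ 1 $ 2 = 2 * (q1 q * q2 q - q0 q * q3 q) / qnr q"
  "quat_rotation q $ 1 $ 3 = 2 * (q1 q * q3 q + q0 q * q2 q) / qnr q"
  "quat_rotation q $ 2 $ 1 = 2 * (q1 q * q2 q + q0 q * q3 q) / qnr q"
  "quat_rotation q $ 2 $ 2 = ((q0 q)\<^sup>2 - (q1 q)\<^sup>2 + (q2 q)\<^sup>2 - (q3 q)\<^sup>2) / qnr q"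
  "quat_rotation q $ 2 $ 3 = 2 * (q2 q * q3 q - q0 q * q1 q) / qnr q"
  "quat_rotation q $ 3 $ 1 = 2 * (q1 q * q3 q - q0 q * q2 q) / qnr q"
  "quat_rotation q $ 3 $ 2 = 2 * (q2 q * q3 q + q0 q * q1 q) / qnr q"
  "quat_rotation q $ 3 $ 3 = ((q0 q)\<^sup>2 - (q1 q)\<^sup>2 - (q2 q)\<^sup>2 + (q3 q)\<^sup>2) / qnr q"
  by (simp_all add: quat_rotation_def Let_def vector_3)

lemma quat_rotation_qcnj: "quat_rotation (qcnj q) = transpose (quat_rotation q)"
  by (simp add: vec_eq_iff forall_3 transpose_def quat_rotation_nth)

lemma half_quat_rotation:
  assumes "q \<noteq> 0"
  shows "qr (qnr q) * half_quat s (quat_rotation q *v v) = q * half_quat s v * qcnj q"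
proof -
  have n: "qnr q \<noteq> 0" using assms qnr_eq_0_iff by blast
  have **: "qnr q * ((x1 / qnr q * y1 + x2 / qnr q * y2 + x3 / qnr q * y3) / 2) = (x1 * y1 + x2 * y2 + x3 * y3) / 2"
    for x1 x2 x3 y1 y2 y3 using n by (simp add: field_simps)
  have sc: "qnr q * s = q0 (q * half_quat s v * qcnj q)"
    unfolding qnr_def by (simp add: power2_eq_square algebra_simps)
  show ?thesis
    unfolding quat_eq_iff
  proof (intro conjI)
    show "q0 (qr (qnr q) * half_quat s (quat_rotation q *v v)) = q0 (q * half_quat s v * qcnj q)"
      using sc by simp
    show "q1 (qr (qnr q) * half_quat s (quat_rotation q *v v)) = q1 (q * half_quat s v * qcnj q)"
      by (simp add: matrix_vector_mult_def sum_3 quat_rotation_nth ** del: times_divide_eq_left times_divide_eq_right)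
         (simp add: power2_eq_square field_simps)
    show "q2 (qr (qnr q) * half_quat s (quat_rotation q *v v)) = q2 (q * half_quat s v * qcnj q)"
      by (simp add: matrix_vector_mult_def sum_3 quat_rotation_nth ** del: times_divide_eq_left times_divide_eq_right)
         (simp add: power2_eq_square field_simps)
    show "q3 (qr (qnr q) * half_quat s (quat_rotation q *v v)) = q3 (q * half_quat s v * qcnj q)"
      by (simp add: matrix_vector_mult_def sum_3 quat_rotation_nth ** del: times_divide_eq_left times_divide_eq_right)
         (simp add: power2_eq_square field_simps)
  qed
qed

lemma quat_rotation_SO3:
  assumes "q \<noteq> 0"
  shows "quat_rotation q \<in> SO3"
proof -
  define n where "n = qnr q"
  have n: "n \<noteq> 0" unfolding n_def using assms qnr_eq_0_iff by blast
  have ndef: "n = (q0 q)\<^sup>2 + (q1 q)\<^sup>2 + (q2 q)\<^sup>2 + (q3 q)\<^sup>2" unfolding n_def qnr_def ..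
  note nth = quat_rotation_nth[of q, folded n_def]
  have dot: "x1 / n * (y1 / n) + x2 / n * (y2 / n) + x3 / n * (y3 / n) = (x1 * y1 + x2 * y2 + x3 * y3) / n\<^sup>2"
    for x1 x2 x3 y1 y2 y3 by (simp add: add_divide_distrib power2_eq_square)
  have "transpose (quat_rotation q) ** quat_rotation q = mat 1"
    unfolding vec_eq_iff forall_3 matrix_matrix_mult_def transpose_def mat_def
    by (simp add: sum_3 nth dot n del: times_divide_eq_left times_divide_eq_right times_divide_times_eq)
       (simp add: ndef power2_eq_square algebra_simps)
  then have "orthogonal_matrix (quat_rotation q)" unfolding orthogonal_matrix .
  moreover have "det (quat_rotation q) = 1"
  proof -
    have "det (quat_rotation q) = (n ^ 3) / n ^ 3"
      unfolding det_3 nth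
      by (simp add: power3_eq_cube add_divide_distrib[symmetric] diff_divide_distrib[symmetric])
         (simp add: ndef power2_eq_square algebra_simps)
    then show ?thesis using n by simp
  qed
  ultimately show ?thesis unfolding SO3_def by blast
qed

lemma quat_rotation_SO3_Q_sqrt5:
  assumes "q \<in> icosian" "q \<noteq> 0"
  shows "quat_rotation q \<in> SO3_Q_sqrt5"
proof -
  note K = icosian_Q_sqrt5[OF assms(1)] 
  have "quat_rotation q $ i $ j \<in> Q_sqrt5" for i j
    using exhaust_3[of i] exhaust_3[of j] K qnr_Q_sqrt5(1)[OF K]
    by (auto simp: quat_rotation_nth power2_eq_square)
  then show ?thesis unfolding SO3_Q_sqrt5_def using quat_rotation_SO3[OF assms(2)] by blast
qed

lemma SO3_inverse:
  assumes "R \<in> SO3"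
  shows "transpose R *v (R *v v) = v" "R *v (transpose R *v v) = v" "transpose R \<in> SO3"
proof -
  have o: "transpose R ** R = mat 1" "R ** transpose R = mat 1" "orthogonal_matrix R" "det R = 1"
    using assms unfolding SO3_def orthogonal_matrix_def by auto
  then show "transpose R *v (R *v v) = v" "R *v (transpose R *v v) = v"
    by (simp_all only: matrix_vector_mul_assoc matrix_vector_mul_lid)
  show "transpose R \<in> SO3" using o unfolding SO3_def orthogonal_matrix_def by simp
qed

lemma SO3_image_iff:
  assumes "R \<in> SO3"
  shows "v \<in> (*v) R ` A \<longleftrightarrow> transpose R *v v \<in> A"
proof
  assume "v \<in> (*v) R ` A"
  then show "transpose R *v v \<in> A" using SO3_inverse[OF assms] by auto
next
  assume "transpose R *v v \<in> A"
  moreover have "v = R *v (transpose R *v v)" using SO3_inverse[OF assms] by simp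
  ultimately show "v \<in> (*v) R ` A" by blast
qed

lemma addsubgroup_image:
  fixes R :: "real ^ 'n ^ 'm"
  assumes "is_addsubgroup A"
  shows "is_addsubgroup ((*v) R ` A)"
proof (rule addsubgroupI)
  show "0 \<in> (*v) R ` A" using addsubgroup_zero[OF assms] by (metis image_eqI matrix_vector_mult_0_right)
  fix x y assume "x \<in> (*v) R ` A" "y \<in> (*v) R ` A"
  then obtain u v where "u \<in> A" "v \<in> A" "x = R *v u" "y = R *v v" by blast
  then have "x - y = R *v (u - v)" "u \<in> A" "v \<in> A" by (simp_all add: matrix_vector_mult_diff_distrib)
  then show "x - y \<in> (*v) R ` A" using addsubgroup_diff[OF assms] by blast
qed

text \<open>The difference of the real parts has an integral double \<open>e\<close>, and integrality of both norms makes \<open>e\<^sup>2\<close>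
  divisible by \<open>2\<close>, hence \<open>e\<close> itself.\<close>

lemma icosian_same_imaginary_part:
  assumes y': "half_quat s' v \<in> icosian" and tr: "qtr (half_quat s v) \<in> Z_golden"
    and nr: "qnr (half_quat s v) \<in> Z_golden"
  shows "half_quat s v \<in> icosian"
proof -
  define e where "e = 2 * s - 2 * s'"
  have t': "2 * s' \<in> Z_golden" using qtr_icosian[OF y'] by (simp add: qtr_def)
  have e: "e \<in> Z_golden" unfolding e_def using tr t' by (simp add: qtr_def)
  have "qnr (half_quat s v) - qnr (half_quat s' v) = s\<^sup>2 - s'\<^sup>2" by (simp add: qnr_def)
  then have d: "s\<^sup>2 - s'\<^sup>2 \<in> Z_golden" using Z_golden_diff[OF nr qnr_icosian[OF y']] by metis
  have "e * e = 2 * (2 * (s\<^sup>2 - s'\<^sup>2) - e * (2 * s'))"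
    unfolding e_def by (simp add: power2_eq_square algebra_simps)
  moreover have "2 * (s\<^sup>2 - s'\<^sup>2) - e * (2 * s') \<in> Z_golden"
    using Z_golden_diff[OF Z_golden_mult[OF _ d] Z_golden_mult[OF e t'], of 2] by simp
  ultimately have "e / 2 \<in> Z_golden" by (rule half_square_Z_golden[OF e])
  moreover have "half_quat s v = half_quat s' v + qr (e / 2)"
    by (simp add: quat_eq_iff e_def diff_divide_distrib)
  ultimately show ?thesis using y' by simp
qed

lemma half_quat_rotation_icosian_iff:
  assumes q: "q \<in> icosian" "q \<noteq> 0"
  shows "half_quat s (quat_rotation (qcnj q) *v v) \<in> icosian \<longleftrightarrow> qdvd (qnr q) (qcnj q * half_quat s v * q)"
proof -
  have n: "qnr q \<noteq> 0" using q qnr_eq_0_iff by blast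
  have "qcnj q \<noteq> 0" using q qcnj_eq_0_iff by simp
  then have e: "qr (qnr q) * half_quat s (quat_rotation (qcnj q) *v v) = qcnj q * half_quat s v * q"
    using half_quat_rotation[of "qcnj q" s v] by simp
  show ?thesis unfolding qdvd_def e[symmetric] qr_cancel[OF n] by simp
qed

text \<open>For \<open>M_B\<close>, conjugation by \<open>q\<^sup>-\<^sup>1\<close> preserves trace and norm. If the imaginary part of the conjugate is
  that of some icosian, the conjugate is therefore itself an icosian.\<close>

lemma rotated_module_iff:
  assumes \<Gamma>: "\<Gamma> \<in> {M_B, M_F}" and q: "q \<in> icosian" "q \<noteq> 0" and v: "v \<in> \<Gamma>"
  shows "\<exists>s. half_quat s v \<in> icosian
    \<and> (v \<in> (*v) (quat_rotation q) ` \<Gamma> \<longleftrightarrow> qdvd (qnr q) (qcnj q * half_quat s v * q))"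
proof -
  have im: "v \<in> (*v) (quat_rotation q) ` \<Gamma> \<longleftrightarrow> quat_rotation (qcnj q) *v v \<in> \<Gamma>"
    unfolding quat_rotation_qcnj by (rule SO3_image_iff[OF quat_rotation_SO3[OF q(2)]])
  have n: "qnr q \<noteq> 0" using q qnr_eq_0_iff by blast
  have q': "qcnj q \<noteq> 0" using q qcnj_eq_0_iff by simp
  consider "\<Gamma> = M_F" | "\<Gamma> = M_B" using \<Gamma> by blast
  then show ?thesis
  proof cases
    case 1
    then have "half_quat 0 v \<in> icosian" using v M_F_iff by blast
    moreover have "v \<in> (*v) (quat_rotation q) ` \<Gamma> \<longleftrightarrow> qdvd (qnr q) (qcnj q * half_quat 0 v * q)"
      unfolding im unfolding 1 M_F_iff by (rule half_quat_rotation_icosian_iff[OF q])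
    ultimately show ?thesis by blast
  next
    case 2
    then obtain s where s: "half_quat s v \<in> icosian" using v M_B_iff by blast
    let ?u = "quat_rotation (qcnj q) *v v"
    have e: "qr (qnr q) * half_quat s ?u = qcnj q * half_quat s v * q"
      using half_quat_rotation[OF q', of s v] by simp
    have tr: "qtr (half_quat s ?u) \<in> Z_golden" using qtr_icosian[OF s] by (simp add: qtr_def)
    have "qnr (qr (qnr q) * half_quat s ?u) = qnr (qcnj q * half_quat s v * q)" unfolding e ..
    then have "(qnr q)\<^sup>2 * qnr (half_quat s ?u) = (qnr q)\<^sup>2 * qnr (half_quat s v)"
      by (simp add: qnr_mult power2_eq_square)
    then have nr: "qnr (half_quat s ?u) \<in> Z_golden" using n qnr_icosian[OF s] by simp
    have "?u \<in> M_B \<longleftrightarrow> half_quat s ?u \<in> icosian"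
      using icosian_same_imaginary_part[OF _ tr nr] M_B_iff by blast
    then have "v \<in> (*v) (quat_rotation q) ` \<Gamma> \<longleftrightarrow> qdvd (qnr q) (qcnj q * half_quat s v * q)"
      unfolding im unfolding 2 using half_quat_rotation_icosian_iff[OF q] by blast
    then show ?thesis using s by blast
  qed
qed

section \<open>Rotations with a prescribed coincidence index\<close>

text \<open>One rotation serves both modules. That the quotients of \<open>\<Gamma>\<close> and \<open>R \<Gamma>\<close> by their intersection have
  exponents dividing \<open>m\<close> is recorded for \<open>add_index_coprime\<close>.\<close>

definition has_coincidence_index :: "real ^ 3 ^ 3 \<Rightarrow> nat \<Rightarrow> bool" where
  "has_coincidence_index R m \<longleftrightarrow> R \<in> SO3_Q_sqrt5 \<and>
    (\<forall>\<Gamma>\<in>{M_B, M_F}. add_index \<Gamma> (\<Gamma> \<inter> (*v) R ` \<Gamma>) = m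
      \<and> (\<forall>v\<in>\<Gamma>. of_nat m *\<^sub>R v \<in> (*v) R ` \<Gamma>) \<and> (\<forall>v\<in>(*v) R ` \<Gamma>. of_nat m *\<^sub>R v \<in> \<Gamma>))"

lemma qdvd_trans:
  assumes "qdvd \<alpha> x" "\<alpha> = n * e" "e \<in> Z_golden"
  shows "qdvd n x"
  using assms unfolding qdvd_def by (metis icosian_scale mult.assoc qr_mult)

text \<open>The assumption \<open>crit\<close> says that \<open>L\<close> describes the kernel of \<open>w \<mapsto> h\<^sup>* w h\<close> modulo \<open>\<alpha>\<close>. The vector \<open>base\<close>
  makes \<open>L\<close> surjective modulo \<open>\<alpha>\<close> on both modules, since it lies in the smaller one, so that \<open>L\<close>
  induces a bijection of \<open>\<Gamma> / (\<Gamma> \<inter> R \<Gamma>)\<close> onto \<open>\<O> / \<alpha> \<O>\<close>.\<close>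

lemma coincidence_index_from_functional:
  assumes \<alpha>: "\<alpha> \<in> Z_golden" "\<alpha> * gconj \<alpha> = of_nat m" "m > 0"
    and h: "h \<in> icosian" "qtr h = of_int t" "coprime t (int m)" "qnr h = \<alpha> * \<beta>" "\<beta> \<in> Z_golden"
    and l: "l1 \<in> Z_golden" "l2 \<in> Z_golden" "l3 \<in> Z_golden"
    and L_def: "\<And>v. L v = l1 * v $ 1 + l2 * v $ 2 + l3 * v $ 3"
    and crit: "\<And>s v. half_quat s v \<in> icosian \<Longrightarrow>
      qdvd \<alpha> (qcnj h * half_quat s v * h) \<longleftrightarrow> L v \<in> (*) \<alpha> ` Z_golden"
    and base: "base \<in> M_F" "L base = of_int n" "coprime n (int m)"
  shows "\<exists>R. has_coincidence_index R m"
proof -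
  let ?\<alpha>' = "gconj \<alpha>"
  have \<alpha>': "?\<alpha>' \<in> Z_golden" using gconj_Z_golden \<alpha> by blast
  have nz: "\<alpha> \<noteq> 0" using \<alpha> by auto
  have "\<alpha> * ?\<alpha>' = of_int (int m)" using \<alpha> by simp
  from icosian_gcd[OF \<alpha>(1) \<alpha>' this nz h] obtain q a b c e e' where
    I: "q \<in> icosian" "a \<in> icosian" "b \<in> icosian" "c \<in> icosian"
    and qh: "q = h * a + qr \<alpha> * b" "h = q * c"
    and e: "e \<in> Z_golden" "qnr q = \<alpha> * e" and e': "e' \<in> Z_golden" "\<alpha> = qnr q * e'"
    by blast
  have q0: "q \<noteq> 0" using e' nz qnr_eq_0_iff by auto
  define R where "R = quat_rotation q"
  have R: "R \<in> SO3_Q_sqrt5" "R \<in> SO3" unfolding R_def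
    using quat_rotation_SO3_Q_sqrt5[OF I(1) q0] quat_rotation_SO3[OF q0] by auto
  have assoc: "qdvd (qnr q) x \<longleftrightarrow> qdvd \<alpha> x" for x
    using qdvd_trans e e' by metis
  have "add_index \<Gamma> (\<Gamma> \<inter> (*v) R ` \<Gamma>) = m
      \<and> (\<forall>v\<in>\<Gamma>. of_nat m *\<^sub>R v \<in> (*v) R ` \<Gamma>) \<and> (\<forall>v\<in>(*v) R ` \<Gamma>. of_nat m *\<^sub>R v \<in> \<Gamma>)"
    if \<Gamma>: "\<Gamma> \<in> {M_B, M_F}" for \<Gamma>
  proof -
    note mod = icosahedral_module[OF \<Gamma>]
    have mem: "v \<in> (*v) R ` \<Gamma> \<longleftrightarrow> L v \<in> (*) \<alpha> ` Z_golden" if v: "v \<in> \<Gamma>" for v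
    proof -
      obtain s where s: "half_quat s v \<in> icosian"
        and iff: "v \<in> (*v) R ` \<Gamma> \<longleftrightarrow> qdvd (qnr q) (qcnj q * half_quat s v * q)"
        using rotated_module_iff[OF \<Gamma> I(1) q0 v] unfolding R_def by blast
      show ?thesis
        unfolding iff assoc qdvd_conjugate_iff[OF \<alpha>(1) I(2,3,4) h(1) s qh] by (rule crit[OF s])
    qed
    have LO: "L v \<in> Z_golden" if "v \<in> \<Gamma>" for v
      unfolding L_def using mod(3)[OF that] l by simp
    have Ld: "L v - L w = L (v - w)" for v w unfolding L_def by (simp add: algebra_simps)
    have Ls: "L (r *\<^sub>R v) = r * L v" for r v unfolding L_def by (simp add: algebra_simps)
    have base\<Gamma>: "base \<in> \<Gamma>" using base \<Gamma> M_F_subset_M_B by blast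
    have sub: "is_addsubgroup (\<Gamma> \<inter> (*v) R ` \<Gamma>)"
      using mod(1) addsubgroup_image addsubgroup_Int by blast
    have "add_index \<Gamma> (\<Gamma> \<inter> (*v) R ` \<Gamma>) = add_index Z_golden ((*) \<alpha> ` Z_golden)"
    proof (rule add_index_transport(2)[where f = L])
      show "L x - L y \<in> (*) \<alpha> ` Z_golden \<longleftrightarrow> x - y \<in> \<Gamma> \<inter> (*v) R ` \<Gamma>" if "x \<in> \<Gamma>" "y \<in> \<Gamma>" for x y
        unfolding Ld using mem[of "x - y"] addsubgroup_diff[OF mod(1) that] by blast
      fix r assume r: "r \<in> Z_golden"
      obtain u w where "u * n + w * int m = 1" using base(3) bezout_int[of n "int m"] by auto
      then have "of_int (u * n + w * int m) = (1::real)" by simp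
      then have uw: "of_int u * of_int n + of_int w * of_nat m = (1::real)" by simp
      have "r - L ((of_int u * r) *\<^sub>R base) = r * (1 - of_int u * of_int n)"
        unfolding Ls base by (simp add: algebra_simps)
      also have "1 - of_int u * of_int n = of_int w * (\<alpha> * ?\<alpha>')"
        using uw unfolding \<alpha>(2) by linarith
      also have "r * (of_int w * (\<alpha> * ?\<alpha>')) = \<alpha> * (?\<alpha>' * of_int w * r)" by (simp add: ac_simps)
      also have "\<dots> \<in> (*) \<alpha> ` Z_golden" using \<alpha>' r by (intro imageI Z_golden_mult) auto
      finally have "r - L ((of_int u * r) *\<^sub>R base) \<in> (*) \<alpha> ` Z_golden" .
      moreover have "(of_int u * r) *\<^sub>R base \<in> \<Gamma>" using mod(2) r base\<Gamma> by simp
      ultimately show "\<exists>a\<in>\<Gamma>. r - L a \<in> (*) \<alpha> ` Z_golden" by blast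
    qed (use sub addsubgroup_gideal LO in auto)
    also have "\<dots> = m" by (rule index_gideal[OF \<alpha>])
    finally have "add_index \<Gamma> (\<Gamma> \<inter> (*v) R ` \<Gamma>) = m" .
    moreover have "of_nat m *\<^sub>R v \<in> (*v) R ` \<Gamma>" if v: "v \<in> \<Gamma>" for v
    proof -
      have "L (of_nat m *\<^sub>R v) = \<alpha> * (?\<alpha>' * L v)" unfolding Ls \<alpha>(2)[symmetric] by simp
      then have "L (of_nat m *\<^sub>R v) \<in> (*) \<alpha> ` Z_golden" using LO[OF v] \<alpha>' by (metis Z_golden_mult imageI)
      moreover have "of_nat m *\<^sub>R v \<in> \<Gamma>" using mod(2) v by simp
      ultimately show ?thesis using mem by blast
    qed
    moreover have "of_nat m *\<^sub>R v \<in> \<Gamma>" if v: "v \<in> (*v) R ` \<Gamma>" for v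
    proof -
      obtain u where u: "u \<in> \<Gamma>" "v = R *v u" using v by blast
      have n: "qnr q \<noteq> 0" using q0 qnr_eq_0_iff by blast
      have conv: "half_quat (of_nat m * s) (of_nat m *\<^sub>R v) \<in> icosian" if s: "half_quat s u \<in> icosian" for s
      proof -
        have "half_quat (of_nat m * s) (of_nat m *\<^sub>R v) = qr (e' * ?\<alpha>') * (qr (qnr q) * half_quat s v)"
          unfolding half_quat_scale \<alpha>(2)[symmetric] mult.assoc[symmetric] qr_mult[symmetric]
          using e'(2) by (simp add: ac_simps)
        also have "\<dots> = qr (e' * ?\<alpha>') * (q * half_quat s u * qcnj q)"
          unfolding u(2) R_def half_quat_rotation[OF q0] ..
        also have "\<dots> \<in> icosian" using e' \<alpha>' I s by simp
        finally show ?thesis .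
      qed
      consider "\<Gamma> = M_F" | "\<Gamma> = M_B" using \<Gamma> by blast
      then show ?thesis
      proof cases
        case 1
        then show ?thesis using conv[of 0] u M_F_iff by simp
      next
        case 2
        then show ?thesis using conv u M_B_iff by blast
      qed
    qed
    ultimately show ?thesis by blast
  qed
  note main = this
  have "has_coincidence_index R m"
    unfolding has_coincidence_index_def by (rule conjI[OF R(1)], rule ballI, rule main)
  then show ?thesis by blast
qed

text \<open>The functional is \<open>L v = y v\<^sub>1 - x v\<^sub>2 + v\<^sub>3\<close>, read off from the third component of \<open>h\<^sup>* w h\<close>. The icosians
  involve denominators \<open>2\<close>, which are harmless modulo the odd norm.\<close>

lemma coincidence_index_odd:
  assumes m: "odd m" and norm: "int m = k\<^sup>2 + k * l - l\<^sup>2"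
  shows "\<exists>R. has_coincidence_index R m"
proof -
  define \<alpha> where "\<alpha> = of_int k + of_int l * golden"
  have \<alpha>: "\<alpha> \<in> Z_golden" unfolding \<alpha>_def by simp
  have \<alpha>m: "\<alpha> * gconj \<alpha> = of_nat m"
    unfolding \<alpha>_def mult_gconj_eq norm[symmetric] by simp
  have \<alpha>': "gconj \<alpha> \<in> Z_golden" using gconj_Z_golden \<alpha> by blast
  have m0: "m > 0" using m by (cases m) auto
  obtain x y :: int where "int m dvd x\<^sup>2 + y\<^sup>2 + 1" using sum_two_squares_plus_one_mod_odd m by blast
  then obtain b where xy: "x\<^sup>2 + y\<^sup>2 + 1 = int m * b" by blast
  have cop: "coprime 2 (int m)" using m by simp
  obtain j where j: "m = 2 * j + 1" using m by (elim oddE)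
  define h where "h = Quat 1 (of_int x) (of_int y) 0"
  define \<beta> where "\<beta> = gconj \<alpha> * of_int b"
  have \<beta>: "\<beta> \<in> Z_golden" unfolding \<beta>_def using \<alpha>' by simp
  have "real_of_int (x\<^sup>2 + y\<^sup>2 + 1) = \<alpha> * \<beta>" unfolding xy \<beta>_def using \<alpha>m by simp
  then have N: "1 + (of_int x)\<^sup>2 + (of_int y)\<^sup>2 = \<alpha> * \<beta>" by simp
  \<comment> \<open>A factor \<open>2\<close> can be cancelled modulo \<open>\<alpha>\<close>, as \<open>1 = m - 2 j\<close> and \<open>\<alpha>\<close> divides \<open>m\<close>.\<close>
  have odd_cancel: "\<exists>e\<in>Z_golden. z = \<alpha> * e" if z: "z \<in> Z_golden" "2 * z = \<alpha> * w" "w \<in> Z_golden" for z w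
  proof -
    have "z = of_nat m * z - of_nat j * (2 * z)" unfolding j by (simp add: algebra_simps)
    also have "\<dots> = \<alpha> * (gconj \<alpha> * z - of_nat j * w)"
      unfolding z(2) \<alpha>m[symmetric] by (simp add: algebra_simps)
    finally have "z = \<alpha> * (gconj \<alpha> * z - of_nat j * w)" .
    moreover have "gconj \<alpha> * z - of_nat j * w \<in> Z_golden" using \<alpha>' z by simp
    ultimately show ?thesis by blast
  qed
  \<comment> \<open>Modulo \<open>\<alpha>\<close> the image of conjugation is spanned by one vector, and \<open>L\<close> is the coefficient.\<close>
  have conj: "qcnj h * half_quat s v * h
      = qr L * Quat 0 (- of_int y) (of_int x) 1 + qr (\<alpha> * \<beta>) * Quat s (v $ 1 / 2) (v $ 2 / 2) (- (v $ 3 / 2))"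
    if "L = of_int y * v $ 1 + (- of_int x) * v $ 2 + 1 * v $ 3" for s v L
    unfolding that h_def N[symmetric] quat_eq_iff by (simp add: field_simps power2_eq_square)
  show ?thesis
  proof (rule coincidence_index_from_functional[OF \<alpha> \<alpha>m m0])
    show "h \<in> icosian" unfolding icosian_iff h_def by simp
    show "qtr h = of_int 2" unfolding qtr_def h_def by simp
    show "coprime 2 (int m)" by (rule cop)
    show "qnr h = \<alpha> * \<beta>" using N unfolding qnr_def h_def by simp
    show "\<beta> \<in> Z_golden" by (rule \<beta>)
    show "of_int y \<in> Z_golden" "- of_int x \<in> Z_golden" "1 \<in> Z_golden" by simp_all
    have "(vector [0, 0, 2] :: real ^ 3) $ i / 2 \<in> Z_golden" for i
      using exhaust_3[of i] by (auto simp: vector_3)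
    then show "vector [0, 0, 2] \<in> M_F" by (intro icosahedral_module(4)) auto
    show "of_int y * (vector [0, 0, 2] :: real ^ 3) $ 1 + (- of_int x) * (vector [0, 0, 2] :: real ^ 3) $ 2
        + 1 * (vector [0, 0, 2] :: real ^ 3) $ 3 = of_int 2" by (simp add: vector_3)
    fix s and v :: "real ^ 3" assume w: "half_quat s v \<in> icosian"
    define L where "L = of_int y * v $ 1 + (- of_int x) * v $ 2 + 1 * v $ 3"
    define X where "X = qcnj h * half_quat s v * h"
    have XI: "X \<in> icosian" unfolding X_def using w \<open>h \<in> icosian\<close> by simp
    have v: "v $ i \<in> Z_golden" for i using w M_B_iff icosahedral_module(3)[of M_B v i] by blast
    have s: "2 * s \<in> Z_golden" using qtr_icosian[OF w] by (simp add: qtr_def)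
    have LO: "L \<in> Z_golden" unfolding L_def using v by simp
    have X: "X = qr L * Quat 0 (- of_int y) (of_int x) 1
        + qr (\<alpha> * \<beta>) * Quat s (v $ 1 / 2) (v $ 2 / 2) (- (v $ 3 / 2))"
      unfolding X_def by (rule conj[OF L_def])
    have "qdvd \<alpha> X \<longleftrightarrow> L \<in> (*) \<alpha> ` Z_golden"
    proof
      assume "qdvd \<alpha> X"
      then obtain Y where Y: "Y \<in> icosian" "X = qr \<alpha> * Y" unfolding qdvd_def by blast
      have "q3 X = \<alpha> * q3 Y" unfolding Y(2) by simp
      then have "2 * L = \<alpha> * (2 * q3 Y + \<beta> * v $ 3)" unfolding X by (simp add: algebra_simps)
      moreover have "2 * q3 Y + \<beta> * v $ 3 \<in> Z_golden" using Y(1)[unfolded icosian_iff] \<beta> v by simp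
      ultimately show "L \<in> (*) \<alpha> ` Z_golden" using odd_cancel[OF LO] by blast
    next
      assume "L \<in> (*) \<alpha> ` Z_golden"
      then obtain e where e: "e \<in> Z_golden" "L = \<alpha> * e" by blast
      define Z where "Z = Quat (\<beta> * (2 * s)) (2 * e * - of_int y + \<beta> * v $ 1) (2 * e * of_int x + \<beta> * v $ 2) (2 * e - \<beta> * v $ 3)"
      have "qr \<alpha> * Z = X + X" unfolding X e(2) Z_def quat_eq_iff by (simp add: field_simps)
      moreover have "Z \<in> icosian"
        unfolding icosian_iff Z_def using e \<beta> v s by simp
      ultimately have d2: "qdvd \<alpha> (X + X)" unfolding qdvd_def by metis
      have "qdvd \<alpha> (qr (of_nat m) * X)"
        by (rule qdvdI[of "qr (gconj \<alpha>) * X"]) (use XI \<alpha>' in \<open>simp_all add: \<alpha>m[symmetric] qr_mult mult.assoc\<close>)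
      moreover have "qdvd \<alpha> (qr (of_nat j) * (X + X))" using d2 by (rule qdvd_mult_left) simp
      ultimately have "qdvd \<alpha> (qr (of_nat m) * X - qr (of_nat j) * (X + X))" by (rule qdvd_diff)
      moreover have "qr (of_nat m) * X - qr (of_nat j) * (X + X) = X"
        unfolding j quat_eq_iff by (simp add: algebra_simps)
      ultimately show "qdvd \<alpha> X" by simp
    qed
    then show "qdvd \<alpha> (qcnj h * half_quat s v * h)
        \<longleftrightarrow> of_int y * v $ 1 + (- of_int x) * v $ 2 + 1 * v $ 3 \<in> (*) \<alpha> ` Z_golden"
      unfolding X_def L_def .
  qed (use cop in auto)
qed

text \<open>Here \<open>h = z - g\<close> with \<open>g = (1 + i + j + \<surd>5 k) / 2\<close> and \<open>\<surd>5 = 2 \<tau> - 1\<close>. The congruence for \<open>z\<close> is used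
  modulo \<open>2 ^ Suc k\<close>, one power more than \<open>\<alpha> = 2 ^ k\<close>: the error term of \<open>h\<^sup>* w h\<close> has denominators \<open>2\<close> and
  is certain to be an icosian only after doubling.\<close>

lemma coincidence_index_power_4: "\<exists>R. has_coincidence_index R (4 ^ k)"
proof -
  obtain z :: int where z: "even z" "2 ^ Suc k dvd z\<^sup>2 - z + 2" using root_mod_power_of_2 by blast
  obtain b where b: "z\<^sup>2 - z + 2 = 2 ^ Suc k * b" using z by blast
  obtain z' where z': "z = 2 * z'" using z by blast
  define \<alpha> :: real where "\<alpha> = 2 ^ k"
  define \<zeta> :: real where "\<zeta> = of_int z"
  have \<zeta>2: "\<zeta> = 2 * of_int z'" unfolding \<zeta>_def z' by simp
  have \<alpha>: "\<alpha> \<in> Z_golden" unfolding \<alpha>_def by simp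
  have "\<alpha> \<in> \<rat>" unfolding \<alpha>_def by simp
  then have "\<alpha> * gconj \<alpha> = \<alpha> * \<alpha>" using gconj_of_rat by simp
  also have "\<dots> = of_nat (4 ^ k)" unfolding \<alpha>_def power_mult_distrib[symmetric] by simp
  finally have \<alpha>m: "\<alpha> * gconj \<alpha> = of_nat (4 ^ k)" .
  define h where "h = Quat (\<zeta> - 1 / 2) (- 1 / 2) (- 1 / 2) (1 / 2 - golden)"
  have "real_of_int (z\<^sup>2 - z + 2) = \<alpha> * (2 * of_int b)" unfolding b \<alpha>_def by simp
  then have N: "\<zeta>\<^sup>2 - \<zeta> + 2 = \<alpha> * (2 * of_int b)" unfolding \<zeta>_def by simp
  have nrh: "qnr h = \<zeta>\<^sup>2 - \<zeta> + 2"
    unfolding qnr_def h_def by (simp add: power2_eq_square field_simps golden_mult_golden golden_reduce)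
  have hI: "h \<in> icosian"
  proof -
    have e: "q0 h - q2 h + (golden - 1) * (q3 h - q2 h) = \<zeta> - (golden - 1) * (golden - 1)"
      "q1 h - (golden - 1) * q2 h - (2 - golden) * q3 h = 2 * golden - 3"
      "2 * q2 h = - 1" "2 * q3 h = 1 - 2 * golden"
      unfolding h_def by (simp_all add: field_simps golden_reduce golden_mult_golden)
    show ?thesis unfolding icosian_iff e \<zeta>_def by simp
  qed
  have conj: "qcnj h * half_quat s v * h
      = qr L * Quat 0 ((1 - golden - \<zeta>) / 2) ((\<zeta> - golden) / 2) (1 / 2)
        + qr (qnr h) * Quat s (v $ 2 / 2) (v $ 1 / 2) (v $ 3 / 2)"
    if "L = (golden - \<zeta>) * v $ 1 + (golden + \<zeta> - 1) * v $ 2 + (- 1) * v $ 3" for s v L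
    unfolding nrh unfolding that h_def quat_eq_iff
    by (simp add: field_simps power2_eq_square golden_reduce golden_mult_golden)
  have n2: "Quat 0 ((1 - golden - \<zeta>) / 2) ((\<zeta> - golden) / 2) (1 / 2) \<in> icosian" (is "?n \<in> _")
  proof -
    have e: "q0 ?n - q2 ?n + (golden - 1) * (q3 ?n - q2 ?n) = golden - golden * of_int z'"
      "q1 ?n - (golden - 1) * q2 ?n - (2 - golden) * q3 ?n = - (golden * of_int z')"
      "2 * q2 ?n = \<zeta> - golden" "2 * q3 ?n = 1"
      by (simp_all add: \<zeta>2 field_simps golden_reduce golden_mult_golden)
    show ?thesis unfolding icosian_iff e unfolding \<zeta>_def by simp
  qed
  \<comment> \<open>On \<open>(\<tau> + 1, \<tau>, 1)\<close> the functional is \<open>1 - z + 2 \<tau>\<close>. Multiplication by the conjugate of this value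
    turns it into its norm, an odd integer.\<close>
  let ?n = "(1 - z)\<^sup>2 + (1 - z) * 2 - 2\<^sup>2"
  define v0 :: "real ^ 3" where "v0 = (3 - 2 * golden - \<zeta>) *\<^sub>R vector [golden + 1, golden, 1]"
  have cop: "coprime x (int (4 ^ k))" if "odd x" for x
    using that by (simp add: coprime_power_right_iff) (metis coprime_mult_right_iff coprime_right_2_iff_odd mult_2_right numeral_Bit0 one_add_one mult.commute)
  show ?thesis
  proof (rule coincidence_index_from_functional[OF \<alpha> \<alpha>m _ hI _ _ N[folded nrh], where t = "2 * z - 1"
        and L = "\<lambda>v. (golden - \<zeta>) * v $ 1 + (golden + \<zeta> - 1) * v $ 2 + (- 1) * v $ 3" and base = v0 and n = ?n])
    show "qtr h = of_int (2 * z - 1)" unfolding qtr_def h_def \<zeta>_def by (simp add: field_simps)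
    show "coprime (2 * z - 1) (int (4 ^ k))" by (rule cop) simp
    show "coprime ?n (int (4 ^ k))" by (rule cop) (use z in simp)
    show "2 * of_int b \<in> Z_golden" by simp
    show "golden - \<zeta> \<in> Z_golden" "golden + \<zeta> - 1 \<in> Z_golden" "- 1 \<in> Z_golden" unfolding \<zeta>_def by simp_all
    have "vector [golden + 1, golden, 1] \<in> M_F"
    proof -
      have e: "0 - (golden * golden - (golden - 1) * 1) / 2 = - 1"
        "(golden + 1 - (golden - 1) * golden - (2 - golden) * 1) / 2 = golden - 1"
        by (simp_all add: field_simps golden_mult_golden)
      show ?thesis unfolding M_F_iff half_quat_icosian vector_3 e by simp
    qed
    then show "v0 \<in> M_F" unfolding v0_def \<zeta>_def by (intro icosahedral_module(2)) auto
    show "(golden - \<zeta>) * v0 $ 1 + (golden + \<zeta> - 1) * v0 $ 2 + (- 1) * v0 $ 3 = of_int ?n"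
      unfolding v0_def \<zeta>_def by (simp add: vector_3 power2_eq_square algebra_simps golden_reduce golden_mult_golden)
    fix s and v :: "real ^ 3" assume w: "half_quat s v \<in> icosian"
    define L where "L = (golden - \<zeta>) * v $ 1 + (golden + \<zeta> - 1) * v $ 2 + (- 1) * v $ 3"
    define X where "X = qcnj h * half_quat s v * h"
    define Y where "Y = Quat (2 * s * of_int b) (of_int b * v $ 2) (of_int b * v $ 1) (of_int b * v $ 3)"
    have v: "v $ i \<in> Z_golden" for i using w M_B_iff icosahedral_module(3)[of M_B v i] by blast
    have s: "2 * s \<in> Z_golden" using qtr_icosian[OF w] by (simp add: qtr_def)
    have YI: "Y \<in> icosian" unfolding icosian_iff Y_def using v s by simp
    have X: "X = qr L * Quat 0 ((1 - golden - \<zeta>) / 2) ((\<zeta> - golden) / 2) (1 / 2) + qr \<alpha> * Y"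
      unfolding X_def conj[OF L_def] Y_def nrh N quat_eq_iff by simp
    have "qdvd \<alpha> X \<longleftrightarrow> L \<in> (*) \<alpha> ` Z_golden"
    proof
      assume "qdvd \<alpha> X"
      then obtain W where W: "W \<in> icosian" "X = qr \<alpha> * W" unfolding qdvd_def by blast
      have "q3 X = \<alpha> * q3 W" unfolding W(2) by simp
      then have "L = \<alpha> * (2 * q3 W - 2 * q3 Y)" unfolding X by (simp add: algebra_simps)
      moreover have "2 * q3 W - 2 * q3 Y \<in> Z_golden"
        using W(1)[unfolded icosian_iff] YI[unfolded icosian_iff] by (blast intro: Z_golden_diff)
      ultimately show "L \<in> (*) \<alpha> ` Z_golden" by blast
    next
      assume "L \<in> (*) \<alpha> ` Z_golden"
      then obtain e where e: "e \<in> Z_golden" "L = \<alpha> * e" by blast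
      have "X = qr \<alpha> * (qr e * Quat 0 ((1 - golden - \<zeta>) / 2) ((\<zeta> - golden) / 2) (1 / 2) + Y)"
        unfolding X e(2) by (simp add: qr_mult distrib_left mult.assoc)
      then show "qdvd \<alpha> X" by (rule qdvdI[rotated]) (use e n2 YI in simp)
    qed
    then show "qdvd \<alpha> (qcnj h * half_quat s v * h)
        \<longleftrightarrow> (golden - \<zeta>) * v $ 1 + (golden + \<zeta> - 1) * v $ 2 + (- 1) * v $ 3 \<in> (*) \<alpha> ` Z_golden"
      unfolding X_def L_def .
  qed simp_all
qed

lemma SO3_mult: "R \<in> SO3 \<Longrightarrow> S \<in> SO3 \<Longrightarrow> R ** S \<in> SO3"
  unfolding SO3_def by (simp add: orthogonal_matrix_mul det_mul)

lemma SO3_Q_sqrt5_mult: "R \<in> SO3_Q_sqrt5 \<Longrightarrow> S \<in> SO3_Q_sqrt5 \<Longrightarrow> R ** S \<in> SO3_Q_sqrt5"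
proof -
  assume R: "R \<in> SO3_Q_sqrt5" and S: "S \<in> SO3_Q_sqrt5"
  have "(R ** S) $ i $ j \<in> Q_sqrt5" for i j
    using R S unfolding SO3_Q_sqrt5_def matrix_matrix_mult_def by (simp add: sum_3)
  then show "R ** S \<in> SO3_Q_sqrt5" using R S SO3_mult unfolding SO3_Q_sqrt5_def by blast
qed

lemma SO3_Q_sqrt5_transpose: "R \<in> SO3_Q_sqrt5 \<Longrightarrow> transpose R \<in> SO3_Q_sqrt5"
  unfolding SO3_Q_sqrt5_def using SO3_inverse(3) by (auto simp: transpose_def)

lemma has_coincidence_indexD:
  assumes "has_coincidence_index R m" "\<Gamma> \<in> {M_B, M_F}"
  shows "add_index \<Gamma> (\<Gamma> \<inter> (*v) R ` \<Gamma>) = m"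
    and "\<And>v. v \<in> \<Gamma> \<Longrightarrow> of_nat m *\<^sub>R v \<in> (*v) R ` \<Gamma>"
    and "\<And>v. v \<in> (*v) R ` \<Gamma> \<Longrightarrow> of_nat m *\<^sub>R v \<in> \<Gamma>"
proof -
  note * = bspec[OF conjunct2[OF assms(1)[unfolded has_coincidence_index_def]] assms(2)]
  show "add_index \<Gamma> (\<Gamma> \<inter> (*v) R ` \<Gamma>) = m" by (rule conjunct1[OF *])
  show "\<And>v. v \<in> \<Gamma> \<Longrightarrow> of_nat m *\<^sub>R v \<in> (*v) R ` \<Gamma>"
    by (rule bspec[OF conjunct1[OF conjunct2[OF *]]])
  show "\<And>v. v \<in> (*v) R ` \<Gamma> \<Longrightarrow> of_nat m *\<^sub>R v \<in> \<Gamma>"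
    by (rule bspec[OF conjunct2[OF conjunct2[OF *]]])
qed

lemma has_coincidence_index_SO3: "has_coincidence_index R m \<Longrightarrow> R \<in> SO3_Q_sqrt5"
  unfolding has_coincidence_index_def by (rule conjunct1)

text \<open>The modules \<open>\<Gamma>\<close>, \<open>R \<Gamma>\<close> and \<open>R S \<Gamma>\<close> are consecutive at coprime distances, and the index of the second
  pair is that of \<open>\<Gamma>\<close> and \<open>S \<Gamma>\<close>, transported by \<open>R\<close>.\<close>

lemma has_coincidence_index_mult:
  assumes R: "has_coincidence_index R m" and S: "has_coincidence_index S n" and cop: "coprime m n"
  shows "has_coincidence_index (R ** S) (m * n)"
proof -
  have K: "R \<in> SO3_Q_sqrt5" "S \<in> SO3_Q_sqrt5" using R S has_coincidence_index_SO3 by auto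
  then have R3: "R \<in> SO3" unfolding SO3_Q_sqrt5_def by blast
  have "add_index \<Gamma> (\<Gamma> \<inter> (*v) (R ** S) ` \<Gamma>) = m * n
      \<and> (\<forall>v\<in>\<Gamma>. of_nat (m * n) *\<^sub>R v \<in> (*v) (R ** S) ` \<Gamma>)
      \<and> (\<forall>v\<in>(*v) (R ** S) ` \<Gamma>. of_nat (m * n) *\<^sub>R v \<in> \<Gamma>)" if \<Gamma>: "\<Gamma> \<in> {M_B, M_F}" for \<Gamma>
  proof -
    note sub = icosahedral_module(1)[OF \<Gamma>]
    define B where "B = (*v) R ` \<Gamma>"
    define D where "D = (*v) S ` \<Gamma>"
    define C where "C = (*v) R ` D"
    have C: "C = (*v) (R ** S) ` \<Gamma>"
      unfolding C_def D_def image_image matrix_vector_mul_assoc ..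
    have subB: "is_addsubgroup B" and subD: "is_addsubgroup D" and subC: "is_addsubgroup C"
      unfolding C_def D_def B_def using sub addsubgroup_image by blast+
    note Rm = has_coincidence_indexD[OF R \<Gamma>, folded B_def]
    note Sn = has_coincidence_indexD[OF S \<Gamma>, folded D_def]
    have BC: "of_nat n *\<^sub>R v \<in> C" if v: "v \<in> B" for v
    proof -
      obtain u where "u \<in> \<Gamma>" "v = R *v u" using v unfolding B_def by blast
      then have "of_nat n *\<^sub>R v = R *v (of_nat n *\<^sub>R u)" "of_nat n *\<^sub>R u \<in> D"
        using Sn by (auto simp: matrix_vector_mult_scaleR)
      then show ?thesis unfolding C_def by blast
    qed
    have CB: "of_nat n *\<^sub>R v \<in> B" if v: "v \<in> C" for v
    proof -
      obtain u where "u \<in> D" "v = R *v u" using v unfolding C_def by blast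
      then have "of_nat n *\<^sub>R v = R *v (of_nat n *\<^sub>R u)" "of_nat n *\<^sub>R u \<in> \<Gamma>"
        using Sn by (auto simp: matrix_vector_mult_scaleR)
      then show ?thesis unfolding B_def by blast
    qed
    have "add_index \<Gamma> (\<Gamma> \<inter> D) = add_index B (B \<inter> C)"
    proof (rule add_index_transport(2)[where f = "(*v) R"])
      show "is_addsubgroup (\<Gamma> \<inter> D)" "is_addsubgroup (B \<inter> C)"
        using sub subB subC subD addsubgroup_Int by blast+
      show "R *v x - R *v y \<in> B \<inter> C \<longleftrightarrow> x - y \<in> \<Gamma> \<inter> D" for x y
        unfolding matrix_vector_mult_diff_distrib[symmetric] B_def C_def
        using SO3_image_iff[OF R3] SO3_inverse(1)[OF R3] by simp
      fix c assume "c \<in> B"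
      then obtain a where "a \<in> \<Gamma>" "c - R *v a = 0" unfolding B_def by auto
      then show "\<exists>a\<in>\<Gamma>. c - R *v a \<in> B \<inter> C"
        using addsubgroup_zero[OF subB] addsubgroup_zero[OF subC] by (metis IntI)
    qed (auto simp: B_def)
    then have "add_index B (B \<inter> C) = n" using Sn by simp
    moreover have "add_index \<Gamma> (\<Gamma> \<inter> C) = add_index \<Gamma> (\<Gamma> \<inter> B) * add_index B (B \<inter> C)"
      by (rule add_index_coprime[OF sub subB subC cop Rm(2,3) BC CB])
    ultimately have "add_index \<Gamma> (\<Gamma> \<inter> C) = m * n" using Rm by simp
    moreover have "of_nat (m * n) *\<^sub>R v \<in> C" if "v \<in> \<Gamma>" for v
      using BC[OF Rm(2)[OF that]] by (simp add: mult.commute)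
    moreover have "of_nat (m * n) *\<^sub>R v \<in> \<Gamma>" if "v \<in> C" for v
      using Rm(3)[OF CB[OF that]] by simp
    ultimately show ?thesis unfolding C by blast
  qed
  note main = this
  show ?thesis
    unfolding has_coincidence_index_def by (rule conjI[OF SO3_Q_sqrt5_mult[OF K]], rule ballI, rule main)
qed

text \<open>An even norm has even \<open>k\<close> and \<open>l\<close>, so the even part of a norm is a power of \<open>4\<close> and the odd part is a
  norm again.\<close>

lemma golden_norm_attained:
  assumes "m \<ge> 1" "is_golden_norm (int m)"
  shows "\<exists>R. has_coincidence_index R m"
proof -
  have "\<exists>a n. m = 4 ^ a * n \<and> odd n \<and> is_golden_norm (int n)"
    using assms
  proof (induction m rule: less_induct)
    case (less m)
    show ?case
    proof (cases "odd m")
      case True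
      then show ?thesis using less.prems by (intro exI[of _ 0] exI[of _ m]) simp
    next
      case False
      obtain k l where kl: "int m = k\<^sup>2 + k * l - l\<^sup>2" using less.prems unfolding is_golden_norm_def by blast
      have "even (k\<^sup>2 + k * l - l\<^sup>2)" unfolding kl[symmetric] using False by simp
      then have "even k" "even l" using even_golden_norm by blast+
      then obtain k' l' where "k = 2 * k'" "l = 2 * l'" by (elim evenE)
      then have m4: "int m = 4 * (k'\<^sup>2 + k' * l' - l'\<^sup>2)" using kl by (simp add: power2_eq_square)
      define n where "n = nat (k'\<^sup>2 + k' * l' - l'\<^sup>2)"
      have n: "int n = k'\<^sup>2 + k' * l' - l'\<^sup>2" unfolding n_def using m4 by simp
      then have "m = 4 * n" using m4 by simp
      moreover have "is_golden_norm (int n)" using n by (rule is_golden_normI)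
      ultimately obtain a n' where "n = 4 ^ a * n'" "odd n'" "is_golden_norm (int n')"
        using less.IH[of n] less.prems by auto
      then show ?thesis using \<open>m = 4 * n\<close> by (intro exI[of _ "Suc a"] exI[of _ n']) simp
    qed
  qed
  then obtain a n where m: "m = 4 ^ a * n" and n: "odd n" "is_golden_norm (int n)" by blast
  obtain R where R: "has_coincidence_index R (4 ^ a)" using coincidence_index_power_4 by blast
  obtain S where S: "has_coincidence_index S n"
    using coincidence_index_odd n unfolding is_golden_norm_def by blast
  have "coprime (2 ^ (2 * a)) n" using n(1) by simp
  then have "coprime (4 ^ a) n" by (simp add: power_mult)
  then show ?thesis using has_coincidence_index_mult[OF R S] m by blast
qed

section \<open>Coincidence groups and spectra\<close>

lemma common_denominator:
  assumes "R \<in> SO3_Q_sqrt5"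
  shows "\<exists>d::nat. d > 0 \<and> (\<forall>i j. of_nat d * R $ i $ j \<in> Z_golden)"
proof -
  have "\<exists>n::nat. n > 0 \<and> of_nat n * R $ fst p $ snd p \<in> Z_golden" for p
    using assms Q_sqrt5_denominator unfolding SO3_Q_sqrt5_def by blast
  then obtain D :: "3 \<times> 3 \<Rightarrow> nat" where D: "\<And>p. D p > 0" "\<And>p. of_nat (D p) * R $ fst p $ snd p \<in> Z_golden"
    by metis
  define d where "d = (\<Prod>p\<in>UNIV. D p)"
  have "of_nat d * R $ i $ j \<in> Z_golden" for i j
  proof -
    have "D (i, j) dvd d" unfolding d_def by (rule dvd_prodI) auto
    then obtain k where "d = k * D (i, j)" by (metis dvdE mult.commute)
    then have e: "of_nat d * R $ i $ j = of_nat k * (of_nat (D (i, j)) * R $ i $ j)" by simp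
    show ?thesis unfolding e using Z_golden_mult[OF Z_golden_of_nat D(2)[of "(i, j)"], of k] by simp
  qed
  moreover have "d > 0" unfolding d_def using D(1) by (intro prod_pos) auto
  ultimately show ?thesis by blast
qed

text \<open>If \<open>d\<close> is a common denominator of \<open>R\<close>, a vector divisible by \<open>2 d\<close> in \<open>\<O>\<^sup>3\<close> lies in \<open>\<Gamma>\<close> and in \<open>R \<Gamma>\<close>, so
  the coordinates modulo \<open>2 d\<close> classify.\<close>

lemma finite_coincidence_index:
  assumes \<Gamma>: "\<Gamma> \<in> {M_B, M_F}" and R: "R \<in> SO3_Q_sqrt5"
  shows "finite (cosets_in \<Gamma> (\<Gamma> \<inter> (*v) R ` \<Gamma>))"
proof -
  note mod = icosahedral_module[OF \<Gamma>]
  have R3: "R \<in> SO3" using R unfolding SO3_Q_sqrt5_def by blast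
  obtain d where d: "d > 0" "\<And>i j. of_nat d * R $ i $ j \<in> Z_golden" using common_denominator[OF R] by blast
  define N where "N = 2 * d"
  have N: "N > 0" unfolding N_def using d by simp
  let ?f = "\<lambda>v :: real ^ 3. (gcoord_mod N (v $ 1), gcoord_mod N (v $ 2), gcoord_mod N (v $ 3))"
  show ?thesis
  proof (rule finite_cosetsI[where f = ?f])
    show "is_addsubgroup (\<Gamma> \<inter> (*v) R ` \<Gamma>)" using mod(1) addsubgroup_image addsubgroup_Int by blast
    let ?S = "{0..<int N} \<times> {0..<int N}"
    have "?f ` \<Gamma> \<subseteq> ?S \<times> ?S \<times> ?S"
      using mod(3) gcoord_mod_range[OF N] by blast
    then show "finite (?f ` \<Gamma>)" by (rule finite_subset) simp
    fix x y assume x: "x \<in> \<Gamma>" and y: "y \<in> \<Gamma>" and "?f x = ?f y"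
    then have "\<forall>i. x $ i - y $ i \<in> (*) (of_nat N) ` Z_golden"
      using gcoord_mod_eq_iff[OF N] mod(3) unfolding forall_3 by simp
    then have "\<forall>i. \<exists>w. w \<in> Z_golden \<and> (x - y) $ i = of_nat N * w" by auto
    then obtain w where w: "\<And>i. w i \<in> Z_golden" "\<And>i. (x - y) $ i = of_nat N * w i" by metis
    have "transpose R *v (x - y) \<in> \<Gamma>"
    proof (rule mod(4))
      fix i
      have "(transpose R *v (x - y)) $ i / 2 = (\<Sum>j\<in>UNIV. (of_nat d * R $ j $ i) * w j)"
        unfolding matrix_vector_mult_def w(2) transpose_def N_def
        by (simp add: sum_divide_distrib ac_simps)
      also have "\<dots> \<in> Z_golden" unfolding sum_3 using d w by simp
      finally show "(transpose R *v (x - y)) $ i / 2 \<in> Z_golden" .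
    qed
    then show "x - y \<in> \<Gamma> \<inter> (*v) R ` \<Gamma>"
      using SO3_image_iff[OF R3] addsubgroup_diff[OF mod(1) x y] by blast
  qed
qed

text \<open>The index of \<open>\<Gamma> \<inter> R \<Gamma>\<close> in \<open>R \<Gamma>\<close> is that of \<open>\<Gamma> \<inter> R\<^sup>T \<Gamma>\<close> in \<open>\<Gamma>\<close>, so finiteness is needed only on one
  side.\<close>

lemma SOC_icosahedral_module:
  assumes \<Gamma>: "\<Gamma> \<in> {M_B, M_F}"
  shows "SOC \<Gamma> = SO3_Q_sqrt5"
proof
  note mod = icosahedral_module[OF \<Gamma>]
  show "SOC \<Gamma> \<subseteq> SO3_Q_sqrt5"
  proof
    fix R assume "R \<in> SOC \<Gamma>"
    then have R: "R \<in> SO3" and fin: "finite (cosets_in ((*v) R ` \<Gamma>) (\<Gamma> \<inter> (*v) R ` \<Gamma>))"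
      unfolding SOC_def commensurate_def by auto
    have "R $ i $ j \<in> Q_sqrt5" for i j
    proof -
      have "axis j (2::real) $ k / 2 \<in> Z_golden" for k by (simp add: axis_def)
      then have "axis j 2 \<in> \<Gamma>" by (rule mod(4))
      then have "R *v axis j 2 \<in> (*v) R ` \<Gamma>" by blast
      from finite_index_multiple[OF addsubgroup_image[OF mod(1)] addsubgroup_Int[OF mod(1) addsubgroup_image[OF mod(1)]] fin this]
      obtain n :: nat where n: "n > 0" "of_nat n *\<^sub>R (R *v axis j 2) \<in> \<Gamma>" by blast
      have "(of_nat n *\<^sub>R (R *v axis j 2)) $ i = of_nat n * (2 * R $ i $ j)"
        by (simp add: matrix_vector_mult_def axis_def if_distrib cong: if_cong)
      then have "of_nat n * (2 * R $ i $ j) \<in> Z_golden" using mod(3)[OF n(2), of i] by metis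
      then have "of_nat n * (2 * R $ i $ j) / of_nat (n * 2) \<in> Q_sqrt5"
        by (intro Q_sqrt5_divide Z_golden_sub) auto
      then show ?thesis using n by simp
    qed
    then show "R \<in> SO3_Q_sqrt5" unfolding SO3_Q_sqrt5_def using R by blast
  qed
  show "SO3_Q_sqrt5 \<subseteq> SOC \<Gamma>"
  proof
    fix R assume R: "R \<in> SO3_Q_sqrt5"
    then have R3: "R \<in> SO3" unfolding SO3_Q_sqrt5_def by blast
    let ?T = "transpose R"
    have T: "?T \<in> SO3_Q_sqrt5" "?T \<in> SO3" using SO3_Q_sqrt5_transpose[OF R] SO3_inverse(3)[OF R3] by auto
    have "finite (cosets_in ((*v) R ` \<Gamma>) (\<Gamma> \<inter> (*v) R ` \<Gamma>)) \<longleftrightarrow> finite (cosets_in \<Gamma> (\<Gamma> \<inter> (*v) ?T ` \<Gamma>))"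
    proof (rule add_index_transport(1)[where f = "(*v) ?T"])
      show "is_addsubgroup (\<Gamma> \<inter> (*v) R ` \<Gamma>)" "is_addsubgroup (\<Gamma> \<inter> (*v) ?T ` \<Gamma>)"
        using mod(1) addsubgroup_image addsubgroup_Int by blast+
      show "?T *v a \<in> \<Gamma>" if "a \<in> (*v) R ` \<Gamma>" for a using that SO3_image_iff[OF R3] by blast
      show "?T *v x - ?T *v y \<in> \<Gamma> \<inter> (*v) ?T ` \<Gamma> \<longleftrightarrow> x - y \<in> \<Gamma> \<inter> (*v) R ` \<Gamma>" for x y
        unfolding matrix_vector_mult_diff_distrib[symmetric] Int_iff SO3_image_iff[OF T(2)] SO3_image_iff[OF R3]
        using SO3_inverse(1)[OF T(2)] by auto
      fix c assume "c \<in> \<Gamma>"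
      then have "R *v c \<in> (*v) R ` \<Gamma>" "c - ?T *v (R *v c) = 0" using SO3_inverse(1)[OF R3] by auto
      then show "\<exists>a\<in>(*v) R ` \<Gamma>. c - ?T *v a \<in> \<Gamma> \<inter> (*v) ?T ` \<Gamma>"
        using addsubgroup_zero[OF mod(1)] addsubgroup_zero[OF addsubgroup_image[OF mod(1)]] by (metis IntI)
    qed
    then show "R \<in> SOC \<Gamma>"
      unfolding SOC_def commensurate_def
      using finite_coincidence_index[OF \<Gamma> R] finite_coincidence_index[OF \<Gamma> T(1)] R3 by blast
  qed
qed

lemma coincidence_index_values:
  assumes \<Gamma>: "\<Gamma> \<in> {M_B, M_F}"
  shows "coincidence_index \<Gamma> ` SO3_Q_sqrt5 = {m. m \<ge> 1 \<and> is_golden_norm (int m)}"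
proof
  note mod = icosahedral_module[OF \<Gamma>]
  show "coincidence_index \<Gamma> ` SO3_Q_sqrt5 \<subseteq> {m. m \<ge> 1 \<and> is_golden_norm (int m)}"
  proof (clarify)
    fix R assume R: "R \<in> SO3_Q_sqrt5"
    let ?B = "\<Gamma> \<inter> (*v) R ` \<Gamma>"
    note fin = finite_coincidence_index[OF \<Gamma> R]
    have "is_golden_norm (int (add_index \<Gamma> ?B))"
    proof (rule index_is_golden_norm[OF mod(1) _ _ _ _ fin])
      show "is_addsubgroup ?B" using mod(1) addsubgroup_image addsubgroup_Int by blast
      show "golden *\<^sub>R x \<in> \<Gamma>" if "x \<in> \<Gamma>" for x using mod(2) that by simp
      then show "golden *\<^sub>R x \<in> ?B" if "x \<in> ?B" for x
        using that by (auto simp: matrix_vector_mult_scaleR[symmetric])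
    qed simp
    moreover have "add_index \<Gamma> ?B > 0" using add_index_pos[OF fin] addsubgroup_zero[OF mod(1)] by blast
    ultimately show "coincidence_index \<Gamma> R \<ge> 1 \<and> is_golden_norm (int (coincidence_index \<Gamma> R))"
      unfolding coincidence_index_def by simp
  qed
  show "{m. m \<ge> 1 \<and> is_golden_norm (int m)} \<subseteq> coincidence_index \<Gamma> ` SO3_Q_sqrt5"
  proof
    fix m assume "m \<in> {m. m \<ge> 1 \<and> is_golden_norm (int m)}"
    then obtain R where R: "has_coincidence_index R m" using golden_norm_attained by blast
    then have "coincidence_index \<Gamma> R = m" "R \<in> SO3_Q_sqrt5"
      using has_coincidence_indexD(1)[OF R \<Gamma>] has_coincidence_index_SO3
      unfolding coincidence_index_def by auto
    then show "m \<in> coincidence_index \<Gamma> ` SO3_Q_sqrt5" by blast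
  qed
qed

theorem corollary4:
  shows "SOC M_B = SO3_Q_sqrt5 \<and> SOC M_F = SO3_Q_sqrt5
    \<and> coincidence_spectrum M_B = coincidence_index M_B ` SO3_Q_sqrt5
    \<and> coincidence_spectrum M_F = coincidence_index M_F ` SO3_Q_sqrt5
    \<and> coincidence_index M_B ` SO3_Q_sqrt5
        = {m :: nat. m \<ge> 1 \<and> (\<exists>k l :: int. int m = k\<^sup>2 + k * l - l\<^sup>2)}
    \<and> coincidence_index M_F ` SO3_Q_sqrt5
        = {m :: nat. m \<ge> 1 \<and> (\<exists>k l :: int. int m = k\<^sup>2 + k * l - l\<^sup>2)}
    \<and> {m \<in> coincidence_spectrum M_B. m \<le> 25} = {1, 4, 5, 9, 11, 16, 19, 20, 25}
    \<and> Group.monoid \<lparr>carrier = coincidence_spectrum M_B, mult = (*), one = 1\<rparr>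
    \<and> coincidence_spectrum M_B
        = {m :: nat. m \<ge> 1 \<and>
             (\<forall>p :: nat. prime p \<and> ([int p = 2] (mod 5) \<or> [int p = - 2] (mod 5))
                \<longrightarrow> even (multiplicity p m))}"
proof -
  have SOC: "SOC M_B = SO3_Q_sqrt5" "SOC M_F = SO3_Q_sqrt5" by (simp_all add: SOC_icosahedral_module)
  have spec: "coincidence_spectrum M_B = coincidence_index M_B ` SO3_Q_sqrt5"
    "coincidence_spectrum M_F = coincidence_index M_F ` SO3_Q_sqrt5"
    unfolding coincidence_spectrum_def SOC by simp_all
  have vals: "coincidence_index M_B ` SO3_Q_sqrt5 = {m. m \<ge> 1 \<and> is_golden_norm (int m)}"
    "coincidence_index M_F ` SO3_Q_sqrt5 = {m. m \<ge> 1 \<and> is_golden_norm (int m)}"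
    by (simp_all add: coincidence_index_values)
  have B: "coincidence_spectrum M_B = {m. m \<ge> 1 \<and> is_golden_norm (int m)}" using spec vals by simp
  have upto: "{m \<in> coincidence_spectrum M_B. m \<le> 25} = {1, 4, 5, 9, 11, 16, 19, 20, 25}"
    unfolding B is_golden_norm_def golden_norms_upto_25[symmetric] by blast
  have monoid: "Group.monoid \<lparr>carrier = coincidence_spectrum M_B, mult = (*), one = 1\<rparr>"
    unfolding B
  proof (rule Group.monoidI)
    have "is_golden_norm (int 1)" by (rule is_golden_normI[of _ 1 0]) simp
    then show "\<one>\<^bsub>\<lparr>carrier = {m. m \<ge> 1 \<and> is_golden_norm (int m)}, mult = (*), one = 1\<rparr>\<^esub>
        \<in> carrier \<lparr>carrier = {m. m \<ge> 1 \<and> is_golden_norm (int m)}, mult = (*), one = 1\<rparr>" by simp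
  qed (auto simp: is_golden_norm_mult)
  have mult: "coincidence_spectrum M_B = {m :: nat. m \<ge> 1 \<and>
      (\<forall>p :: nat. prime p \<and> ([int p = 2] (mod 5) \<or> [int p = - 2] (mod 5)) \<longrightarrow> even (multiplicity p m))}"
    unfolding B using golden_norm_iff_even_multiplicity by blast
  show ?thesis
    using SOC spec vals[unfolded is_golden_norm_def] upto monoid mult by (intro conjI)
qed

end
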